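(* Let $\bar x\in\mathbb{R}^n$ and $(u,v)\in AC([a,b];U)\times L^1([a,b];V)$, and let $x:[a,b]\to\mathbb{R}^n$ be a map. Assume one of the following two conditions. (A) The vector fields $g_1,\dots,g_m$ satisfy Hypothesis (CC), and $x$ is a limit solution of the Cauchy problem $$\dot x=f(t,x,u,v)+\sum_{\alpha=1}^m g_\alpha(x)\,\dot u_\alpha,\quad t\in[a,b],\qquad x(a)=\bar x,$$ corresponding to $\bar x$ and $(u,v)$. (B) $x\in AC([a,b];\mathbb{R}^n)$ and $x$ is a BV simple limit solution of this Cauchy problem corresponding to $\bar x$ and $(u,v)$. Then $x$ coincides with $x[\bar x,u,v]$, the (unique) Carathéodory solution of the Cauchy problem corresponding to $\bar x$ and $(u,v)$.
   Context: Notation. $[a,b]$ is a compact interval. For $E\subset\mathbb{R}^d$: $\mathcal{L}^1([a,b];E)$ is the set of pointwise (everywhere) defined Lebesgue integrable functions from $[a,b]$ with values in $E$, while $L^1([a,b];E)$ is the corresponding set of equivalence classes modulo equality a.e.; $AC([a,b];E)$ is the set of absolutely continuous maps from $[a,b]$ to $E$. $\|\cdot\|_1$ is the $L^1$-norm. Standing hypotheses. Here $f:[a,b]\times\mathbb{R}^n\times\mathbb{R}^m\times V\to\mathbb{R}^n$ and $g_1,\dots,g_m:\mathbb{R}^n\to\mathbb{R}^n$. (i) $U\subset\mathbb{R}^m$ is compact and such that for every bounded interval $I\subset\mathbb{R}$, each $\tau\in I$ and every $w\in\mathcal{L}^1(I;U)$ there is a sequence $(w_k^\tau)\subset AC(I;U)$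 with $|w_k^\tau(\tau)-w(\tau)|+\|w_k^\tau-w\|_1\to0$. (ii) $V\subset\mathbb{R}^l$ is compact. (iii) For each $(x,u,v)$ the map $t\mapsto f(t,x,u,v)$ is measurable on $[a,b]$; for each $t\in[a,b]$ the map $(x,u,v)\mapsto f(t,x,u,v)$ is continuous on $\mathbb{R}^n\times\mathbb{R}^m\times V$; and $(x,u)\mapsto f(t,x,u,v)$ is locally Lipschitz on $\mathbb{R}^n\times\mathbb{R}^m$, uniformly in $(t,v)\in[a,b]\times V$. (iv) Each $g_\alpha$ is of class $C^1$. (v) There is $M>0$ with $|(f(t,x,u,v),g_1(x),\dots,g_m(x))|\le M(1+|(x,u)|)$ for every $(x,u)\in\mathbb{R}^n\times\mathbb{R}^m$, uniformly in $(t,v)\in[a,b]\times V$. Under (ii)–(v), for $\bar x\in\mathbb{R}^n$ and $(u,v)\in AC([a,b];U)\times L^1([a,b];V)$ the Cauchy problem has a unique Carathéodory solution on $[a,b]$, denoted $x[\bar x,u,v]$. Limit solutions. Let $\bar x\in\mathbb{R}^n$, $u\in\mathcal{L}^1([a,b];U)$, $v\in L^1([a,b];V)$. A map $x:[a,b]\to\mathbb{R}^n$ is a limit solution of the Cauchy problem corresponding to $\bar x$ and $(u,v)$ if for every $\tau\in[a,b]$ there is a sequence $(u_k^\tau)$ of absolutely continuous maps from $[a,b]$ into $U$ such that: for each $k$ there exists a Carathéodory solution $x_k^\tau:[a,b]\to\mathbb{R}^n$ of the Cauchy problem with initial value $\bar x$ and control $(u_k^\tau,v)$, the sequence $(x_k^\tau)$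 is bounded, and $$|(x_k^\tau,u_k^\tau)(\tau)-(x,u)(\tau)|+\|(x_k^\tau,u_k^\tau)-(x,u)\|_1\to0 .$$ A limit solution is simple if $(u_k^\tau)$ can be chosen independently of $\tau$ (the sequence is then written $(u_k)$). A simple limit solution is a BV simple limit solution if the approximating inputs $u_k$ (chosen independently of $\tau$) have equibounded variation on $[a,b]$. Hypothesis (CC). For all $\alpha,\beta=1,\dots,m$ one has $[g_\alpha,g_\beta](x)=0$ for every $x\in\mathbb{R}^n$, where $[g_\alpha,g_\beta]:=Dg_\beta\,g_\alpha-Dg_\alpha\,g_\beta$ is the Lie bracket; and each $g_\alpha$ is complete, i.e. for every $\bar x\in\mathbb{R}^n$ the solution of $\dot x=g_\alpha(x)$, $x(0)=\bar x$ is (uniquely) defined on all of $\mathbb{R}$. *)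

theory Defs
  imports "HOL-Analysis.Analysis"
begin

section \<open>Absolutely continuous functions and functions of bounded variation\<close>

text \<open>Members of a division are nondegenerate or degenerate compact intervals, so
  \<open>K = {Inf K..Sup K}\<close>; distinct members have disjoint interiors. The set \<open>I\<close> is
  meant to be an interval, not necessarily closed.\<close>

definition abs_continuous_on :: "real set \<Rightarrow> (real \<Rightarrow> 'a::real_normed_vector) \<Rightarrow> bool" where
  "abs_continuous_on I w \<longleftrightarrow>
     (\<forall>\<epsilon>>0. \<exists>\<delta>>0. \<forall>D S. D division_of S \<and> S \<subseteq> I \<and> (\<Sum>K\<in>D. Sup K - Inf K) < \<delta>
        \<longrightarrow> (\<Sum>K\<in>D. norm (w (Sup K) - w (Inf K))) < \<epsilon>)"

definition AC :: "real set \<Rightarrow> 'a::real_normed_vector set \<Rightarrow> (real \<Rightarrow> 'a) set" where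
  "AC I E = {w. abs_continuous_on I w \<and> (\<forall>t\<in>I. w t \<in> E)}"

definition equibounded_variation :: "real \<Rightarrow> real \<Rightarrow> (nat \<Rightarrow> real \<Rightarrow> 'a::real_normed_vector) \<Rightarrow> bool" where
  "equibounded_variation a b w \<longleftrightarrow>
     (\<exists>C. \<forall>k D. D division_of {a..b} \<longrightarrow> (\<Sum>K\<in>D. norm (w k (Sup K) - w k (Inf K))) \<le> C)"

section \<open>Integrable functions\<close>

text \<open>\<open>L1_fun I E\<close> is the set of everywhere defined integrable functions with values in
  \<open>E\<close>. A function in \<open>L1_rep I E\<close> is a representative of an element of the quotient
  space, so it needs to lie in \<open>E\<close> only almost everywhere.\<close>

definition L1_fun :: "real set \<Rightarrow> 'a::euclidean_space set \<Rightarrow> (real \<Rightarrow> 'a) set" where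
  "L1_fun I E = {w. integrable (lebesgue_on I) w \<and> (\<forall>t\<in>I. w t \<in> E)}"

definition L1_rep :: "real set \<Rightarrow> 'a::euclidean_space set \<Rightarrow> (real \<Rightarrow> 'a) set" where
  "L1_rep I E = {w. integrable (lebesgue_on I) w \<and> (AE t in lebesgue_on I. w t \<in> E)}"

text \<open>The integrability requirement is needed because the Bochner integral of a
  non-integrable function is \<open>0\<close> by convention.\<close>

definition point_L1_tendsto ::
  "real set \<Rightarrow> real \<Rightarrow> (nat \<Rightarrow> real \<Rightarrow> 'a::euclidean_space) \<Rightarrow> (real \<Rightarrow> 'a) \<Rightarrow> bool" where
  "point_L1_tendsto I \<tau> w\<^sub>k w \<longleftrightarrow>
     (\<forall>k. integrable (lebesgue_on I) (\<lambda>t. w\<^sub>k k t - w t)) \<and>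
     (\<lambda>k. norm (w\<^sub>k k \<tau> - w \<tau>) + (LINT t|lebesgue_on I. norm (w\<^sub>k k t - w t))) \<longlonglongrightarrow> 0"

definition AC_approximable :: "'a::euclidean_space set \<Rightarrow> bool" where
  "AC_approximable U \<longleftrightarrow>
     (\<forall>I. is_interval I \<and> bounded I \<longrightarrow>
       (\<forall>\<tau>\<in>I. \<forall>w\<in>L1_fun I U. \<exists>w\<^sub>k. (\<forall>k. w\<^sub>k k \<in> AC I U) \<and> point_L1_tendsto I \<tau> w\<^sub>k w))"

section \<open>Vector fields\<close>

definition C1_field :: "('a::euclidean_space \<Rightarrow> 'a) \<Rightarrow> bool" where
  "C1_field h \<longleftrightarrow>
     (\<exists>h' :: 'a \<Rightarrow> 'a \<Rightarrow>\<^sub>L 'a. (\<forall>x. (h has_derivative blinfun_apply (h' x)) (at x)) \<and>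
        continuous_on UNIV h')"

definition lie_bracket :: "('a::euclidean_space \<Rightarrow> 'a) \<Rightarrow> ('a \<Rightarrow> 'a) \<Rightarrow> 'a \<Rightarrow> 'a" where
  "lie_bracket h\<^sub>1 h\<^sub>2 x =
     frechet_derivative h\<^sub>2 (at x) (h\<^sub>1 x) - frechet_derivative h\<^sub>1 (at x) (h\<^sub>2 x)"

definition complete_field :: "('a::euclidean_space \<Rightarrow> 'a) \<Rightarrow> bool" where
  "complete_field h \<longleftrightarrow>
     (\<forall>x\<^sub>0. \<exists>!y :: real \<Rightarrow> 'a. y 0 = x\<^sub>0 \<and> (\<forall>t. (y has_vector_derivative h (y t)) (at t)))"

definition commuting_complete :: "('m \<Rightarrow> 'a::euclidean_space \<Rightarrow> 'a) \<Rightarrow> bool" where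
  "commuting_complete g \<longleftrightarrow>
     (\<forall>\<alpha> \<beta> x. lie_bracket (g \<alpha>) (g \<beta>) x = 0) \<and> (\<forall>\<alpha>. complete_field (g \<alpha>))"

section \<open>Caratheodory and limit solutions\<close>

text \<open>Solutions are total functions of which only the restriction to \<open>{a..b}\<close> matters.\<close>

definition caratheodory_solution ::
  "real \<Rightarrow> real \<Rightarrow> (real \<Rightarrow> real^'n \<Rightarrow> real^'m \<Rightarrow> real^'l \<Rightarrow> real^'n) \<Rightarrow> ('m \<Rightarrow> real^'n \<Rightarrow> real^'n)
   \<Rightarrow> real^'n \<Rightarrow> (real \<Rightarrow> real^'m) \<Rightarrow> (real \<Rightarrow> real^'l) \<Rightarrow> (real \<Rightarrow> real^'n) \<Rightarrow> bool" where
  "caratheodory_solution a b f g x\<^sub>0 u v x \<longleftrightarrow>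
     abs_continuous_on {a..b} x \<and> x a = x\<^sub>0 \<and>
     (AE t in lebesgue_on {a..b}. \<exists>u'.
        (u has_vector_derivative u') (at t within {a..b}) \<and>
        (x has_vector_derivative f t (x t) (u t) (v t) + (\<Sum>\<alpha>\<in>UNIV. u' $ \<alpha> *\<^sub>R g \<alpha> (x t)))
          (at t within {a..b}))"

definition approximates_at ::
  "real \<Rightarrow> real \<Rightarrow> (real \<Rightarrow> real^'n \<Rightarrow> real^'m \<Rightarrow> real^'l \<Rightarrow> real^'n) \<Rightarrow> ('m \<Rightarrow> real^'n \<Rightarrow> real^'n)
   \<Rightarrow> (real^'m) set \<Rightarrow> real^'n \<Rightarrow> (real \<Rightarrow> real^'m) \<Rightarrow> (real \<Rightarrow> real^'l) \<Rightarrow> (real \<Rightarrow> real^'n)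
   \<Rightarrow> real \<Rightarrow> (nat \<Rightarrow> real \<Rightarrow> real^'m) \<Rightarrow> bool" where
  "approximates_at a b f g U x\<^sub>0 u v x \<tau> u\<^sub>k \<longleftrightarrow>
     (\<forall>k. u\<^sub>k k \<in> AC {a..b} U) \<and>
     (\<exists>x\<^sub>k. (\<forall>k. caratheodory_solution a b f g x\<^sub>0 (u\<^sub>k k) v (x\<^sub>k k)) \<and>
        (\<exists>B. \<forall>k. \<forall>t\<in>{a..b}. norm (x\<^sub>k k t) \<le> B) \<and>
        point_L1_tendsto {a..b} \<tau> (\<lambda>k t. (x\<^sub>k k t, u\<^sub>k k t)) (\<lambda>t. (x t, u t)))"

definition limit_solution where
  "limit_solution a b f g U x\<^sub>0 u v x \<longleftrightarrow>
     (\<forall>\<tau>\<in>{a..b}. \<exists>u\<^sub>k. approximates_at a b f g U x\<^sub>0 u v x \<tau> u\<^sub>k)"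

definition BV_simple_limit_solution where
  "BV_simple_limit_solution a b f g U x\<^sub>0 u v x \<longleftrightarrow>
     (\<exists>u\<^sub>k. equibounded_variation a b u\<^sub>k \<and>
        (\<forall>\<tau>\<in>{a..b}. approximates_at a b f g U x\<^sub>0 u v x \<tau> u\<^sub>k))"

end

theory Submission
  imports Defs
begin

text \<open>An absolutely continuous function is differentiable almost everywhere (Vitali covering) and
  is the integral of its derivative. Hence a solution is determined by its input, by an integral
  inequality, and only existence is at stake: the limit \<open>x\<close> must be shown to solve the equation.

  If the fields commute and are complete, their flows combine to a map \<open>\<Psi> p z\<close> with
  \<open>\<Psi> p 0 = p\<close> and \<open>z\<close>-derivative \<open>\<lambda>k. \<Sum>\<alpha>. k\<^sub>\<alpha> g\<^sub>\<alpha>\<close>. For a solution \<open>x\<close> with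
  input \<open>u\<close> one gets
  \<open>|x t - \<Psi> (x s) (u t - u s) - \<integral> f| \<le> K \<integral> |u t - u r| dr\<close> on \<open>[s, t]\<close>, with \<open>K\<close> depending
  only on bounds for \<open>x\<close> and \<open>u\<close>. No derivative of \<open>u\<close> appears, so the estimate passes to \<open>L\<^sup>1\<close> limits, and
  \<open>t \<rightarrow> s\<close> gives the differential equation.

  For inputs of equibounded variation, the error of an Euler step is quadratic in the variation
  \<open>W\<close> of the input over the step. Only boundedly many steps of a fine partition have large
  \<open>W\<close>, and over these the continuous limit hardly moves; over the others the errors sum to
  the order of \<open>max W\<close> times the total variation.\<close>

section \<open>Absolutely continuous functions\<close>

text \<open>Different obstacles shape the two existence proofs. With commuting fields the
  approximating sequence may change with \<open>\<tau>\<close>, and each one converges, after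
  thinning, only almost everywhere and at its own \<open>\<tau>\<close>. Estimates therefore hold
  off a null set, and the value of \<open>x\<close> at a given time is recovered by approaching it
  through points that are good for two sequences at once. Absolute continuity of \<open>x\<close> is
  a result there: its increments are bounded by those of \<open>u\<close> and of time. The flow map
  enters through \<open>|\<Psi> p z - \<Psi> q z - (p - q)| \<le> C |z| |p - q|\<close>, which
  Gronwall's inequality yields without differentiating in \<open>p\<close>.

  With bounded variation one sequence serves all times, and uniqueness of solutions makes it
  converge everywhere. However, the variation of the approximations may concentrate, so the
  quadratic errors need not be small on every step. Errors are compared after capping them at
  \<open>\<rho> = \<epsilon>^2\<close>: a step of variation above \<open>\<epsilon>\<close> then
  costs at most \<open>\<epsilon>\<close> times its variation, while continuity of \<open>u\<close>
  and \<open>x\<close> makes the cap invisible in the limit.\<close>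

lemma abs_continuous_onD:
  assumes "abs_continuous_on I w" "0 < \<epsilon>"
  obtains \<delta> where "0 < \<delta>"
    "\<And>D S. \<lbrakk>D division_of S; S \<subseteq> I; (\<Sum>K\<in>D. Sup K - Inf K) < \<delta>\<rbrakk>
       \<Longrightarrow> (\<Sum>K\<in>D. norm (w (Sup K) - w (Inf K))) < \<epsilon>"
  using assms unfolding abs_continuous_on_def by metis

lemma abs_continuous_on_subset:
  "abs_continuous_on I w \<Longrightarrow> J \<subseteq> I \<Longrightarrow> abs_continuous_on J w"
  unfolding abs_continuous_on_def by (meson order_trans)

lemma abs_continuous_on_dominated:
  fixes w :: "real \<Rightarrow> 'a::real_normed_vector" and y :: "real \<Rightarrow> 'b::real_normed_vector"
  assumes w: "abs_continuous_on I w"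
    and le: "\<And>s t. s \<in> I \<Longrightarrow> t \<in> I \<Longrightarrow> norm (y t - y s) \<le> C * norm (w t - w s)"
  shows "abs_continuous_on I y"
  unfolding abs_continuous_on_def
proof (intro allI impI)
  fix \<epsilon> :: real assume "0 < \<epsilon>"
  \<comment> \<open>The sign of \<open>C\<close> is not prescribed; enlarging it to a positive
    \<open>C'\<close> makes \<open>\<epsilon> / C'\<close> a legitimate tolerance.\<close>
  define C' where "C' = \<bar>C\<bar> + 1"
  have C': "C' > 0" "C \<le> C'" by (auto simp: C'_def)
  obtain \<delta> where \<delta>: "0 < \<delta>"
    "\<And>D S. \<lbrakk>D division_of S; S \<subseteq> I; (\<Sum>K\<in>D. Sup K - Inf K) < \<delta>\<rbrakk>
       \<Longrightarrow> (\<Sum>K\<in>D. norm (w (Sup K) - w (Inf K))) < \<epsilon> / C'"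
    by (rule abs_continuous_onD[OF w, of "\<epsilon> / C'"]) (use \<open>0 < \<epsilon>\<close> C' in auto)
  have "(\<Sum>K\<in>D. norm (y (Sup K) - y (Inf K))) < \<epsilon>"
    if D: "D division_of S" and S: "S \<subseteq> I" and l: "(\<Sum>K\<in>D. Sup K - Inf K) < \<delta>" for D S
  proof -
    have "norm (y (Sup K) - y (Inf K)) \<le> C' * norm (w (Sup K) - w (Inf K))" if "K \<in> D" for K
    proof -
      obtain c d where K: "K = {c..d}" "c \<le> d"
        using division_ofD(3,4)[OF D \<open>K \<in> D\<close>] by (metis atLeastatMost_empty_iff box_real(2))
      have "K \<subseteq> I" using division_ofD(2)[OF D \<open>K \<in> D\<close>] S by auto
      then have "Sup K \<in> I" "Inf K \<in> I" using K by auto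
      then have "norm (y (Sup K) - y (Inf K)) \<le> C * norm (w (Sup K) - w (Inf K))"
        using le by blast
      also have "\<dots> \<le> C' * norm (w (Sup K) - w (Inf K))"
        using C' by (intro mult_right_mono) auto
      finally show ?thesis .
    qed
    then have "(\<Sum>K\<in>D. norm (y (Sup K) - y (Inf K))) \<le> C' * (\<Sum>K\<in>D. norm (w (Sup K) - w (Inf K)))"
      unfolding sum_distrib_left by (rule sum_mono)
    also have "\<dots> < \<epsilon>"
      using \<delta>(2)[OF D S l] C' by (simp add: pos_less_divide_eq mult.commute)
    finally show ?thesis .
  qed
  then show "\<exists>\<delta>>0. \<forall>D S. D division_of S \<and> S \<subseteq> I \<and> (\<Sum>K\<in>D. Sup K - Inf K) < \<delta> \<longrightarrow>
      (\<Sum>K\<in>D. norm (y (Sup K) - y (Inf K))) < \<epsilon>"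
    using \<delta>(1) by blast
qed

text \<open>The two dominating functions are joined into one pair-valued function. This is how
  trajectories become absolutely continuous: their increments are controlled by those of the input
  together with those of time or of the state.\<close>

lemma abs_continuous_on_add_dominated:
  fixes w :: "real \<Rightarrow> 'a::real_normed_vector" and y :: "real \<Rightarrow> 'b::real_normed_vector"
    and z :: "real \<Rightarrow> 'c::real_normed_vector"
  assumes w: "abs_continuous_on I w" and z: "abs_continuous_on I z"
    and le: "\<And>s t. s \<in> I \<Longrightarrow> t \<in> I \<Longrightarrow> norm (y t - y s) \<le> C * (norm (w t - w s) + norm (z t - z s))"
  shows "abs_continuous_on I y"
proof -
  have "abs_continuous_on I (\<lambda>t. (w t, z t))"
    unfolding abs_continuous_on_def
  proof (intro allI impI)
    fix \<epsilon> :: real assume "0 < \<epsilon>"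
    then have e2: "\<epsilon>/2 > 0" by simp
    obtain \<delta>1 where \<delta>1: "0 < \<delta>1"
      "\<And>D S. \<lbrakk>D division_of S; S \<subseteq> I; (\<Sum>K\<in>D. Sup K - Inf K) < \<delta>1\<rbrakk>
         \<Longrightarrow> (\<Sum>K\<in>D. norm (w (Sup K) - w (Inf K))) < \<epsilon> / 2"
      by (rule abs_continuous_onD[OF w e2]) blast
    obtain \<delta>2 where \<delta>2: "0 < \<delta>2"
      "\<And>D S. \<lbrakk>D division_of S; S \<subseteq> I; (\<Sum>K\<in>D. Sup K - Inf K) < \<delta>2\<rbrakk>
         \<Longrightarrow> (\<Sum>K\<in>D. norm (z (Sup K) - z (Inf K))) < \<epsilon> / 2"
      by (rule abs_continuous_onD[OF z e2]) blast
    have "(\<Sum>K\<in>D. norm ((w (Sup K), z (Sup K)) - (w (Inf K), z (Inf K)))) < \<epsilon>"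
      if D: "D division_of S" "S \<subseteq> I" "(\<Sum>K\<in>D. Sup K - Inf K) < min \<delta>1 \<delta>2" for D S
    proof -
      have "(\<Sum>K\<in>D. norm ((w (Sup K), z (Sup K)) - (w (Inf K), z (Inf K))))
          \<le> (\<Sum>K\<in>D. norm (w (Sup K) - w (Inf K)) + norm (z (Sup K) - z (Inf K)))"
        by (intro sum_mono) (simp add: norm_Pair sqrt_sum_squares_le_sum_abs[of "norm _" "norm _", simplified])
      also have "\<dots> < \<epsilon>" using \<delta>1(2)[of D S] \<delta>2(2)[of D S] D by (simp add: sum.distrib)
      finally show ?thesis .
    qed
    then show "\<exists>\<delta>>0. \<forall>D S. D division_of S \<and> S \<subseteq> I \<and> (\<Sum>K\<in>D. Sup K - Inf K) < \<delta> \<longrightarrow>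
      (\<Sum>K\<in>D. norm ((w (Sup K), z (Sup K)) - (w (Inf K), z (Inf K)))) < \<epsilon>"
      using \<delta>1(1) \<delta>2(1) by (intro exI[of _ "min \<delta>1 \<delta>2"]) auto
  qed
  then show ?thesis
  proof (rule abs_continuous_on_dominated)
    fix s t assume st: "s \<in> I" "t \<in> I"
    have "norm (w t - w s) + norm (z t - z s) \<le> 2 * norm ((w t, z t) - (w s, z s))"
      using norm_fst_le[of "w t - w s" "z t - z s"] norm_snd_le[where x="w t - w s" and y="z t - z s"] by simp
    then have "\<bar>C\<bar> * (norm (w t - w s) + norm (z t - z s)) \<le> \<bar>C\<bar> * (2 * norm ((w t, z t) - (w s, z s)))"
      by (intro mult_left_mono) auto
    moreover have "C * (norm (w t - w s) + norm (z t - z s)) \<le> \<bar>C\<bar> * (norm (w t - w s) + norm (z t - z s))"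
      by (intro mult_right_mono) auto
    ultimately show "norm (y t - y s) \<le> (2 * \<bar>C\<bar>) * norm ((w t, z t) - (w s, z s))"
      using le[OF st] by (simp add: mult.assoc mult.left_commute)
  qed
qed

lemma abs_continuous_on_ident: "abs_continuous_on I (\<lambda>t::real. t)"
  unfolding abs_continuous_on_def
proof (intro allI impI)
  fix \<epsilon> :: real assume "0 < \<epsilon>"
  have "(\<Sum>K\<in>D. norm (Sup K - Inf K)) = (\<Sum>K\<in>D. Sup K - Inf K)"
    if D: "D division_of S" for D and S :: "real set"
  proof (rule sum.cong)
    fix K assume "K \<in> D"
    obtain c d where "K = {c..d}" "c \<le> d"
      using division_ofD(3,4)[OF D \<open>K \<in> D\<close>] by (metis atLeastatMost_empty_iff box_real(2))
    then show "norm (Sup K - Inf K) = Sup K - Inf K" by auto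
  qed auto
  then show "\<exists>\<delta>>0. \<forall>D S. D division_of S \<and> S \<subseteq> I \<and> (\<Sum>K\<in>D. Sup K - Inf K) < \<delta> \<longrightarrow>
      (\<Sum>K\<in>D. norm (Sup K - Inf K)) < \<epsilon>"
    using \<open>0 < \<epsilon>\<close> by (intro exI[of _ \<epsilon>]) auto
qed

lemma abs_continuous_on_imp_continuous:
  fixes w :: "real \<Rightarrow> 'a::real_normed_vector"
  assumes "abs_continuous_on {a..b} w"
  shows "continuous_on {a..b} w"
  unfolding continuous_on_iff
proof (intro ballI allI impI)
  fix t \<epsilon> :: real assume t: "t \<in> {a..b}" and "0 < \<epsilon>"
  obtain \<delta> where \<delta>: "0 < \<delta>"
    "\<And>D S. \<lbrakk>D division_of S; S \<subseteq> {a..b}; (\<Sum>K\<in>D. Sup K - Inf K) < \<delta>\<rbrakk>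
       \<Longrightarrow> (\<Sum>K\<in>D. norm (w (Sup K) - w (Inf K))) < \<epsilon>"
    by (rule abs_continuous_onD[OF assms \<open>0 < \<epsilon>\<close>]) blast
  have *: "norm (w d - w c) < \<epsilon>" if "c \<le> d" "c \<in> {a..b}" "d \<in> {a..b}" "d - c < \<delta>" for c d
    using \<delta>(2)[of "{{c..d}}" "{c..d}"] division_of_self[of c d] that by (auto simp: box_real)
  have "dist (w s) (w t) < \<epsilon>" if "s \<in> {a..b}" "dist s t < \<delta>" for s
    using *[of s t] *[of t s] t that by (cases "s \<le> t") (auto simp: dist_norm norm_minus_commute)
  then show "\<exists>d>0. \<forall>s\<in>{a..b}. dist s t < d \<longrightarrow> dist (w s) (w t) < \<epsilon>"
    using \<delta>(1) by blast
qed

text \<open>On the exceptional null set the gauge forces the tagged intervals into an open set of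
  small measure, where absolute continuity makes the increments negligible.\<close>

theorem abs_continuous_has_integral_derivative:
  fixes w :: "real \<Rightarrow> 'a::real_normed_vector"
  assumes ab: "a \<le> b" and ac: "abs_continuous_on {a..b} w" and N: "negligible N"
    and d: "\<And>t. t \<in> {a..b} - N \<Longrightarrow> (w has_vector_derivative d t) (at t within {a..b})"
  shows "(d has_integral w b - w a) {a..b}"
proof -
  \<comment> \<open>With the integrand zero on \<open>N\<close>, an interval tagged in
    \<open>N\<close> contributes nothing but the increment of \<open>w\<close>; the spike at the end
    undoes the change.\<close>
  define d' where "d' t = (if t \<in> N then 0 else d t)" for t
  have "(d' has_integral w b - w a) (cbox a b)"
    unfolding has_integral
  proof (intro allI impI)
    fix e :: real assume "0 < e"
    then have e2: "e / 2 > 0" by simp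
    obtain \<delta> where \<delta>: "0 < \<delta>"
      "\<And>D S. \<lbrakk>D division_of S; S \<subseteq> {a..b}; (\<Sum>K\<in>D. Sup K - Inf K) < \<delta>\<rbrakk>
         \<Longrightarrow> (\<Sum>K\<in>D. norm (w (Sup K) - w (Inf K))) < e / 2"
      by (rule abs_continuous_onD[OF ac e2]) blast
    obtain T where T: "open T" "N \<subseteq> T" "T - N \<in> lmeasurable" "emeasure lebesgue (T - N) < ennreal \<delta>"
      using sets_lebesgue_outer_open[of N \<delta>] N \<delta>(1) negligible_imp_sets by blast
    have TL: "T \<in> lmeasurable" "measure lebesgue T < \<delta>"
    proof -
      have "T = (T - N) \<union> N" using T(2) by auto
      moreover have NL: "N \<in> lmeasurable" "measure lebesgue N = 0"
        using N negligible_imp_measurable negligible_imp_measure0 by auto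
      ultimately show "T \<in> lmeasurable" using T(3) by (metis fmeasurable.Un)
      have "measure lebesgue T \<le> measure lebesgue (T - N) + measure lebesgue N"
        using \<open>T = (T - N) \<union> N\<close> measure_Un_le[of "T - N" lebesgue N] T(3) NL(1)
        by (metis fmeasurableD)
      also have "\<dots> < \<delta>" using T(3,4) NL(2) \<delta>(1)
        by (simp add: emeasure_eq_measure2 ennreal_less_iff)
      finally show "measure lebesgue T < \<delta>" .
    qed
    \<comment> \<open>Half of \<open>e\<close> is spread over the intervals with tags off
      \<open>N\<close>; the summand 1 keeps the quotient defined when \<open>a = b\<close>.\<close>
    define e' where "e' = e / (2 * (b - a + 1))"
    have e': "e' > 0" using \<open>0 < e\<close> ab by (simp add: e'_def)
    have "\<exists>r>0. \<forall>y\<in>{a..b}. \<bar>y - t\<bar> < r \<longrightarrow> norm (w y - w t - (y - t) *\<^sub>R d t) \<le> e' * \<bar>y - t\<bar>"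
      if "t \<in> {a..b} - N" for t
      using d[OF that] e' unfolding has_vector_derivative_def has_derivative_within_alt
      by (metis real_norm_def)
    then obtain r where r: "\<And>t. t \<in> {a..b} - N \<Longrightarrow> r t > 0"
      "\<And>t y. \<lbrakk>t \<in> {a..b} - N; y \<in> {a..b}; \<bar>y - t\<bar> < r t\<rbrakk>
          \<Longrightarrow> norm (w y - w t - (y - t) *\<^sub>R d t) \<le> e' * \<bar>y - t\<bar>"
      by metis
    \<comment> \<open>The last branch only makes the gauge total: tags of a division of
      \<open>[a, b]\<close> never reach it.\<close>
    define \<gamma> where "\<gamma> t = (if t \<in> N then T else if t \<in> {a..b} then ball t (r t) else ball t 1)" for t
    have g: "gauge \<gamma>"
      using T r(1) by (auto simp: gauge_def \<gamma>_def)
    have lt: "norm ((\<Sum>(x,K)\<in>D. measure lborel K *\<^sub>R d' x) - (w b - w a)) < e"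
      if D: "D tagged_division_of cbox a b" "\<gamma> fine D" for D
    proof -
      note fin = tagged_division_ofD(1)[OF D(1)]
      have Dp: "D tagged_partial_division_of cbox a b"
        using D(1) by (simp add: tagged_division_of_def)
      have K: "\<exists>c e. K = {c..e} \<and> c \<le> x \<and> x \<le> e \<and> a \<le> c \<and> e \<le> b \<and> measure lborel K = e - c
           \<and> Inf K = c \<and> Sup K = e"
        if xK: "(x, K) \<in> D" for x K
      proof -
        obtain c e where ce: "K = cbox c e" using tagged_division_ofD(4)[OF D(1) xK] by auto
        moreover have "x \<in> K" "K \<subseteq> cbox a b"
          using tagged_division_ofD(2,3)[OF D(1) xK] by auto
        ultimately have "c \<le> x" "x \<le> e" by auto
        moreover from this have "c \<in> cbox a b" "e \<in> cbox a b"
          using \<open>K \<subseteq> cbox a b\<close> ce by auto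
        ultimately show ?thesis using ce by auto
      qed
      define P where "P = {(x,K) \<in> D. x \<in> N}"
      have PD: "P \<subseteq> D" by (auto simp: P_def)
      let ?g = "\<lambda>x K. norm (measure lborel K *\<^sub>R d' x - (w (Sup K) - w (Inf K)))"
      have tel: "(\<Sum>(x,K)\<in>D. w (Sup K) - w (Inf K)) = w b - w a"
        using additive_tagged_division_1[OF ab, of D w] D(1) by (simp add: box_real)
      have "norm ((\<Sum>(x,K)\<in>D. measure lborel K *\<^sub>R d' x) - (w b - w a))
          = norm (\<Sum>(x,K)\<in>D. measure lborel K *\<^sub>R d' x - (w (Sup K) - w (Inf K)))"
        unfolding tel[symmetric] by (simp add: sum_subtractf split_def)
      also have "\<dots> \<le> (\<Sum>(x,K)\<in>D. ?g x K)"
        unfolding split_def by (rule norm_sum)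
      also have "\<dots> = (\<Sum>(x,K)\<in>P. ?g x K) + (\<Sum>(x,K)\<in>D - P. ?g x K)"
        using sum.subset_diff[OF PD fin, of "\<lambda>(x,K). ?g x K"] by simp
      also have "(\<Sum>(x,K)\<in>P. ?g x K) < e / 2"
      proof -
        \<comment> \<open>Passing from tagged pairs to intervals asks for a function that vanishes
          on degenerate intervals. The increment does so anyway; the case distinction makes this
          explicit.\<close>
        let ?h = "\<lambda>K. if measure lborel K = 0 then 0 else norm (w (Sup K) - w (Inf K))"
        have Pp: "P tagged_partial_division_of cbox a b"
          using tagged_partial_division_subset[OF Dp PD] .
        have div: "snd ` P division_of \<Union>(snd ` P)"
          by (rule partial_division_of_tagged_division[OF Pp])
        have "(\<Sum>(x,K)\<in>P. ?g x K) = (\<Sum>(x,K)\<in>P. ?h K)"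
        proof (rule sum.cong, simp, safe)
          fix x K assume "(x, K) \<in> P"
          then have xK: "(x, K) \<in> D" "x \<in> N" by (auto simp: P_def)
          with K[OF xK(1)] show "?g x K = ?h K" by (auto simp: d'_def norm_minus_commute)
        qed
        also have "\<dots> = sum ?h (snd ` P)"
          by (rule sum.over_tagged_division_lemma[OF tagged_partial_division_of_Union_self[OF Pp]])
             (simp add: content_eq_0_interior)
        also have "\<dots> \<le> (\<Sum>K\<in>snd ` P. norm (w (Sup K) - w (Inf K)))"
          by (intro sum_mono) auto
        also have "\<dots> < e / 2"
        proof (rule \<delta>(2)[OF div])
          show "\<Union>(snd ` P) \<subseteq> {a..b}"
          proof safe
            fix y x k assume y: "y \<in> snd (x, k)" "(x, k) \<in> P"
            then have "(x, k) \<in> D" using PD by blast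
            from tagged_division_ofD(3)[OF D(1) this] show "y \<in> {a..b}" using y by auto
          qed
          have "(\<Sum>K\<in>snd ` P. Sup K - Inf K) = (\<Sum>K\<in>snd ` P. measure lebesgue K)"
          proof (intro sum.cong refl)
            fix k assume "k \<in> snd ` P"
            then obtain x where "(x, k) \<in> D" using PD by auto
            from K[OF this] obtain c e where "k = {c..e}" "c \<le> e" by force
            then show "Sup k - Inf k = measure lebesgue k" by simp
          qed
          also have "\<dots> = measure lebesgue (\<Union>(snd ` P))"
            using content_division[OF div] by simp
          also have "\<dots> \<le> measure lebesgue T"
          proof (rule measure_mono_fmeasurable)
            show "\<Union>(snd ` P) \<subseteq> T"
            proof safe
              fix y x k assume yk: "y \<in> snd (x, k)" "(x, k) \<in> P"
              then have "k \<subseteq> \<gamma> x" "x \<in> N" using D(2) by (auto simp: fine_def P_def)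
              then show "y \<in> T" using yk by (auto simp: \<gamma>_def)
            qed
            show "\<Union>(snd ` P) \<in> sets lebesgue"
              using lmeasurable_division[OF div] by auto
          qed (use TL in auto)
          finally show "(\<Sum>K\<in>snd ` P. Sup K - Inf K) < \<delta>" using TL(2) by simp
        qed
        finally show ?thesis .
      qed
      also have "(\<Sum>(x,K)\<in>D - P. ?g x K) \<le> (\<Sum>(x,K)\<in>D - P. e' * measure lborel K)"
      proof (rule sum_mono, safe)
        fix x K assume xK: "(x, K) \<in> D" "(x, K) \<notin> P"
        then have "x \<notin> N" by (auto simp: P_def)
        obtain c e where ce: "K = {c..e}" "c \<le> x" "x \<le> e" "a \<le> c" "e \<le> b" "measure lborel K = e - c"
            "Inf K = c" "Sup K = e"
          using K[OF xK(1)] by blast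
        have x: "x \<in> {a..b} - N" using ce \<open>x \<notin> N\<close> by auto
        have "K \<subseteq> ball x (r x)"
          using fineD[OF D(2) xK(1)] x by (auto simp: \<gamma>_def)
        moreover have "c \<in> K" "e \<in> K" using ce by auto
        ultimately have "\<bar>c - x\<bar> < r x" "\<bar>e - x\<bar> < r x" by (auto simp: dist_real_def abs_minus_commute)
        then have 1: "norm (w c - w x - (c - x) *\<^sub>R d x) \<le> e' * \<bar>c - x\<bar>"
          "norm (w e - w x - (e - x) *\<^sub>R d x) \<le> e' * \<bar>e - x\<bar>"
          using r(2)[OF x, of c] r(2)[OF x, of e] ce by auto
        \<comment> \<open>Straddling the tag: both endpoints are compared with \<open>x\<close>, so
          differentiability is used at \<open>x\<close> itself and not at the ends.\<close>
        have "measure lborel K *\<^sub>R d' x - (w (Sup K) - w (Inf K))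
            = (w c - w x - (c - x) *\<^sub>R d x) - (w e - w x - (e - x) *\<^sub>R d x)"
          using \<open>x \<notin> N\<close> ce by (simp add: d'_def algebra_simps)
        then have "?g x K \<le> e' * \<bar>c - x\<bar> + e' * \<bar>e - x\<bar>"
          using 1 norm_triangle_ineq4[of "w c - w x - (c - x) *\<^sub>R d x" "w e - w x - (e - x) *\<^sub>R d x"] by simp
        also have "\<dots> = e' * measure lborel K" using ce by (simp add: algebra_simps)
        finally show "?g x K \<le> e' * measure lborel K" .
      qed
      also have "\<dots> \<le> (\<Sum>(x,K)\<in>D. e' * measure lborel K)"
        using e' fin by (intro sum_mono2) auto
      also have "\<dots> = e' * (b - a)"
        using additive_content_tagged_division[OF D(1)] ab
        by (simp add: split_def flip: sum_distrib_left)
      also have "\<dots> \<le> e / 2"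
        using \<open>0 < e\<close> ab by (simp add: e'_def field_simps)
      finally show ?thesis by simp
    qed
    show "\<exists>\<gamma>. gauge \<gamma> \<and> (\<forall>D. D tagged_division_of cbox a b \<and> \<gamma> fine D \<longrightarrow>
        norm ((\<Sum>(x,K)\<in>D. measure lborel K *\<^sub>R d' x) - (w b - w a)) < e)"
      using g lt by (intro exI[of _ \<gamma>]) simp
  qed
  then have "(d' has_integral w b - w a) {a..b}" by (simp add: box_real)
  then show ?thesis
    by (rule has_integral_spike[OF N, rotated]) (auto simp: d'_def)
qed

section \<open>Divisions and Vitali coverings of the real line\<close>

lemma division_of_real_member:
  assumes "D division_of S" "K \<in> D"
  obtains c e :: real where "K = {c..e}" "c \<le> e"
  using division_ofD(3,4)[OF assms] by (metis atLeastatMost_empty_iff box_real(2))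

text \<open>Tagging every member by its left endpoint reduces this to the telescoping of tagged
  divisions, so no ordering of the members has to be constructed.\<close>

lemma division_telescope:
  fixes \<phi> :: "real \<Rightarrow> 'a::real_normed_vector"
  assumes "a \<le> b" "D division_of {a..b}"
  shows "(\<Sum>K\<in>D. \<phi> (Sup K) - \<phi> (Inf K)) = \<phi> b - \<phi> a"
proof -
  define p where "p = (\<lambda>K. (Inf K, K)) ` D"
  have "p tagged_division_of {a..b}"
    unfolding tagged_division_of p_def
  proof (intro conjI allI impI)
    show "finite ((\<lambda>K. (Inf K, K)) ` D)" using division_ofD(1)[OF assms(2)] by simp
  next
    fix x K assume "(x, K) \<in> (\<lambda>K. (Inf K, K)) ` D"
    then have K: "K \<in> D" "x = Inf K" by auto
    obtain c e where "K = {c..e}" "c \<le> e"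
      by (rule division_of_real_member[OF assms(2) K(1)])
    then show "x \<in> K" "\<exists>a b. K = cbox a b" using K by (auto simp: box_real)
    show "K \<subseteq> {a..b}" using division_ofD(2)[OF assms(2) K(1)] .
  next
    fix x1 K1 x2 K2
    assume "(x1, K1) \<in> (\<lambda>K. (Inf K, K)) ` D \<and> (x2, K2) \<in> (\<lambda>K. (Inf K, K)) ` D
        \<and> (x1, K1) \<noteq> (x2, K2)"
    then show "interior K1 \<inter> interior K2 = {}"
      using division_ofD(5)[OF assms(2)] by blast
  next
    have "{K. \<exists>x. (x, K) \<in> (\<lambda>K. (Inf K, K)) ` D} = D" by auto
    then show "\<Union>{K. \<exists>x. (x, K) \<in> (\<lambda>K. (Inf K, K)) ` D} = {a..b}"
      using division_ofD(6)[OF assms(2)] by simp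
  qed
  from additive_tagged_division_1[OF assms(1) this, of \<phi>]
  show ?thesis by (simp add: p_def sum.reindex inj_on_def)
qed

text \<open>Vitali's theorem yields countably many disjoint members covering \<open>E\<close> up to
  a null set; by continuity of measure from above finitely many suffice up to \<open>\<eta>\<close>.
  In the applications \<open>P\<close> carries a slope condition, and \<open>x\<close> is an
  endpoint of its interval.\<close>

lemma vitali_intervals:
  fixes E :: "real set"
  assumes E: "E \<in> lmeasurable" and T: "open T" "E \<subseteq> T" and "0 < \<eta>"
    and P: "\<And>x d. x \<in> E \<Longrightarrow> 0 < d \<Longrightarrow> \<exists>c e. c < e \<and> c \<le> x \<and> x \<le> e \<and> e - c < d \<and> P c e"
  obtains F where "finite F" "\<And>K. K \<in> F \<Longrightarrow> \<exists>c e. K = {c..e} \<and> c < e \<and> P c e \<and> K \<subseteq> T"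
    "pairwise disjnt F" "measure lebesgue (E - \<Union>F) < \<eta>"
proof -
  define I where "I = {(c,e). c < e \<and> P c e \<and> {c..e} \<subseteq> T}"
  \<comment> \<open>Midpoint and half-length turn an interval into the closed ball that the covering
    theorem expects.\<close>
  define m where "m i = (fst i + snd i) / 2" for i :: "real \<times> real"
  define r where "r i = (snd i - fst i) / 2" for i :: "real \<times> real"
  have cb: "cball (m i) (r i) = {fst i..snd i}" for i
    by (auto simp: m_def r_def dist_real_def field_simps abs_real_def split: if_splits)
  have cover: "\<exists>i. i \<in> I \<and> x \<in> cball (m i) (r i) \<and> r i < d" if x: "x \<in> E" and "0 < d" for x d
  proof -
    obtain \<rho> where \<rho>: "\<rho> > 0" "ball x \<rho> \<subseteq> T" using T x by (meson openE subsetD)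
    obtain c e where ce: "c < e" "c \<le> x" "x \<le> e" "e - c < min d \<rho>" "P c e"
      using P[OF x, of "min d \<rho>"] \<rho> \<open>0 < d\<close> by auto
    then have "{c..e} \<subseteq> ball x \<rho>" by (auto simp: dist_real_def)
    then have "(c, e) \<in> I" using ce \<rho> by (auto simp: I_def)
    moreover have "x \<in> cball (m (c, e)) (r (c, e))" unfolding cb using ce by simp
    moreover have "r (c, e) < d" using ce by (simp add: r_def)
    ultimately show ?thesis by blast
  qed
  have rpos: "0 < r i" if "i \<in> I" for i using that by (auto simp: I_def r_def)
  obtain C where C: "countable C" "C \<subseteq> I"
     "pairwise (\<lambda>i j. disjnt (cball (m i) (r i)) (cball (m j) (r j))) C"
     "negligible (E - (\<Union>i \<in> C. cball (m i) (r i)))"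
    by (rule Vitali_covering_theorem_cballs[OF rpos cover])
  show thesis
  proof (cases "C = {}")
    case True
    then have "measure lebesgue E = 0" using C(4) negligible_imp_measure0 by auto
    then show thesis using that[of "{}"] \<open>0 < \<eta>\<close> by simp
  next
    case False
    \<comment> \<open>If \<open>C\<close> is finite the enumeration repeats itself, so disjointness
      is proved only for distinct members of the image.\<close>
    define J where "J n = {fst (from_nat_into C n)..snd (from_nat_into C n)}" for n
    have inC: "from_nat_into C n \<in> C" for n using False by (rule from_nat_into)
    define A where "A n = E - (\<Union>i<n. J i)" for n
    have "(\<Inter>n. A n) = E - (\<Union>i\<in>C. cball (m i) (r i))"
    proof -
      have "(\<Union>i\<in>C. cball (m i) (r i)) = (\<Union>n. J n)"
      proof -
        have "(\<Union>i\<in>range (from_nat_into C). cball (m i) (r i)) = (\<Union>n. J n)"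
          by (simp add: cb J_def)
        then show ?thesis using range_from_nat_into[OF False C(1)] by simp
      qed
      then show ?thesis by (auto simp: A_def)
    qed
    then have "measure lebesgue (\<Inter>n. A n) = 0" using C(4) negligible_imp_measure0 by simp
    moreover have "(\<lambda>n. measure lebesgue (A n)) \<longlonglongrightarrow> measure lebesgue (\<Inter>n. A n)"
    proof (rule Lim_measure_decseq)
      have A: "A n \<in> lmeasurable" for n
        unfolding A_def J_def by (intro fmeasurable.Diff E sets.finite_UN) auto
      then show "range A \<subseteq> sets lebesgue" by (auto intro: fmeasurableD)
      show "emeasure lebesgue (A n) \<noteq> \<infinity>" for n
        using fmeasurableD2[OF A] by simp
      show "decseq A" by (fastforce simp: decseq_def A_def)
    qed
    ultimately have "\<forall>\<^sub>F n in sequentially. measure lebesgue (A n) < \<eta>"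
      using \<open>0 < \<eta>\<close> by (intro order_tendstoD(2)) auto
    then obtain n where n: "measure lebesgue (A n) < \<eta>"
      using eventually_happens'[OF sequentially_bot] by blast
    show thesis
    proof (rule that[of "J ` {..<n}"])
      show "\<exists>c e. K = {c..e} \<and> c < e \<and> P c e \<and> K \<subseteq> T" if K: "K \<in> J ` {..<n}" for K
      proof -
        obtain i where i: "K = J i" using K by blast
        have "from_nat_into C i \<in> I" using inC C(2) by blast
        then show ?thesis
          unfolding i J_def I_def
          by (intro exI[of _ "fst (from_nat_into C i)"] exI[of _ "snd (from_nat_into C i)"])
             (simp add: case_prod_beta)
      qed
      show "pairwise disjnt (J ` {..<n})"
      proof (rule pairwise_imageI)
        fix i j assume "i \<noteq> j" "J i \<noteq> J j"
        then have "from_nat_into C i \<noteq> from_nat_into C j" by (auto simp: J_def)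
        then show "disjnt (J i) (J j)"
          using C(3) inC unfolding pairwise_def cb J_def by blast
      qed
      show "measure lebesgue (E - \<Union> (J ` {..<n})) < \<eta>" using n by (simp add: A_def)
    qed simp
  qed
qed

text \<open>The gaps between two nested families of intervals are again a division, and the identity
  holds for every function at once, so it can be applied to the increments and to the lengths.\<close>

lemma interval_family_gaps:
  fixes F H :: "real set set"
  assumes F: "finite F" "\<And>K. K \<in> F \<Longrightarrow> \<exists>c e. K = {c..e} \<and> c < e" "pairwise disjnt F"
    and H: "finite H" "\<And>K. K \<in> H \<Longrightarrow> \<exists>c e. K = {c..e} \<and> c < e" "pairwise disjnt H"
    and HF: "\<And>K. K \<in> H \<Longrightarrow> \<exists>I\<in>F. K \<subseteq> I"
  obtains G where "G division_of \<Union>G" "\<Union>G \<subseteq> \<Union>F"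
    "\<And>\<phi> :: real \<Rightarrow> real. (\<Sum>K\<in>F. \<phi> (Sup K) - \<phi> (Inf K))
        = (\<Sum>K\<in>H. \<phi> (Sup K) - \<phi> (Inf K)) + (\<Sum>K\<in>G. \<phi> (Sup K) - \<phi> (Inf K))"
proof -
  define S where "S I = {K\<in>H. K \<subseteq> I}" for I
  \<comment> \<open>The members of \<open>H\<close> inside \<open>I\<close> form a partial division,
    whose completion adds exactly the gaps of \<open>I\<close>.\<close>
  have "\<exists>q. S I \<subseteq> q \<and> q division_of I" if I: "I \<in> F" for I
  proof -
    obtain c e where ce: "I = {c..e}" using F(2)[OF I] by auto
    have "S I division_of \<Union>(S I)"
    proof (rule division_ofI)
      show "finite (S I)" using H(1) by (simp add: S_def)
      fix K assume K: "K \<in> S I"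
      then show "K \<subseteq> \<Union>(S I)" by auto
      show "K \<noteq> {}" "\<exists>a b. K = cbox a b"
        using H(2)[of K] K by (auto simp: S_def box_real)
      fix K' assume "K' \<in> S I" "K \<noteq> K'"
      then have "K \<inter> K' = {}" using H(3) K by (auto simp: S_def pairwise_def disjnt_def)
      then show "interior K \<inter> interior K' = {}"
        using interior_subset by blast
    qed simp
    moreover have "\<Union>(S I) \<subseteq> cbox c e" using ce by (auto simp: S_def)
    ultimately obtain q where "S I \<subseteq> q" "q division_of cbox c e"
      by (rule partial_division_extend_interval)
    then show ?thesis using ce by auto
  qed
  then obtain q where q: "\<And>I. I \<in> F \<Longrightarrow> S I \<subseteq> q I" "\<And>I. I \<in> F \<Longrightarrow> q I division_of I" by metis
  have ne: "K \<noteq> {}" "K \<subseteq> I" if "I \<in> F" "K \<in> q I" for I K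
    using division_ofD(2,3)[OF q(2)[OF that(1)] that(2)] by auto
  have disj: "q I \<inter> q I' = {}" if "I \<in> F" "I' \<in> F" "I \<noteq> I'" for I I'
  proof -
    have "I \<inter> I' = {}" using F(3) that by (auto simp: pairwise_def disjnt_def)
    then show ?thesis using ne[OF that(1)] ne[OF that(2)] by blast
  qed
  define G where "G = (\<Union>I\<in>F. q I - S I)"
  show thesis
  proof (rule that[of G])
    show "G division_of \<Union>G"
    proof (rule division_ofI)
      show "finite G" unfolding G_def using F(1) division_ofD(1)[OF q(2)] by blast
      fix K assume K: "K \<in> G"
      then obtain I where I: "I \<in> F" "K \<in> q I" by (auto simp: G_def)
      show "K \<subseteq> \<Union>G" using K by auto
      show "K \<noteq> {}" "\<exists>a b. K = cbox a b"
        using division_ofD(3,4)[OF q(2)[OF I(1)] I(2)] by auto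
      fix K' assume K': "K' \<in> G" "K \<noteq> K'"
      then obtain I' where I': "I' \<in> F" "K' \<in> q I'" by (auto simp: G_def)
      show "interior K \<inter> interior K' = {}"
      proof (cases "I = I'")
        case True
        then show ?thesis using division_ofD(5)[OF q(2)[OF I(1)] I(2)] I'(2) K'(2) by blast
      next
        case False
        then have "I \<inter> I' = {}" using F(3) I I' by (auto simp: pairwise_def disjnt_def)
        then have "K \<inter> K' = {}" using ne[OF I] ne[OF I'] by blast
        then show ?thesis using interior_subset by blast
      qed
    qed simp
    show "\<Union>G \<subseteq> \<Union>F" using ne by (fastforce simp: G_def)
    fix \<phi> :: "real \<Rightarrow> real"
    let ?d = "\<lambda>K. \<phi> (Sup K) - \<phi> (Inf K)"
    have "(\<Sum>K\<in>F. ?d K) = (\<Sum>I\<in>F. sum ?d (S I) + sum ?d (q I - S I))"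
    proof (rule sum.cong[OF refl])
      fix I assume I: "I \<in> F"
      obtain c e where ce: "I = {c..e}" "c < e" using F(2)[OF I] by auto
      have "?d I = sum ?d (q I)" using division_telescope[of c e "q I" \<phi>] q(2)[OF I] ce by simp
      also have "\<dots> = sum ?d (S I) + sum ?d (q I - S I)"
        using sum.subset_diff[OF q(1)[OF I] division_ofD(1)[OF q(2)[OF I]], of ?d] by simp
      finally show "?d I = sum ?d (S I) + sum ?d (q I - S I)" .
    qed
    also have "\<dots> = (\<Sum>I\<in>F. sum ?d (S I)) + (\<Sum>I\<in>F. sum ?d (q I - S I))"
      by (rule sum.distrib)
    also have "(\<Sum>I\<in>F. sum ?d (S I)) = sum ?d (\<Union>I\<in>F. S I)"
    proof (rule sum.UNION_disjoint[symmetric])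
      show "\<forall>I\<in>F. finite (S I)" using H(1) by (simp add: S_def)
      show "\<forall>i\<in>F. \<forall>j\<in>F. i \<noteq> j \<longrightarrow> S i \<inter> S j = {}" using disj q(1) by blast
    qed (rule F(1))
    also have "(\<Union>I\<in>F. S I) = H" using HF by (auto simp: S_def)
    also have "(\<Sum>I\<in>F. sum ?d (q I - S I)) = sum ?d G"
      unfolding G_def
    proof (rule sum.UNION_disjoint[symmetric])
      show "\<forall>I\<in>F. finite (q I - S I)" using division_ofD(1)[OF q(2)] by blast
      show "\<forall>i\<in>F. \<forall>j\<in>F. i \<noteq> j \<longrightarrow> (q i - S i) \<inter> (q j - S j) = {}" using disj by blast
    qed (rule F(1))
    finally show "(\<Sum>K\<in>F. ?d K) = sum ?d H + sum ?d G" .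
  qed
qed

section \<open>Differentiability almost everywhere by covering arguments\<close>

lemma disjoint_intervals_division:
  fixes F :: "real set set"
  assumes F: "finite F" "\<And>K. K \<in> F \<Longrightarrow> \<exists>c e. K = {c..e} \<and> c < e" "pairwise disjnt F"
  shows "F division_of \<Union>F" "(\<Sum>K\<in>F. Sup K - Inf K) = measure lebesgue (\<Union>F)"
proof -
  show div: "F division_of \<Union>F"
  proof (rule division_ofI)
    fix K assume K: "K \<in> F"
    then show "K \<subseteq> \<Union>F" by auto
    show "K \<noteq> {}" "\<exists>a b. K = cbox a b" using F(2)[OF K] by (auto simp: box_real)
    fix K' assume "K' \<in> F" "K \<noteq> K'"
    then have "K \<inter> K' = {}" using F(3) K by (auto simp: pairwise_def disjnt_def)
    then show "interior K \<inter> interior K' = {}" using interior_subset by blast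
  qed (use F(1) in auto)
  have "(\<Sum>K\<in>F. Sup K - Inf K) = (\<Sum>K\<in>F. measure lebesgue K)"
  proof (rule sum.cong[OF refl])
    fix K assume "K \<in> F"
    from F(2)[OF this] obtain c e where "K = {c..e}" "c < e" by auto
    then show "Sup K - Inf K = measure lebesgue K" by simp
  qed
  then show "(\<Sum>K\<in>F. Sup K - Inf K) = measure lebesgue (\<Union>F)"
    using content_division[OF div] by simp
qed

text \<open>This set lies between the one where the upper derivate exceeds \<open>q\<close> and the
  one where it is at least \<open>q\<close>. Asking for a quotient above \<open>q\<close> at every
  scale, instead of taking a limit superior, keeps measurability elementary. With
  \<open>- \<phi>\<close> and \<open>- p\<close> it records quotients below
  \<open>p\<close>.\<close>

definition steep :: "real \<Rightarrow> real \<Rightarrow> (real \<Rightarrow> real) \<Rightarrow> real \<Rightarrow> real set" where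
  "steep a b \<phi> q = {x \<in> {a<..<b}. \<forall>d>0. \<exists>y\<in>{a<..<b}. y \<noteq> x \<and> \<bar>y - x\<bar> < d \<and> q < (\<phi> y - \<phi> x) / (y - x)}"

text \<open>For fixed \<open>y\<close> the quotient is continuous in \<open>x\<close> away from
  \<open>y\<close>, so the points served by some \<open>y\<close> at scale \<open>1 / Suc n\<close>
  form an open set; the scales are countable.\<close>

lemma steep_measurable:
  assumes "continuous_on {a..b} \<phi>"
  shows "steep a b \<phi> q \<in> lmeasurable"
proof -
  define W where "W n y = ({a<..<b} - {y}) \<inter> ball y (1 / Suc n)" for n and y :: real
  define A where "A n = (\<Union>y\<in>{a<..<b}. W n y \<inter> (\<lambda>x. (\<phi> y - \<phi> x) / (y - x)) -` {q<..})" for n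
  have "open (A n)" for n
    unfolding A_def
  proof (intro open_UN ballI continuous_open_preimage)
    fix y assume "y \<in> {a<..<b}"
    have "continuous_on (W n y) \<phi>"
      by (rule continuous_on_subset[OF assms]) (auto simp: W_def)
    then show "continuous_on (W n y) (\<lambda>x. (\<phi> y - \<phi> x) / (y - x))"
      by (intro continuous_intros) (auto simp: W_def)
    show "open (W n y)" unfolding W_def by (intro open_Int open_Diff) auto
  qed auto
  moreover have "steep a b \<phi> q = (\<Inter>n. A n)"
  proof
    show "steep a b \<phi> q \<subseteq> (\<Inter>n. A n)"
    proof
      fix x assume x: "x \<in> steep a b \<phi> q"
      have "x \<in> A n" for n
      proof -
        obtain y where "y\<in>{a<..<b}" "y \<noteq> x" "\<bar>y - x\<bar> < 1 / Suc n" "q < (\<phi> y - \<phi> x) / (y - x)"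
          using x unfolding steep_def by (auto elim!: allE[of _ "1 / Suc n"])
        then show ?thesis using x unfolding A_def W_def steep_def by (auto simp: dist_real_def)
      qed
      then show "x \<in> (\<Inter>n. A n)" by auto
    qed
    show "(\<Inter>n. A n) \<subseteq> steep a b \<phi> q"
    proof
      fix x assume x: "x \<in> (\<Inter>n. A n)"
      have "\<exists>y\<in>{a<..<b}. y \<noteq> x \<and> \<bar>y - x\<bar> < d \<and> q < (\<phi> y - \<phi> x) / (y - x)" if d: "0 < d" for d
      proof -
        obtain n where n: "1 / Suc n < d" using nat_approx_posE[OF d] by auto
        have "x \<in> A n" using x by auto
        then obtain y where "y \<in> {a<..<b}" "x \<in> W n y" "q < (\<phi> y - \<phi> x) / (y - x)"
          by (auto simp: A_def)
        then show ?thesis using n by (intro bexI[of _ y]) (auto simp: W_def dist_real_def)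
      qed
      moreover have "x \<in> {a<..<b}" using x by (auto simp: A_def W_def)
      ultimately show "x \<in> steep a b \<phi> q" by (auto simp: steep_def)
    qed
  qed
  ultimately have "steep a b \<phi> q \<in> sets lebesgue"
    using borel_open by (auto intro!: sets.countable_INT sets_completionI_sets)
  moreover have "steep a b \<phi> q \<subseteq> {a<..<b}" by (auto simp: steep_def)
  moreover have "{a<..<b} \<in> lmeasurable" by simp
  ultimately show ?thesis using fmeasurableI2 by blast
qed

text \<open>The quotient is symmetric in its two points, so \<open>x\<close> may be either endpoint.
  These are the arbitrarily short intervals fed to the Vitali covering.\<close>

lemma steep_interval:
  assumes "x \<in> steep a b \<phi> q" "0 < d"
  shows "\<exists>c e. c < e \<and> c \<le> x \<and> x \<le> e \<and> e - c < d \<and> q * (e - c) < \<phi> e - \<phi> c \<and> {c..e} \<subseteq> {a<..<b}"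
proof -
  obtain y where y: "y\<in>{a<..<b}" "y \<noteq> x" "\<bar>y - x\<bar> < d" "q < (\<phi> y - \<phi> x) / (y - x)" "x \<in> {a<..<b}"
    using assms unfolding steep_def by auto
  show ?thesis
  proof (cases "x < y")
    case True
    then show ?thesis using y by (intro exI[of _ x] exI[of _ y]) (auto simp: field_simps)
  next
    case False
    then show ?thesis using y by (intro exI[of _ y] exI[of _ x]) (auto simp: field_simps)
  qed
qed

text \<open>An infinite upper derivate on a set of positive measure would give disjoint intervals,
  of total length above half of that measure, on which \<open>\<phi>\<close> rises with slope above
  any given \<open>k\<close>; absolute continuity keeps the total rise below 1.\<close>

lemma negligible_inf_steep:
  assumes ac: "abs_continuous_on {a..b} \<phi>"
  shows "negligible (\<Inter>n. steep a b \<phi> (real n))"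
proof -
  let ?E = "\<Inter>n. steep a b \<phi> (real n)"
  obtain \<delta> where \<delta>: "0 < \<delta>"
    "\<And>D S. \<lbrakk>D division_of S; S \<subseteq> {a..b}; (\<Sum>K\<in>D. Sup K - Inf K) < \<delta>\<rbrakk>
       \<Longrightarrow> (\<Sum>K\<in>D. norm (\<phi> (Sup K) - \<phi> (Inf K))) < 1"
    by (rule abs_continuous_onD[OF ac, of 1]) auto
  have S: "steep a b \<phi> (real n) \<in> lmeasurable" for n
    by (rule steep_measurable[OF abs_continuous_on_imp_continuous[OF ac]])
  have meas: "?E \<in> lmeasurable"
  proof (rule fmeasurableI2[OF S[of 0]])
    show "?E \<in> sets lebesgue" using S by (intro sets.countable_INT) (auto intro: fmeasurableD)
  qed blast
  show ?thesis
  proof (rule iffD2[OF locally_negligible_alt], intro ballI)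
    fix x assume x: "x \<in> ?E"
    \<comment> \<open>Disjoint intervals inside this ball have total length at most
      \<open>2 * \<delta> / 3\<close>, less than the \<open>\<delta>\<close> that belongs to the
      bound 1.\<close>
    define B where "B = ball x (\<delta> / 3)"
    define E where "E = ?E \<inter> B"
    have E: "E \<in> lmeasurable" unfolding E_def B_def using meas by (intro fmeasurable.Int) auto
    have "measure lebesgue E = 0"
    proof (rule ccontr)
      assume "measure lebesgue E \<noteq> 0"
      then have m: "measure lebesgue E > 0" by (simp add: zero_less_measure_iff)
      \<comment> \<open>The covering misses less than half of \<open>E\<close>, so slope
        \<open>k\<close> over the rest forces a rise above 1.\<close>
      obtain k :: nat where k: "2 / measure lebesgue E < real k" using reals_Archimedean2 by blast
      obtain F where F: "finite F"
        "\<And>K. K \<in> F \<Longrightarrow> \<exists>c e. K = {c..e} \<and> c < e \<and> (real k * (e - c) < \<phi> e - \<phi> c \<and> {c..e} \<subseteq> {a<..<b}) \<and> K \<subseteq> B"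
        "pairwise disjnt F" "measure lebesgue (E - \<Union>F) < measure lebesgue E / 2"
      proof (rule vitali_intervals[OF E, of B "measure lebesgue E / 2" "\<lambda>c e. real k * (e - c) < \<phi> e - \<phi> c \<and> {c..e} \<subseteq> {a<..<b}"])
        show "\<exists>c e. c < e \<and> c \<le> y \<and> y \<le> e \<and> e - c < d \<and> real k * (e - c) < \<phi> e - \<phi> c \<and> {c..e} \<subseteq> {a<..<b}"
          if "y \<in> E" "0 < d" for y d
          using that by (intro steep_interval) (auto simp: E_def)
      qed (use m in \<open>auto simp: E_def B_def\<close>)
      have Fi: "\<exists>c e. K = {c..e} \<and> c < e" if "K \<in> F" for K using F(2)[OF that] by blast
      note FD = disjoint_intervals_division[OF F(1) Fi F(3)]
      have FL: "\<Union>F \<in> lmeasurable" using lmeasurable_division[OF FD(1)] .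
      have "measure lebesgue E \<le> measure lebesgue (E - \<Union>F) + measure lebesgue (\<Union>F)"
      proof -
        have "measure lebesgue E \<le> measure lebesgue ((E - \<Union>F) \<union> \<Union>F)"
          by (rule measure_mono_fmeasurable) (use E FL in \<open>auto intro: fmeasurable.Un fmeasurable.Diff fmeasurableD\<close>)
        also have "\<dots> \<le> measure lebesgue (E - \<Union>F) + measure lebesgue (\<Union>F)"
          using E FL by (intro measure_Un_le) (auto intro: fmeasurableD)
        finally show ?thesis .
      qed
      then have ge: "(\<Sum>K\<in>F. Sup K - Inf K) > measure lebesgue E / 2" using F(4) FD(2) by simp
      have "measure lebesgue (\<Union>F) \<le> measure lebesgue B"
        using F(2) FL by (intro measure_mono_fmeasurable) (auto simp: B_def intro: fmeasurableD)
      also have "measure lebesgue B < \<delta>"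
        using \<delta>(1) by (simp add: B_def ball_eq_greaterThanLessThan)
      finally have "(\<Sum>K\<in>F. norm (\<phi> (Sup K) - \<phi> (Inf K))) < 1"
        using F(2) FD by (intro \<delta>(2)[OF FD(1)]) fastforce+
      moreover have "real k * (\<Sum>K\<in>F. Sup K - Inf K) \<le> (\<Sum>K\<in>F. norm (\<phi> (Sup K) - \<phi> (Inf K)))"
        unfolding sum_distrib_left
      proof (rule sum_mono)
        fix K assume "K \<in> F"
        then obtain c e where "K = {c..e}" "c < e" "real k * (e - c) < \<phi> e - \<phi> c" using F(2) by blast
        then show "real k * (Sup K - Inf K) \<le> norm (\<phi> (Sup K) - \<phi> (Inf K))" by simp
      qed
      moreover have "1 < real k * (\<Sum>K\<in>F. Sup K - Inf K)"
      proof -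
        have "1 < real k * (measure lebesgue E / 2)" using k m by (simp add: field_simps)
        also have "\<dots> \<le> real k * (\<Sum>K\<in>F. Sup K - Inf K)" using ge by (intro mult_left_mono) auto
        finally show ?thesis .
      qed
      ultimately show False by linarith
    qed
    then have "negligible E" using E by (simp add: negligible_iff_measure)
    then show "\<exists>U. openin (top_of_set ?E) U \<and> x \<in> U \<and> negligible U"
      using x \<delta>(1) by (intro exI[of _ E]) (auto simp: E_def B_def intro: openin_open_Int)
  qed
qed

text \<open>Two nested Vitali coverings: intervals of mean slope below \<open>p\<close> almost
  exhaust \<open>E\<close> within an open set hardly larger than \<open>E\<close>, and inside them
  intervals of mean slope above \<open>q\<close> almost exhaust it again. Both families have nearly
  the same length, so their total increments differ by about \<open>(q - p) * m\<close>. Only the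
  gaps could account for this, and absolute continuity keeps their contribution below
  \<open>\<epsilon>\<close>.\<close>

lemma negligible_steep_inter:
  assumes ac: "abs_continuous_on {a..b} \<phi>" and "p < q"
  shows "negligible (steep a b \<phi> q \<inter> steep a b (\<lambda>x. - \<phi> x) (- p))"
proof -
  define E where "E = steep a b \<phi> q \<inter> steep a b (\<lambda>x. - \<phi> x) (- p)"
  have cont: "continuous_on {a..b} \<phi>" by (rule abs_continuous_on_imp_continuous[OF ac])
  have E: "E \<in> lmeasurable"
    unfolding E_def by (intro fmeasurable.Int steep_measurable continuous_intros cont)
  define m where "m = measure lebesgue E"
  have "m = 0"
  proof (rule ccontr)
    assume "m \<noteq> 0"
    then have m: "m > 0" by (simp add: m_def zero_less_measure_iff)
    \<comment> \<open>The final contradiction sets \<open>(q - p) * lH < 2 * \<epsilon>\<close>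
      against \<open>lH \<ge> m / 2\<close>.\<close>
    define \<epsilon> where "\<epsilon> = (q - p) * m / 4"
    have \<epsilon>: "\<epsilon> > 0" using \<open>p < q\<close> m by (simp add: \<epsilon>_def)
    obtain \<delta> where \<delta>: "0 < \<delta>"
      "\<And>D S. \<lbrakk>D division_of S; S \<subseteq> {a..b}; (\<Sum>K\<in>D. Sup K - Inf K) < \<delta>\<rbrakk>
         \<Longrightarrow> (\<Sum>K\<in>D. norm (\<phi> (Sup K) - \<phi> (Inf K))) < \<epsilon>"
      by (rule abs_continuous_onD[OF ac \<epsilon>]) blast
    \<comment> \<open>The three entries serve in turn for \<open>lH \<ge> m / 2\<close>, for
      absolute continuity on gaps of total length at most \<open>3 * \<eta>\<close>, and for
      absorbing \<open>p * lG\<close>.\<close>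
    define \<eta> where "\<eta> = min (m / 4) (min (\<delta> / 6) (\<epsilon> / (3 * (\<bar>p\<bar> + 1))))"
    have \<eta>: "\<eta> > 0" "\<eta> \<le> m / 4" "3 * \<eta> < \<delta>" "\<bar>p\<bar> * (3 * \<eta>) \<le> \<epsilon>"
    proof -
      have "3 * (\<bar>p\<bar> + 1) > 0" by simp
      then show "\<eta> > 0" using m \<delta>(1) \<epsilon> unfolding \<eta>_def by (intro min_less_iff_conj[THEN iffD2] conjI divide_pos_pos) auto
      show "\<eta> \<le> m / 4" unfolding \<eta>_def by (rule min.cobounded1)
      have "\<eta> \<le> \<delta> / 6" unfolding \<eta>_def by (intro min.coboundedI2 min.cobounded1)
      then show "3 * \<eta> < \<delta>" using \<delta>(1) by linarith
      have "\<eta> \<le> \<epsilon> / (3 * (\<bar>p\<bar> + 1))" unfolding \<eta>_def by (intro min.coboundedI2 min.cobounded2)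
      then have "(\<bar>p\<bar> + 1) * (3 * \<eta>) \<le> \<epsilon>" by (simp add: field_simps)
      then show "\<bar>p\<bar> * (3 * \<eta>) \<le> \<epsilon>" using \<open>\<eta> > 0\<close> by (simp add: algebra_simps)
    qed
    obtain T where T: "open T" "E \<subseteq> T" "T - E \<in> lmeasurable" "emeasure lebesgue (T - E) < ennreal \<eta>"
      using sets_lebesgue_outer_open[of E \<eta>] E \<eta>(1) by (auto intro: fmeasurableD)
    have TL: "T \<in> lmeasurable" "measure lebesgue T \<le> m + \<eta>"
    proof -
      have eq: "T = E \<union> (T - E)" using T(2) by auto
      show "T \<in> lmeasurable" by (subst eq) (intro fmeasurable.Un E T(3))
      have "measure lebesgue T \<le> measure lebesgue E + measure lebesgue (T - E)"
        by (subst eq) (intro measure_Un_le fmeasurableD E T(3))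
      moreover have "measure lebesgue (T - E) < \<eta>"
        using T(3,4) \<eta>(1) by (simp add: emeasure_eq_measure2 ennreal_less_iff)
      ultimately show "measure lebesgue T \<le> m + \<eta>" by (simp add: m_def)
    qed
    let ?P = "\<lambda>c e. (- p) * (e - c) < (- \<phi> e) - (- \<phi> c) \<and> {c..e} \<subseteq> {a<..<b}"
    obtain F where F: "finite F" "\<And>K. K \<in> F \<Longrightarrow> \<exists>c e. K = {c..e} \<and> c < e \<and> ?P c e \<and> K \<subseteq> T"
        "pairwise disjnt F" "measure lebesgue (E - \<Union>F) < \<eta>"
    proof (rule vitali_intervals[OF E T(1,2) \<eta>(1), of ?P])
      show "\<exists>c e. c < e \<and> c \<le> x \<and> x \<le> e \<and> e - c < d \<and> ?P c e" if "x \<in> E" "0 < d" for x d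
        using that by (intro steep_interval) (auto simp: E_def)
    qed blast
    have Fi: "\<exists>c e. K = {c..e} \<and> c < e" if "K \<in> F" for K using F(2)[OF that] by blast
    note FD = disjoint_intervals_division[OF F(1) Fi F(3)]
    have FL: "\<Union>F \<in> lmeasurable" using lmeasurable_division[OF FD(1)] .
    \<comment> \<open>The second covering must live in an open set, so the endpoints are dropped;
      they lie in the null set \<open>X\<close>.\<close>
    define T' where "T' = (\<Union>K\<in>F. interior K)"
    have T': "open T'" by (auto simp: T'_def)
    have T'L: "T' \<in> lmeasurable"
      using T' interior_subset by (intro fmeasurableI2[OF FL]) (fastforce simp: T'_def borel_open)+
    define X where "X = (\<Union>K\<in>F. {Inf K, Sup K})"
    have X: "finite X" using F(1) by (auto simp: X_def)
    then have XN: "X \<in> lmeasurable" "measure lebesgue X = 0"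
      by (auto intro: negligible_imp_measurable negligible_imp_measure0)
    have "\<Union>F \<subseteq> T' \<union> X"
    proof
      fix x assume "x \<in> \<Union>F"
      then obtain K where K: "K \<in> F" "x \<in> K" by auto
      obtain c e where "K = {c..e}" "c < e" using Fi[OF K(1)] by auto
      then have "x \<in> interior K \<or> x = Inf K \<or> x = Sup K" using K(2) by auto
      then show "x \<in> T' \<union> X" using K(1) by (auto simp: T'_def X_def)
    qed
    then have "E - T' \<subseteq> (E - \<Union>F) \<union> X" by auto
    then have "measure lebesgue (E - T') \<le> measure lebesgue ((E - \<Union>F) \<union> X)"
      by (intro measure_mono_fmeasurable fmeasurable.Un fmeasurable.Diff fmeasurableD sets.Diff E FL XN T'L)
    also have "\<dots> \<le> measure lebesgue (E - \<Union>F) + measure lebesgue X"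
      by (intro measure_Un_le fmeasurableD sets.Diff E FL XN)
    finally have ET': "measure lebesgue (E - T') < \<eta>" using F(4) XN by simp
    define E2 where "E2 = E \<inter> T'"
    have E2: "E2 \<in> lmeasurable" unfolding E2_def by (intro fmeasurable.Int E T'L)
    let ?Q = "\<lambda>c e. q * (e - c) < \<phi> e - \<phi> c \<and> {c..e} \<subseteq> {a<..<b}"
    obtain H where H: "finite H" "\<And>K. K \<in> H \<Longrightarrow> \<exists>c e. K = {c..e} \<and> c < e \<and> ?Q c e \<and> K \<subseteq> T'"
        "pairwise disjnt H" "measure lebesgue (E2 - \<Union>H) < \<eta>"
    proof (rule vitali_intervals[OF E2 T' _ \<eta>(1), of ?Q])
      show "\<exists>c e. c < e \<and> c \<le> x \<and> x \<le> e \<and> e - c < d \<and> ?Q c e" if "x \<in> E2" "0 < d" for x d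
        using that by (intro steep_interval) (auto simp: E_def E2_def)
      show "E2 \<subseteq> T'" by (auto simp: E2_def)
    qed blast
    have Hi: "\<exists>c e. K = {c..e} \<and> c < e" if "K \<in> H" for K using H(2)[OF that] by blast
    note HD = disjoint_intervals_division[OF H(1) Hi H(3)]
    have HL: "\<Union>H \<in> lmeasurable" using lmeasurable_division[OF HD(1)] .
    have HF: "\<exists>I\<in>F. K \<subseteq> I" if K: "K \<in> H" for K
    proof -
      obtain c e where ce: "K = {c..e}" "c < e" "K \<subseteq> T'" using H(2)[OF K] by blast
      then obtain I where I: "I \<in> F" "c \<in> interior I" unfolding T'_def by fastforce
      \<comment> \<open>The interiors of the other intervals. A connected \<open>K\<close> inside
        the union of two disjoint open sets meets only one of them, which places \<open>K\<close> in
        a single member of \<open>F\<close>.\<close>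
      define R where "R = (\<Union>J\<in>F - {I}. interior J)"
      have "connected K" using ce by simp
      moreover have "open (interior I)" "open R" by (auto simp: R_def)
      moreover have "interior I \<inter> R \<inter> K = {}"
      proof -
        have "interior I \<inter> interior J = {}" if "J \<in> F - {I}" for J
          using division_ofD(5)[OF FD(1) I(1), of J] that by auto
        then show ?thesis by (auto simp: R_def)
      qed
      moreover have "K \<subseteq> interior I \<union> R" using ce(3) by (auto simp: R_def T'_def)
      ultimately have "interior I \<inter> K = {} \<or> R \<inter> K = {}" by (rule connectedD)
      then have "K \<subseteq> interior I" using I(2) ce \<open>K \<subseteq> interior I \<union> R\<close> by auto
      then show ?thesis using I(1) interior_subset by blast
    qed
    obtain G where G: "G division_of \<Union>G" "\<Union>G \<subseteq> \<Union>F"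
      "\<And>\<phi> :: real \<Rightarrow> real. (\<Sum>K\<in>F. \<phi> (Sup K) - \<phi> (Inf K))
          = (\<Sum>K\<in>H. \<phi> (Sup K) - \<phi> (Inf K)) + (\<Sum>K\<in>G. \<phi> (Sup K) - \<phi> (Inf K))"
      by (rule interval_family_gaps[OF F(1) Fi F(3) H(1) Hi H(3) HF]) blast+
    define lF where "lF = (\<Sum>K\<in>F. Sup K - Inf K)"
    define lH where "lH = (\<Sum>K\<in>H. Sup K - Inf K)"
    define lG where "lG = (\<Sum>K\<in>G. Sup K - Inf K)"
    have len: "lF = lH + lG" unfolding lF_def lH_def lG_def by (rule G(3))
    have lF_eq: "lF = measure lebesgue (\<Union>F)" unfolding lF_def by (rule FD(2))
    have lH_eq: "lH = measure lebesgue (\<Union>H)" unfolding lH_def by (rule HD(2))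
    have "lF \<le> measure lebesgue T"
      unfolding lF_eq using F(2) FL by (intro measure_mono_fmeasurable TL) (auto intro: fmeasurableD)
    then have lF: "lF \<le> m + \<eta>" using TL by simp
    have "m \<le> measure lebesgue (E - T') + measure lebesgue E2"
    proof -
      have "E = (E - T') \<union> E2" by (auto simp: E2_def)
      then show ?thesis unfolding m_def
        using measure_Un_le[of "E - T'" lebesgue E2] E T'L E2 by (auto dest: fmeasurableD)
    qed
    moreover have "measure lebesgue E2 \<le> measure lebesgue (E2 - \<Union>H) + lH"
    proof -
      have "measure lebesgue E2 \<le> measure lebesgue ((E2 - \<Union>H) \<union> \<Union>H)"
        by (intro measure_mono_fmeasurable fmeasurable.Un fmeasurable.Diff fmeasurableD E2 HL) auto
      also have "\<dots> \<le> measure lebesgue (E2 - \<Union>H) + measure lebesgue (\<Union>H)"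
        by (intro measure_Un_le fmeasurableD sets.Diff E2 HL)
      finally show ?thesis by (simp add: lH_eq)
    qed
    ultimately have lH: "lH \<ge> m - 2 * \<eta>" using ET' H(4) by linarith
    \<comment> \<open>\<open>lG\<close> equals \<open>lF - lH\<close>, at most
      \<open>(m + \<eta>) - (m - 2 * \<eta>)\<close>.\<close>
    have lG: "0 \<le> lG" "lG \<le> 3 * \<eta>"
    proof -
      show "0 \<le> lG" unfolding lG_def
      proof (rule sum_nonneg)
        fix K assume "K \<in> G"
        then obtain c e where "K = {c..e}" "c \<le> e" by (rule division_of_real_member[OF G(1)])
        then show "0 \<le> Sup K - Inf K" by simp
      qed
      show "lG \<le> 3 * \<eta>" using len lF lH by linarith
    qed
    have "K \<subseteq> {a..b}" if K: "K \<in> F" for K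
    proof -
      obtain c e where "K = {c..e}" "{c..e} \<subseteq> {a<..<b}" using F(2)[OF K] by blast
      then show ?thesis using greaterThanLessThan_subseteq_atLeastAtMost_iff[of a b a b] by blast
    qed
    then have "\<Union>G \<subseteq> {a..b}" using G(2) by blast
    then have "(\<Sum>K\<in>G. norm (\<phi> (Sup K) - \<phi> (Inf K))) < \<epsilon>"
      using lG(2) \<eta>(3) by (intro \<delta>(2)[OF G(1)]) (auto simp: lG_def)
    moreover have "- (\<Sum>K\<in>G. norm (\<phi> (Sup K) - \<phi> (Inf K))) \<le> (\<Sum>K\<in>G. \<phi> (Sup K) - \<phi> (Inf K))"
      unfolding sum_negf[symmetric] by (rule sum_mono) (simp add: abs_real_def)
    ultimately have Gs: "(\<Sum>K\<in>G. \<phi> (Sup K) - \<phi> (Inf K)) > - \<epsilon>" by linarith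
    have Fs: "(\<Sum>K\<in>F. \<phi> (Sup K) - \<phi> (Inf K)) \<le> p * lF"
      unfolding lF_def sum_distrib_left
    proof (rule sum_mono)
      fix K assume "K \<in> F"
      then obtain c e where "K = {c..e}" "c < e" "(- p) * (e - c) < (- \<phi> e) - (- \<phi> c)" using F(2) by blast
      then show "\<phi> (Sup K) - \<phi> (Inf K) \<le> p * (Sup K - Inf K)" by (simp add: algebra_simps)
    qed
    have Hs: "q * lH \<le> (\<Sum>K\<in>H. \<phi> (Sup K) - \<phi> (Inf K))"
      unfolding lH_def sum_distrib_left
    proof (rule sum_mono)
      fix K assume "K \<in> H"
      then obtain c e where "K = {c..e}" "c < e" "q * (e - c) < \<phi> e - \<phi> c" using H(2) by blast
      then show "q * (Sup K - Inf K) \<le> \<phi> (Sup K) - \<phi> (Inf K)" by simp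
    qed
    have "q * lH - \<epsilon> < p * lF" using G(3)[of \<phi>] Gs Fs Hs by linarith
    then have "(q - p) * lH < \<epsilon> + p * lG" by (simp add: len algebra_simps)
    also have "p * lG \<le> \<bar>p\<bar> * lG" using lG(1) by (intro mult_right_mono) auto
    also have "\<dots> \<le> \<bar>p\<bar> * (3 * \<eta>)" using lG(2) by (intro mult_left_mono) auto
    also have "\<dots> \<le> \<epsilon>" by (rule \<eta>(4))
    finally have "(q - p) * lH < 2 * \<epsilon>" by simp
    moreover have "(q - p) * (m / 2) \<le> (q - p) * lH"
      using lH \<eta>(2) \<open>p < q\<close> by (intro mult_left_mono) auto
    ultimately show False by (simp add: \<epsilon>_def mult.commute[of m])
  qed
  then show ?thesis using E unfolding m_def E_def by (simp add: negligible_iff_measure)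
qed

text \<open>If the lower and upper limits of the quotient differed, two rationals strictly between
  them would put \<open>x\<close> into an excluded intersection; the assumptions \<open>up\<close>
  and \<open>down\<close> make both limits finite. Rationals keep the number of excluded sets
  countable.\<close>

lemma steep_limit:
  assumes x: "x \<in> {a<..<b}"
    and up: "x \<notin> (\<Inter>n. steep a b \<phi> (real n))"
    and down: "x \<notin> (\<Inter>n. steep a b (\<lambda>y. - \<phi> y) (real n))"
    and between: "\<And>p q :: rat. p < q \<Longrightarrow>
      x \<notin> steep a b \<phi> (of_rat q) \<inter> steep a b (\<lambda>y. - \<phi> y) (- of_rat p)"
  shows "\<exists>D. (\<phi> has_field_derivative D) (at x)"
proof -
  define s where "s y = (\<phi> y - \<phi> x) / (y - x)" for y
  have not_steep: "\<forall>\<^sub>F y in at x. (\<psi> y - \<psi> x) / (y - x) \<le> q"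
    if n: "x \<notin> steep a b \<psi> q" for \<psi> q
  proof -
    obtain d where d: "d > 0" "\<And>y. y \<in> {a<..<b} \<Longrightarrow> y \<noteq> x \<Longrightarrow> \<bar>y - x\<bar> < d \<Longrightarrow> (\<psi> y - \<psi> x) / (y - x) \<le> q"
      using n x unfolding steep_def mem_Collect_eq by (meson linorder_not_le)
    have "\<forall>\<^sub>F y in at x. y \<in> {a<..<b} \<inter> ball x d"
      using x d(1) by (intro eventually_at_in_open') auto
    moreover have "\<forall>\<^sub>F y in at x. y \<noteq> x" by (simp add: eventually_at_filter)
    ultimately show ?thesis
      by eventually_elim (use d(2) in \<open>auto simp: dist_real_def abs_minus_commute\<close>)
  qed
  have neg: "((- \<phi> y) - (- \<phi> x)) / (y - x) = - s y" for y
    by (simp add: s_def minus_divide_left)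
  obtain n1 :: nat where n1: "\<forall>\<^sub>F y in at x. s y \<le> real n1"
    using up not_steep[of \<phi>] unfolding s_def by blast
  obtain n2 :: nat where n2: "\<forall>\<^sub>F y in at x. - s y \<le> real n2"
    using down not_steep[of "\<lambda>y. - \<phi> y"] unfolding neg by blast
  define L where "L = Liminf (at x) (\<lambda>y. ereal (s y))"
  define U where "U = Limsup (at x) (\<lambda>y. ereal (s y))"
  have "L \<le> U" unfolding L_def U_def by (rule Liminf_le_Limsup) simp
  moreover have "\<not> L < U"
  proof
    assume "L < U"
    then obtain q :: rat where q: "L < real_of_rat q" "real_of_rat q < U" using ereal_dense3 by blast
    obtain p :: rat where p: "L < real_of_rat p" "ereal (real_of_rat p) < real_of_rat q"
      using ereal_dense3[OF q(1)] by blast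
    then have "p < q" by (simp add: of_rat_less)
    then consider "x \<notin> steep a b \<phi> (of_rat q)" | "x \<notin> steep a b (\<lambda>y. - \<phi> y) (- of_rat p)"
      using between by blast
    then show False
    proof cases
      case 1
      then have "\<forall>\<^sub>F y in at x. ereal (s y) \<le> ereal (of_rat q)"
        using not_steep[OF 1] by (simp add: s_def)
      then have "U \<le> ereal (of_rat q)" unfolding U_def by (rule Limsup_bounded)
      then show False using q(2) by simp
    next
      case 2
      then have "\<forall>\<^sub>F y in at x. ereal (of_rat p) \<le> ereal (s y)"
        using not_steep[OF 2] unfolding neg by simp
      then have "ereal (of_rat p) \<le> L" unfolding L_def by (rule Liminf_bounded)
      then show False using p(1) by simp
    qed
  qed
  ultimately have LU: "L = U" by simp
  have "ereal (- real n2) \<le> L" unfolding L_def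
    by (rule Liminf_bounded) (use n2 in \<open>simp add: minus_le_iff\<close>)
  moreover have "U \<le> ereal (real n1)" unfolding U_def
    by (rule Limsup_bounded) (use n1 in simp)
  ultimately obtain D where D: "L = ereal D" using LU by (cases L) auto
  have "((\<lambda>y. ereal (s y)) \<longlongrightarrow> ereal D) (at x)"
    using LU D by (intro Liminf_eq_Limsup) (auto simp: L_def U_def)
  then have "(s \<longlongrightarrow> D) (at x)" by simp
  then show ?thesis unfolding has_field_derivative_iff s_def[abs_def] by blast
qed

lemma abs_continuous_uminus:
  fixes w :: "real \<Rightarrow> 'a::real_normed_vector"
  shows "abs_continuous_on I w \<Longrightarrow> abs_continuous_on I (\<lambda>t. - w t)"
  by (rule abs_continuous_on_dominated[where C=1]) (auto simp: norm_minus_commute)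

lemma abs_continuous_real_differentiable:
  fixes \<phi> :: "real \<Rightarrow> real"
  assumes ac: "abs_continuous_on {a..b} \<phi>"
  shows "\<exists>N. negligible N \<and> (\<forall>x\<in>{a..b} - N. \<exists>D. (\<phi> has_vector_derivative D) (at x within {a..b}))"
proof -
  have ac': "abs_continuous_on {a..b} (\<lambda>x. - \<phi> x)" using ac by (rule abs_continuous_uminus)
  \<comment> \<open>Pairs in the wrong order receive the empty set, so that the union may run over
    all rational pairs.\<close>
  define B where "B p q = (if p < q then steep a b \<phi> (of_rat q) \<inter> steep a b (\<lambda>y. - \<phi> y) (- of_rat p) else {})"
    for p q :: rat
  \<comment> \<open>\<open>steep\<close> speaks of interior points only, hence the endpoints are
    added to the exceptional set.\<close>
  define N where "N = {a, b} \<union> (\<Inter>n. steep a b \<phi> (real n))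
      \<union> (\<Inter>n. steep a b (\<lambda>y. - \<phi> y) (real n)) \<union> (\<Union>p. \<Union>q. B p q)"
  have "negligible (B p q)" for p q
    using negligible_steep_inter[OF ac, of "of_rat p" "of_rat q"] by (simp add: B_def of_rat_less)
  then have "negligible (\<Union>p. \<Union>q. B p q)"
    by (intro negligible_countable_Union) (auto intro!: negligible_countable_Union)
  then have "negligible N"
    unfolding N_def using negligible_inf_steep[OF ac] negligible_inf_steep[OF ac']
    by (intro negligible_Un) auto
  moreover have "\<exists>D. (\<phi> has_vector_derivative D) (at x within {a..b})" if x: "x \<in> {a..b} - N" for x
  proof -
    have "\<exists>D. (\<phi> has_field_derivative D) (at x)"
    proof (rule steep_limit)
      show "x \<in> {a<..<b}" using x by (auto simp: N_def)
      show "x \<notin> steep a b \<phi> (of_rat q) \<inter> steep a b (\<lambda>y. - \<phi> y) (- of_rat p)" if "p < q" for p q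
      proof -
        have "x \<notin> B p q" using x by (auto simp: N_def)
        then show ?thesis using that by (simp add: B_def)
      qed
    qed (use x in \<open>auto simp: N_def\<close>)
    then show ?thesis
      using has_real_derivative_iff_has_vector_derivative has_vector_derivative_at_within by blast
  qed
  ultimately show ?thesis by blast
qed

theorem abs_continuous_differentiable_ae:
  fixes w :: "real \<Rightarrow> 'a::euclidean_space"
  assumes ac: "abs_continuous_on {a..b} w"
  obtains N where "negligible N"
    "\<And>x. x \<in> {a..b} - N \<Longrightarrow> (w has_vector_derivative vector_derivative w (at x within {a..b})) (at x within {a..b})"
proof -
  have "abs_continuous_on {a..b} (\<lambda>t. w t \<bullet> i)" if "i \<in> Basis" for i
    using ac
  proof (rule abs_continuous_on_dominated[where C=1])
    fix s t
    show "norm (w t \<bullet> i - w s \<bullet> i) \<le> 1 * norm (w t - w s)"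
      using Basis_le_norm[OF that, of "w t - w s"] by (simp add: inner_diff_left)
  qed
  then have "\<forall>i\<in>Basis. \<exists>N. negligible N \<and> (\<forall>x\<in>{a..b} - N. \<exists>D. ((\<lambda>t. w t \<bullet> i) has_vector_derivative D) (at x within {a..b}))"
    using abs_continuous_real_differentiable by blast
  then obtain N where N: "\<And>i. i \<in> Basis \<Longrightarrow> negligible (N i)"
    "\<And>i x. i \<in> Basis \<Longrightarrow> x \<in> {a..b} - N i \<Longrightarrow> \<exists>D. ((\<lambda>t. w t \<bullet> i) has_vector_derivative D) (at x within {a..b})"
    by metis
  show thesis
  proof
    show "negligible (\<Union>(N ` Basis))" using N(1) by (intro negligible_Union) auto
    fix x assume x: "x \<in> {a..b} - \<Union>(N ` Basis)"
    have "\<forall>i\<in>Basis. (\<lambda>t. w t \<bullet> i) differentiable (at x within {a..b})"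
      using N(2) x by (blast intro: differentiableI_vector)
    then have "w differentiable (at x within {a..b})"
      by (rule iffD2[OF differentiable_componentwise_within])
    then show "(w has_vector_derivative vector_derivative w (at x within {a..b})) (at x within {a..b})"
      by (simp add: vector_derivative_works)
  qed
qed

text \<open>The derivative \<open>d\<close> is free on \<open>N\<close>, so the same facts apply to
  the vector derivative and to the right-hand side of a differential equation.\<close>

locale abs_continuous_derivative =
  fixes a b :: real and w d :: "real \<Rightarrow> 'a::euclidean_space" and N :: "real set"
  assumes ac: "abs_continuous_on {a..b} w" and N: "negligible N"
    and d: "\<And>t. t \<in> {a..b} - N \<Longrightarrow> (w has_vector_derivative d t) (at t within {a..b})"
begin

lemma has_integral_subinterval:
  assumes "a \<le> s" "s \<le> t" "t \<le> b"
  shows "(d has_integral w t - w s) {s..t}"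
proof (rule abs_continuous_has_integral_derivative[OF assms(2) _ N])
  show "abs_continuous_on {s..t} w"
    using ac by (rule abs_continuous_on_subset) (use assms in auto)
  fix r assume "r \<in> {s..t} - N"
  then show "(w has_vector_derivative d r) (at r within {s..t})"
    using assms by (intro has_vector_derivative_within_subset[OF d]) auto
qed

lemma integral_interval_member:
  assumes "D division_of S" "S \<subseteq> {a..b}" "K \<in> D"
  shows "integral K d = w (Sup K) - w (Inf K)"
proof -
  obtain c e where K: "K = {c..e}" "c \<le> e" by (rule division_of_real_member[OF assms(1,3)])
  moreover have "K \<subseteq> {a..b}" using division_ofD(2)[OF assms(1,3)] assms(2) by blast
  ultimately show ?thesis using has_integral_subinterval[of c e] by (auto intro: integral_unique)
qed

text \<open>On an interval shorter than \<open>\<delta>\<close> the integrals of \<open>d\<close>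
  over the members of a division are increments of \<open>w\<close>, so their norms sum to at most 1
  and \<open>d\<close> is absolutely integrable there; such short intervals are then glued.\<close>

lemma absolutely_integrable: "d absolutely_integrable_on {a..b}"
proof -
  obtain \<delta> where \<delta>: "0 < \<delta>"
    "\<And>D S. \<lbrakk>D division_of S; S \<subseteq> {a..b}; (\<Sum>K\<in>D. Sup K - Inf K) < \<delta>\<rbrakk>
       \<Longrightarrow> (\<Sum>K\<in>D. norm (w (Sup K) - w (Inf K))) < 1"
    by (rule abs_continuous_onD[OF ac, of 1]) auto
  have int: "d integrable_on {s..t}" if "{s..t} \<subseteq> {a..b}" for s t
  proof (cases "s \<le> t")
    case True
    then show ?thesis using has_integral_subinterval[of s t] that by (auto simp: integrable_on_def)
  qed (simp add: integrable_on_empty)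
  have small: "(\<lambda>t. norm (d t)) integrable_on cbox s t"
    if st: "s \<in> {a..b}" "t \<in> {a..b}" "t - s < \<delta>" for s t
  proof (cases "s \<le> t")
    case True
    have "d absolutely_integrable_on cbox s t"
    proof (rule bounded_variation_absolutely_integrable_interval)
      show "d integrable_on cbox s t" using int[of s t] st by auto
      fix D assume D: "D division_of cbox s t"
      have sub: "cbox s t \<subseteq> {a..b}" using st by auto
      have "(\<Sum>K\<in>D. norm (integral K d)) = (\<Sum>K\<in>D. norm (w (Sup K) - w (Inf K)))"
        by (intro sum.cong refl) (simp add: integral_interval_member[OF D sub])
      also have "\<dots> \<le> 1"
        using division_telescope[OF True, of D "\<lambda>t. t"] D st(3)
        by (intro less_imp_le \<delta>(2)[OF D sub]) simp
      finally show "(\<Sum>K\<in>D. norm (integral K d)) \<le> 1" .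
    qed
    then show ?thesis by (simp add: absolutely_integrable_on_def)
  qed (simp add: integrable_on_empty)
  have "(\<lambda>t. norm (d t)) integrable_on cbox a b"
  proof (rule integrable_on_little_subintervals, intro ballI exI conjI allI impI)
    \<comment> \<open>Half of \<open>\<delta>\<close>, because an interval inside the ball may
      extend to both sides of its centre.\<close>
    show "0 < \<delta> / 2" using \<delta>(1) by simp
    fix x s t assume x: "x \<in> cbox a b" and st: "x \<in> cbox s t \<and> cbox s t \<subseteq> ball x (\<delta> / 2) \<and> cbox s t \<subseteq> cbox a b"
    then have "s \<in> cbox s t" "t \<in> cbox s t" by auto
    then have "s \<in> ball x (\<delta> / 2)" "t \<in> ball x (\<delta> / 2)" "s \<in> cbox a b" "t \<in> cbox a b"
      using st by blast+
    then show "(\<lambda>t. norm (d t)) integrable_on cbox s t"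
    proof (intro small)
      show "t - s < \<delta>"
        using \<open>s \<in> ball x (\<delta> / 2)\<close> \<open>t \<in> ball x (\<delta> / 2)\<close> unfolding mem_ball dist_real_def by linarith
    qed auto
  qed
  then show ?thesis using int[of a b] by (simp add: absolutely_integrable_on_def)
qed

text \<open>Henstock's lemma replaces each term of a Riemann sum of \<open>norm (d t)\<close> by the
  norm of an integral of \<open>d\<close>, which is an increment of \<open>w\<close>. A common bound
  on variations thus becomes a common \<open>L1\<close> bound on the derivatives of the
  approximating inputs.\<close>

lemma integral_norm_le_variation:
  assumes ab: "a \<le> b" and var: "\<And>D. D division_of {a..b} \<Longrightarrow> (\<Sum>K\<in>D. norm (w (Sup K) - w (Inf K))) \<le> C"
  shows "integral {a..b} (\<lambda>t. norm (d t)) \<le> C"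
proof (rule field_le_epsilon)
  fix e :: real assume "0 < e"
  then have e2: "e / 2 > 0" by simp
  have di: "d integrable_on cbox a b" and ni: "(\<lambda>t. norm (d t)) integrable_on cbox a b"
    using absolutely_integrable by (auto simp: absolutely_integrable_on_def)
  obtain \<gamma>1 where \<gamma>1: "gauge \<gamma>1"
    "\<And>p. \<lbrakk>p tagged_partial_division_of (cbox a b); \<gamma>1 fine p\<rbrakk> \<Longrightarrow>
             sum (\<lambda>(x,K). norm(measure lborel K *\<^sub>R d x - integral K d)) p < e / 2"
    using Henstock_lemma[OF di e2] by blast
  obtain \<gamma>2 where \<gamma>2: "gauge \<gamma>2"
    "\<And>p. \<lbrakk>p tagged_division_of (cbox a b); \<gamma>2 fine p\<rbrakk> \<Longrightarrow>
       norm ((\<Sum>(x,K)\<in>p. measure lborel K *\<^sub>R norm (d x)) - integral (cbox a b) (\<lambda>t. norm (d t))) < e / 2"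
    using integrable_integral[OF ni, unfolded has_integral] e2 by meson
  obtain p where p: "p tagged_division_of cbox a b" "(\<lambda>x. \<gamma>1 x \<inter> \<gamma>2 x) fine p"
    using fine_division_exists[OF gauge_Int[OF \<gamma>1(1) \<gamma>2(1)]] by blast
  have fine: "\<gamma>1 fine p" "\<gamma>2 fine p" using p(2) by (auto simp: fine_Int)
  have pp: "p tagged_partial_division_of cbox a b" using p(1) by (simp add: tagged_division_of_def)
  note div = division_of_tagged_division[OF p(1)]
  have "integral (cbox a b) (\<lambda>t. norm (d t)) < (\<Sum>(x,K)\<in>p. measure lborel K *\<^sub>R norm (d x)) + e / 2"
    using \<gamma>2(2)[OF p(1) fine(2)] unfolding real_norm_def abs_less_iff by linarith
  also have "(\<Sum>(x,K)\<in>p. measure lborel K *\<^sub>R norm (d x))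
      \<le> (\<Sum>(x,K)\<in>p. norm (measure lborel K *\<^sub>R d x - integral K d) + norm (integral K d))"
  proof (rule sum_mono, safe)
    fix x K
    show "measure lborel K *\<^sub>R norm (d x) \<le> norm (measure lborel K *\<^sub>R d x - integral K d) + norm (integral K d)"
      using norm_triangle_sub[of "measure lborel K *\<^sub>R d x" "integral K d"] by simp
  qed
  also have "\<dots> = (\<Sum>(x,K)\<in>p. norm (measure lborel K *\<^sub>R d x - integral K d)) + (\<Sum>(x,K)\<in>p. norm (integral K d))"
    by (simp add: split_def sum.distrib)
  also have "(\<Sum>(x,K)\<in>p. norm (measure lborel K *\<^sub>R d x - integral K d)) < e / 2"
    by (rule \<gamma>1(2)[OF pp fine(1)])
  also have "(\<Sum>(x,K)\<in>p. norm (integral K d)) = (\<Sum>K\<in>snd ` p. norm (integral K d))"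
  proof (rule sum.over_tagged_division_lemma[OF p(1)])
    fix s t :: real assume "box s t = {}"
    then have "measure lborel (cbox s t) = 0" by (simp only: content_eq_0_interior interior_cbox)
    then show "norm (integral (cbox s t) d) = 0" by (simp only: integral_null norm_zero)
  qed
  also have "\<dots> = (\<Sum>K\<in>snd ` p. norm (w (Sup K) - w (Inf K)))"
    by (intro sum.cong refl) (simp add: integral_interval_member[OF div])
  also have "\<dots> \<le> C" using var div by simp
  finally show "integral {a..b} (\<lambda>t. norm (d t)) \<le> C + e" by simp
qed

end

section \<open>Flows of commuting vector fields\<close>

text \<open>The squared norm avoids differentiating the norm at zero. With
  \<open>K = 2 * L + 1\<close> the function \<open>w\<close> is nonincreasing, the extra 1 coming
  from \<open>2 * norm (y s) * \<epsilon> \<le> (norm (y s))^2 + \<epsilon>^2\<close>.\<close>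

lemma gronwall_unit_interval:
  fixes y :: "real \<Rightarrow> 'a::real_inner"
  assumes y: "\<And>s. s \<in> {0..1} \<Longrightarrow> (y has_vector_derivative y' s) (at s within {0..1})"
    and le: "\<And>s. s \<in> {0..1} \<Longrightarrow> norm (y' s) \<le> L * norm (y s) + \<epsilon>"
    and nn: "0 \<le> L" "0 \<le> \<epsilon>" and s: "s \<in> {0..1}"
  shows "norm (y s) \<le> exp (L + 1) * (norm (y 0) + \<epsilon>)"
proof -
  define K where "K = 2 * L + 1"
  define w where "w s = (y s \<bullet> y s) * exp (- (K * s)) - \<epsilon>\<^sup>2 * s" for s
  define w' where "w' s = (2 * (y s \<bullet> y' s) - K * (y s \<bullet> y s)) * exp (- (K * s)) - \<epsilon>\<^sup>2" for s
  have dw: "(w has_vector_derivative w' s) (at s within {0..1})" if "s \<in> {0..1}" for s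
    unfolding w_def w'_def has_vector_derivative_def
    by (rule has_derivative_eq_rhs, (rule derivative_eq_intros y[OF that, unfolded has_vector_derivative_def] refl)+)
       (auto simp: fun_eq_iff algebra_simps inner_commute)
  have w'_le: "w' s \<le> 0" if "s \<in> {0..1}" for s
  proof -
    have "2 * (y s \<bullet> y' s) \<le> 2 * (norm (y s) * norm (y' s))"
      using norm_cauchy_schwarz[of "y s" "y' s"] by simp
    also have "\<dots> \<le> 2 * (norm (y s) * (L * norm (y s) + \<epsilon>))"
      using le[OF that] by (simp add: mult_left_mono)
    also have "\<dots> \<le> K * (norm (y s))\<^sup>2 + \<epsilon>\<^sup>2"
      using sum_squares_ge_zero[of "norm (y s) - \<epsilon>" 0] by (simp add: K_def algebra_simps power2_eq_square)
    finally have 1: "2 * (y s \<bullet> y' s) - K * (y s \<bullet> y s) \<le> \<epsilon>\<^sup>2"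
      by (simp add: power2_norm_eq_inner)
    have "K * s \<ge> 0" using nn that by (simp add: K_def)
    then have "exp (- (K * s)) \<le> 1" by simp
    have "(2 * (y s \<bullet> y' s) - K * (y s \<bullet> y s)) * exp (- (K * s)) \<le> \<epsilon>\<^sup>2 * exp (- (K * s))"
      using 1 by (intro mult_right_mono) auto
    also have "\<dots> \<le> \<epsilon>\<^sup>2" using \<open>exp (- (K * s)) \<le> 1\<close> by (simp add: mult_left_le)
    finally show ?thesis by (simp add: w'_def)
  qed
  have "w s \<le> w 0"
  proof (cases "s = 0")
    case False
    then have "0 < s" using s by simp
    have "continuous_on {0..s} w"
      by (rule continuous_on_subset[OF continuous_on_vector_derivative[OF dw]]) (use s in auto)
    moreover have "(w has_real_derivative w' r) (at r)" if "0 < r" "r < s" for r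
    proof -
      have "(w has_vector_derivative w' r) (at r within {0<..<1})"
        by (rule has_vector_derivative_within_subset[OF dw]) (use that s in auto)
      then have "(w has_vector_derivative w' r) (at r)"
        using that s by (subst (asm) has_vector_derivative_within_open) auto
      then show ?thesis by (simp add: has_real_derivative_iff_has_vector_derivative)
    qed
    ultimately obtain l r where r: "0 < r" "r < s" "DERIV w r :> l" "w s - w 0 = (s - 0) * l"
      using MVT[OF \<open>0 < s\<close>, of w] by (auto simp: real_differentiable_def)
    have "(w has_real_derivative w' r) (at r)" using \<open>\<And>r. 0 < r \<Longrightarrow> r < s \<Longrightarrow> (w has_real_derivative w' r) (at r)\<close> r by blast
    then have "l = w' r" using r(3) DERIV_unique by blast
    then have "l \<le> 0" using w'_le[of r] r s by simp
    then have "(s - 0) * l \<le> 0" using \<open>0 < s\<close> by (simp add: mult_nonneg_nonpos)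
    then show ?thesis using r(4) by linarith
  qed simp
  then have "(norm (y s))\<^sup>2 * exp (- (K * s)) \<le> (norm (y 0))\<^sup>2 + \<epsilon>\<^sup>2 * s"
    by (simp add: w_def power2_norm_eq_inner)
  also have "\<dots> \<le> (norm (y 0))\<^sup>2 + \<epsilon>\<^sup>2" using s by (simp add: mult_left_le)
  also have "\<dots> \<le> (norm (y 0) + \<epsilon>)\<^sup>2" using nn by (simp add: power2_sum)
  finally have "(norm (y s))\<^sup>2 \<le> exp (K * s) * (norm (y 0) + \<epsilon>)\<^sup>2"
    by (simp add: exp_minus field_simps)
  \<comment> \<open>Rounding \<open>K * s\<close> up to \<open>2 * (L + 1)\<close> makes the factor
    the square of an exponential, ready for the root.\<close>
  also have "\<dots> \<le> exp (2 * (L + 1)) * (norm (y 0) + \<epsilon>)\<^sup>2"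
  proof (intro mult_right_mono)
    have "K * s \<le> K * 1" using s nn by (intro mult_left_mono) (auto simp: K_def)
    then show "exp (K * s) \<le> exp (2 * (L + 1))" by (simp add: K_def)
  qed auto
  also have "\<dots> = (exp (L + 1) * (norm (y 0) + \<epsilon>))\<^sup>2"
    by (simp only: power_mult_distrib exp_double)
  finally show ?thesis
    by (rule power2_le_imp_le) (use nn in auto)
qed

lemma vector_mean_value_unit_interval:
  fixes F :: "real \<Rightarrow> 'a::real_normed_vector"
  assumes F: "\<And>s. s \<in> {0..1} \<Longrightarrow> (F has_vector_derivative F' s) (at s within {0..1})"
    and B: "\<And>s. s \<in> {0..1} \<Longrightarrow> norm (F' s) \<le> B"
  shows "norm (F 1 - F 0) \<le> B"
proof -
  have "0 \<le> B" using B[of 0] norm_ge_zero[of "F' 0"] by (simp del: norm_ge_zero)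
  have "norm (F 1 - F 0) \<le> B * norm (1 - 0 :: real)"
  proof (rule differentiable_bound[of "{0..1}" F "\<lambda>s h. h *\<^sub>R F' s"])
    show "onorm (\<lambda>h. h *\<^sub>R F' s) \<le> B" if "s \<in> {0..1}" for s
      using B[OF that] \<open>0 \<le> B\<close> by (intro onorm_bound) (auto simp: mult.commute[of B] mult_left_mono)
  qed (use F in \<open>auto simp: has_vector_derivative_def\<close>)
  then show ?thesis by simp
qed

text \<open>Uniform continuity of \<open>h'\<close> on a slightly larger ball bounds the
  linearisation error by the oscillation of \<open>h'\<close> along the segment. Uniformity in
  \<open>y\<close> allows the estimate to be applied along a whole orbit.\<close>

lemma C1_uniformly_differentiable:
  fixes h :: "'a::euclidean_space \<Rightarrow> 'b::real_normed_vector" and h' :: "'a \<Rightarrow> 'a \<Rightarrow>\<^sub>L 'b"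
  assumes h: "\<And>x. (h has_derivative blinfun_apply (h' x)) (at x)" and cont: "continuous_on UNIV h'"
    and "0 < \<epsilon>"
  shows "\<exists>\<delta>>0. \<forall>y\<in>cball 0 R. \<forall>w. norm w \<le> \<delta> \<longrightarrow> norm (h (y + w) - h y - h' y w) \<le> \<epsilon> * norm w"
proof -
  have "uniformly_continuous_on (cball 0 (R + 1)) h'"
    using cont by (intro compact_uniformly_continuous) (auto intro: continuous_on_subset)
  then obtain d where d: "d > 0"
    "\<And>x y. x \<in> cball 0 (R+1) \<Longrightarrow> y \<in> cball 0 (R+1) \<Longrightarrow> dist y x < d \<Longrightarrow> dist (h' y) (h' x) < \<epsilon>"
    using \<open>0 < \<epsilon>\<close> unfolding uniformly_continuous_on_def by metis
  \<comment> \<open>The bound 1 keeps \<open>y + w\<close> in the larger ball; half of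
    \<open>d\<close> turns the weak inequality into a strict one.\<close>
  define \<delta> where "\<delta> = min (d / 2) 1"
  have "\<delta> > 0" using d(1) by (simp add: \<delta>_def)
  moreover have "norm (h (y + w) - h y - h' y w) \<le> \<epsilon> * norm w"
    if y: "y \<in> cball 0 R" and w: "norm w \<le> \<delta>" for y w
  proof -
    have "norm (h (y + w) - h y - h' y ((y + w) - y)) \<le> norm ((y + w) - y) * \<epsilon>"
    proof (rule differentiable_bound_linearization[where f'="\<lambda>x. blinfun_apply (h' x)" and S="cball y \<delta>"])
      show "y + t *\<^sub>R (y + w - y) \<in> cball y \<delta>" if "t \<in> {0..1}" for t
      proof -
        have "\<bar>t\<bar> * norm w \<le> 1 * norm w" using that by (intro mult_right_mono) auto
        then show ?thesis using w by (simp add: dist_norm)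
      qed
      show "(h has_derivative blinfun_apply (h' x)) (at x within cball y \<delta>)" for x
        using h has_derivative_at_withinI by blast
      show "onorm (blinfun_apply (h' x) - blinfun_apply (h' y)) \<le> \<epsilon>" if x: "x \<in> cball y \<delta>" for x
      proof -
        have "norm x \<le> norm y + dist y x" using norm_triangle_sub[of x y] by (simp add: dist_norm norm_minus_commute)
        then have "x \<in> cball 0 (R + 1)" "y \<in> cball 0 (R + 1)" "dist x y < d"
          using x y d(1) by (auto simp: \<delta>_def dist_commute)
        then have "norm (h' x - h' y) \<le> \<epsilon>" using d(2)[of y x] by (simp add: dist_norm less_imp_le)
        moreover have "blinfun_apply (h' x) - blinfun_apply (h' y) = blinfun_apply (h' x - h' y)"
          by (simp add: fun_eq_iff blinfun.diff_left)
        ultimately show ?thesis by (simp add: norm_blinfun.rep_eq)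
      qed
      show "y \<in> cball y \<delta>" using \<open>\<delta> > 0\<close> by simp
    qed
    then show ?thesis by (simp add: mult.commute)
  qed
  ultimately show ?thesis by blast
qed

text \<open>The control term with \<open>z\<close> in the place of the derivative of
  \<open>u\<close>. For fixed \<open>z\<close> it is a vector field, for fixed \<open>p\<close> a
  linear map; both views are used.\<close>

definition lincomb :: "('m \<Rightarrow> 'a \<Rightarrow> 'a) \<Rightarrow> real^'m \<Rightarrow> 'a \<Rightarrow> 'a::euclidean_space" where
  "lincomb g z p = (\<Sum>\<alpha>\<in>UNIV. z $ \<alpha> *\<^sub>R g \<alpha> p)"

lemma linear_lincomb: "linear (\<lambda>z. lincomb g z p)"
  unfolding lincomb_def by (rule linearI) (auto simp: algebra_simps sum.distrib scaleR_sum_right)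

lemma bounded_linear_lincomb: "bounded_linear (\<lambda>z. lincomb g z p)"
  using linear_lincomb linear_conv_bounded_linear by blast

lemma lincomb_simps:
  "lincomb g 0 p = 0" "lincomb g (z + w) p = lincomb g z p + lincomb g w p"
  "lincomb g (z - w) p = lincomb g z p - lincomb g w p" "lincomb g (c *\<^sub>R z) p = c *\<^sub>R lincomb g z p"
  "lincomb g (- z) p = - lincomb g z p"
  by (rule linear_0[OF linear_lincomb] linear_add[OF linear_lincomb] linear_diff[OF linear_lincomb]
        linear_scale[OF linear_lincomb] linear_neg[OF linear_lincomb])+

lemma norm_lincomb_le:
  fixes B :: real
  assumes "\<And>\<alpha>. norm (g \<alpha> p) \<le> B"
  shows "norm (lincomb g (z :: real^'m) p) \<le> CARD('m) * B * norm z"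
proof -
  have "norm (lincomb g z p) \<le> (\<Sum>\<alpha>\<in>(UNIV :: 'm set). norm z * B)"
    unfolding lincomb_def
  proof (rule sum_norm_le)
    fix \<alpha> show "norm (z $ \<alpha> *\<^sub>R g \<alpha> p) \<le> norm z * B"
      using component_le_norm_cart[of z \<alpha>] assms[of \<alpha>] by (simp add: mult_mono)
  qed
  then show ?thesis by (simp add: algebra_simps)
qed

locale C1_fields =
  fixes g :: "'m::finite \<Rightarrow> 'a::euclidean_space \<Rightarrow> 'a" and g' :: "'m \<Rightarrow> 'a \<Rightarrow> 'a \<Rightarrow>\<^sub>L 'a" and M :: real
  assumes deriv: "\<And>\<alpha> x. (g \<alpha> has_derivative blinfun_apply (g' \<alpha> x)) (at x)"
    and cont': "\<And>\<alpha>. continuous_on UNIV (g' \<alpha>)"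
    and M: "M > 0" and growth: "\<And>\<alpha> x. norm (g \<alpha> x) \<le> M * (1 + norm x)"
begin

lemma continuous_field: "continuous_on S (g \<alpha>)"
  by (intro continuous_at_imp_continuous_on ballI has_derivative_continuous[OF deriv])

lemma lincomb_growth: "norm (lincomb g z x) \<le> CARD('m) * M * norm z * (1 + norm x)"
  using norm_lincomb_le[of g x "M * (1 + norm x)" z, OF growth] by (simp add: algebra_simps)

lemma lincomb_bounded:
  assumes "norm x \<le> R"
  shows "norm (lincomb g z x) \<le> CARD('m) * M * (1 + R) * norm z"
proof -
  have "norm (lincomb g z x) \<le> CARD('m) * M * norm z * (1 + norm x)" by (rule lincomb_growth)
  also have "\<dots> \<le> CARD('m) * M * norm z * (1 + R)"
    using assms M by (intro mult_left_mono) auto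
  finally show ?thesis by (simp add: algebra_simps)
qed

text \<open>The derivatives are bounded on the compact convex ball. Keeping \<open>norm z\<close> as
  a factor lets the rate of an input, which is only integrable, be inserted for
  \<open>z\<close>.\<close>

lemma lincomb_lipschitz:
  obtains L where "L \<ge> 0"
    "\<And>z x y. norm x \<le> R \<Longrightarrow> norm y \<le> R \<Longrightarrow> norm (lincomb g z x - lincomb g z y) \<le> L * norm z * norm (x - y)"
proof -
  have "\<exists>B. \<forall>x\<in>cball 0 R. norm (g' \<alpha> x) \<le> B" for \<alpha>
  proof -
    have "compact (g' \<alpha> ` cball 0 R)"
      using cont'[of \<alpha>] by (intro compact_continuous_image) (auto intro: continuous_on_subset)
    then show ?thesis using bounded_iff compact_imp_bounded by (metis image_eqI)
  qed
  then obtain B where B: "\<And>\<alpha> x. x \<in> cball 0 R \<Longrightarrow> norm (g' \<alpha> x) \<le> B \<alpha>" by metis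
  define L0 where "L0 = (\<Sum>\<alpha>\<in>UNIV. \<bar>B \<alpha>\<bar>)"
  have L0: "\<bar>B \<alpha>\<bar> \<le> L0" for \<alpha> unfolding L0_def by (rule member_le_sum) auto
  then have "L0 \<ge> 0" using abs_ge_zero order_trans by blast
  have lip: "norm (g \<alpha> x - g \<alpha> y) \<le> L0 * norm (x - y)" if "norm x \<le> R" "norm y \<le> R" for \<alpha> x y
  proof (rule differentiable_bound[of "cball 0 R" "g \<alpha>" "\<lambda>x. blinfun_apply (g' \<alpha> x)"])
    show "onorm (blinfun_apply (g' \<alpha> p)) \<le> L0" if "p \<in> cball 0 R" for p
      using B[OF that, of \<alpha>] L0[of \<alpha>] by (simp add: norm_blinfun.rep_eq[symmetric])
  qed (use that in \<open>auto intro: has_derivative_at_withinI[OF deriv]\<close>)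
  show thesis
  proof
    show "0 \<le> CARD('m) * L0" using \<open>L0 \<ge> 0\<close> by simp
    fix z :: "real^'m" and x y :: 'a assume xy: "norm x \<le> R" "norm y \<le> R"
    \<comment> \<open>Evaluated at \<open>x\<close> and \<open>y\<close>, the differences are
      constant fields, to which the general norm bound applies.\<close>
    have "lincomb g z x - lincomb g z y = lincomb (\<lambda>\<alpha> _. g \<alpha> x - g \<alpha> y) z x"
      by (simp add: lincomb_def sum_subtractf scaleR_diff_right)
    also have "norm \<dots> \<le> CARD('m) * (L0 * norm (x - y)) * norm z"
      by (rule norm_lincomb_le) (rule lip[OF xy])
    finally show "norm (lincomb g z x - lincomb g z y) \<le> CARD('m) * L0 * norm z * norm (x - y)"
      by (simp add: algebra_simps)
  qed
qed

end

section \<open>Integral curves over unit time and their dependence on the start\<close>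

lemma norm_axis: "norm (axis \<alpha> (c::real)) = \<bar>c\<bar>"
  by (simp add: norm_eq_sqrt_inner inner_axis_axis)

context C1_fields
begin

text \<open>Time is normalised to the unit interval, so the size of \<open>z\<close> takes the part
  of the elapsed time.\<close>

definition integral_curve :: "real^'m \<Rightarrow> (real \<Rightarrow> 'a) \<Rightarrow> bool" where
  "integral_curve z y \<longleftrightarrow>
     (\<forall>s\<in>{0..1}. (y has_vector_derivative lincomb g z (y s)) (at s within {0..1}))"

text \<open>Gronwall's bound when the slope and the inhomogeneity both equal
  \<open>CARD('m) * M * r\<close>, as linear growth gives.\<close>

definition curve_bound :: "real \<Rightarrow> real \<Rightarrow> real" where
  "curve_bound r R = exp (CARD('m) * M * r + 1) * (R + CARD('m) * M * r)"

lemma integral_curve_bounded: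
  assumes y: "integral_curve z y" and z: "norm z \<le> r" and R: "norm (y 0) \<le> R" and s: "s \<in> {0..1}"
  shows "norm (y s) \<le> curve_bound r R"
proof -
  define k where "k = CARD('m) * M * r"
  have "r \<ge> 0" using z norm_ge_zero order_trans by blast
  then have k: "k \<ge> 0" using M by (simp add: k_def)
  have "norm (y s) \<le> exp (k + 1) * (norm (y 0) + k)"
  proof (rule gronwall_unit_interval[where y'="\<lambda>s. lincomb g z (y s)"])
    fix s :: real
    have "norm (lincomb g z (y s)) \<le> CARD('m) * M * norm z * (1 + norm (y s))" by (rule lincomb_growth)
    also have "\<dots> \<le> CARD('m) * M * r * (1 + norm (y s))"
      using z M by (intro mult_right_mono mult_left_mono) auto
    finally show "norm (lincomb g z (y s)) \<le> k * norm (y s) + k" by (simp add: k_def algebra_simps)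
  qed (use y s k in \<open>auto simp: integral_curve_def\<close>)
  also have "\<dots> \<le> curve_bound r R"
    unfolding curve_bound_def k_def[symmetric] using R by (intro mult_left_mono) auto
  finally show ?thesis .
qed

text \<open>Gronwall's inequality for the difference of two curves, both confined to the ball given
  by \<open>curve_bound\<close>. Equal starting points yield uniqueness, from which the additivity
  of the joint flow follows.\<close>

lemma integral_curve_lipschitz:
  assumes "r \<ge> 0"
  obtains C where "C \<ge> 0"
    "\<And>z y1 y2 s. \<lbrakk>integral_curve z y1; integral_curve z y2; norm z \<le> r; norm (y1 0) \<le> R; norm (y2 0) \<le> R; s \<in> {0..1}\<rbrakk>
       \<Longrightarrow> norm (y1 s - y2 s) \<le> C * norm (y1 0 - y2 0)"
proof -
  obtain L where L: "L \<ge> 0"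
    "\<And>z x y. norm x \<le> curve_bound r R \<Longrightarrow> norm y \<le> curve_bound r R \<Longrightarrow>
       norm (lincomb g z x - lincomb g z y) \<le> L * norm z * norm (x - y)"
    by (rule lincomb_lipschitz[of "curve_bound r R"]) blast
  show thesis
  proof
    show "exp (L * r + 1) \<ge> 0" by simp
    fix z y1 y2 and s :: real
    assume *: "integral_curve z y1" "integral_curve z y2" "norm z \<le> r" "norm (y1 0) \<le> R" "norm (y2 0) \<le> R" "s \<in> {0..1}"
    have "norm (y1 s - y2 s) \<le> exp (L * r + 1) * (norm (y1 0 - y2 0) + 0)"
    proof (rule gronwall_unit_interval[where y="\<lambda>s. y1 s - y2 s" and y'="\<lambda>s. lincomb g z (y1 s) - lincomb g z (y2 s)"])
      fix s :: real assume s: "s \<in> {0..1}"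
      show "((\<lambda>s. y1 s - y2 s) has_vector_derivative lincomb g z (y1 s) - lincomb g z (y2 s)) (at s within {0..1})"
        using *(1,2) s by (intro has_vector_derivative_diff) (auto simp: integral_curve_def)
      have "norm (lincomb g z (y1 s) - lincomb g z (y2 s)) \<le> L * norm z * norm (y1 s - y2 s)"
        using * s by (intro L(2) integral_curve_bounded)
      also have "\<dots> \<le> L * r * norm (y1 s - y2 s)"
        using L(1) *(3) by (intro mult_right_mono mult_left_mono) auto
      finally show "norm (lincomb g z (y1 s) - lincomb g z (y2 s)) \<le> L * r * norm (y1 s - y2 s) + 0" by simp
    qed (use L(1) assms *(6) in auto)
    then show "norm (y1 s - y2 s) \<le> exp (L * r + 1) * norm (y1 0 - y2 0)" by simp
  qed
qed

lemma lincomb_axis: "lincomb g (axis \<alpha> c) p = c *\<^sub>R g \<alpha> p"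
proof -
  have "lincomb g (axis \<alpha> c) p = (\<Sum>\<beta>\<in>UNIV. if \<beta> = \<alpha> then c *\<^sub>R g \<alpha> p else 0)"
    unfolding lincomb_def by (rule sum.cong) (auto simp: axis_def)
  then show ?thesis by simp
qed

end

text \<open>Composing the flows of the fields in \<open>A\<close> alone gives a map with derivative
  \<open>lincomb g (mask A k)\<close>; the set \<open>A\<close> grows by one index in the
  induction.\<close>

definition mask :: "'m set \<Rightarrow> real^'m \<Rightarrow> real^'m::finite" where
  "mask A k = (\<chi> \<alpha>. if \<alpha> \<in> A then k $ \<alpha> else 0)"

lemma mask_nth [simp]: "mask A k $ \<alpha> = (if \<alpha> \<in> A then k $ \<alpha> else 0)"
  by (simp add: mask_def)

lemma norm_mask_le: "norm (mask A k) \<le> norm k"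
  by (rule norm_le_componentwise_cart) simp

lemma linear_mask: "linear (mask A)"
  by (rule linearI) (auto simp: vec_eq_iff)

locale commuting_flows = C1_fields g g' M
  for g :: "'m::finite \<Rightarrow> 'a::euclidean_space \<Rightarrow> 'a" and g' M +
  fixes \<phi> :: "'m \<Rightarrow> 'a \<Rightarrow> real \<Rightarrow> 'a"
  assumes commute: "\<And>\<alpha> \<beta> x. g' \<beta> x (g \<alpha> x) = g' \<alpha> x (g \<beta> x)"
    and flow_0: "\<And>\<alpha> p. \<phi> \<alpha> p 0 = p"
    and flow_deriv: "\<And>\<alpha> p t. (\<phi> \<alpha> p has_vector_derivative g \<alpha> (\<phi> \<alpha> p t)) (at t)"
begin

lemma flow_rescaled:
  "((\<lambda>s. \<phi> \<alpha> p (c * s)) has_vector_derivative c *\<^sub>R g \<alpha> (\<phi> \<alpha> p (c * s))) (at s within S)"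
proof -
  have "((\<phi> \<alpha> p \<circ> (\<lambda>s. c * s)) has_vector_derivative (c *\<^sub>R g \<alpha> (\<phi> \<alpha> p (c * s)))) (at s within S)"
  proof (rule vector_diff_chain_within)
    show "((*) c has_vector_derivative c) (at s within S)"
      by (auto intro!: derivative_eq_intros)
    show "(\<phi> \<alpha> p has_vector_derivative g \<alpha> (\<phi> \<alpha> p (c * s))) (at (c * s) within (*) c ` S)"
      using flow_deriv has_vector_derivative_at_within by blast
  qed
  then show ?thesis by (simp add: o_def)
qed

lemma integral_curve_flow: "integral_curve (axis \<alpha> c) (\<lambda>s. \<phi> \<alpha> p (c * s))"
  unfolding integral_curve_def lincomb_axis using flow_rescaled by blast

text \<open>Lipschitz dependence on the start, uniform for times near \<open>s\<^sub>0\<close>, is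
  combined with continuity in time at the fixed start \<open>p\<close>. A flow over time
  \<open>c\<close> is a unit-time curve of \<open>axis \<alpha> c\<close>.\<close>

lemma flow_continuous: "isCont (\<lambda>(x, s). \<phi> \<alpha> x s) (p, s\<^sub>0)"
proof -
  define R where "R = norm p + 1"
  define r where "r = \<bar>s\<^sub>0\<bar> + 1"
  obtain C where C: "C \<ge> 0"
    "\<And>z y1 y2 s. \<lbrakk>integral_curve z y1; integral_curve z y2; norm z \<le> r; norm (y1 0) \<le> R; norm (y2 0) \<le> R; s \<in> {0..1}\<rbrakk>
       \<Longrightarrow> norm (y1 s - y2 s) \<le> C * norm (y1 0 - y2 0)"
    by (rule integral_curve_lipschitz[of r R]) (auto simp: r_def)
  have ev: "\<forall>\<^sub>F w in at (p, s\<^sub>0). dist w (p, s\<^sub>0) < 1"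
    unfolding eventually_at by (intro exI[of _ 1]) simp
  have ev': "\<forall>\<^sub>F w in at (p, s\<^sub>0). norm (\<phi> \<alpha> (fst w) (snd w) - \<phi> \<alpha> p (snd w)) \<le> C * norm (fst w - p)"
    using ev
  proof eventually_elim
    case (elim w)
    have "norm (fst w - p) < 1" "\<bar>snd w - s\<^sub>0\<bar> < 1"
      using elim dist_fst_le[of w "(p, s\<^sub>0)"] dist_snd_le[of w "(p, s\<^sub>0)"] by (auto simp: dist_norm)
    moreover from this have "norm (fst w) \<le> R" using norm_triangle_sub[of "fst w" p] by (simp add: R_def)
    ultimately have "norm (\<phi> \<alpha> (fst w) (snd w * 1) - \<phi> \<alpha> p (snd w * 1))
        \<le> C * norm (\<phi> \<alpha> (fst w) (snd w * 0) - \<phi> \<alpha> p (snd w * 0))"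
      by (intro C(2)[OF integral_curve_flow integral_curve_flow]) (auto simp: flow_0 R_def r_def norm_axis)
    then show ?case by (simp add: flow_0)
  qed
  have t0: "((\<lambda>w. C * norm (fst w - p)) \<longlongrightarrow> C * norm (fst (p, s\<^sub>0) - p)) (at (p, s\<^sub>0))"
    by (intro tendsto_intros)
  then have "((\<lambda>w. C * norm (fst w - p)) \<longlongrightarrow> 0) (at (p, s\<^sub>0))" by simp
  then have 1: "((\<lambda>w. \<phi> \<alpha> (fst w) (snd w) - \<phi> \<alpha> p (snd w)) \<longlongrightarrow> 0) (at (p, s\<^sub>0))"
    by (rule Lim_null_comparison[OF ev'])
  have "isCont (\<phi> \<alpha> p) (snd (p, s\<^sub>0))" using flow_deriv[of \<alpha> p s\<^sub>0] has_vector_derivative_continuous by auto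
  moreover have "(snd \<longlongrightarrow> snd (p, s\<^sub>0)) (at (p, s\<^sub>0))" by (intro tendsto_intros)
  ultimately have "((\<lambda>w. \<phi> \<alpha> p (snd w)) \<longlongrightarrow> \<phi> \<alpha> p (snd (p, s\<^sub>0))) (at (p, s\<^sub>0))"
    by (rule isCont_tendsto_compose)
  from tendsto_add[OF 1 this] show ?thesis by (simp add: isCont_def case_prod_unfold)
qed

text \<open>The field \<open>lincomb g k\<close> restricted to an orbit of \<open>g \<beta>\<close> solves the linearised equation,
  because the brackets vanish. So \<open>y + lincomb g k y\<close> is an approximate orbit, and Gronwall's
  inequality compares it with the true one; the derivative of the flow with respect to its
  initial value is never needed.\<close>

lemma flow_pushes_lincomb:
  assumes \<psi>: "(\<psi> has_derivative (\<lambda>k. lincomb g (mask A k) (\<psi> z))) (at (z :: real^'m))"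
  shows "((\<lambda>w. \<phi> \<beta> (\<psi> w) c) has_derivative (\<lambda>k. lincomb g (mask A k) (\<phi> \<beta> (\<psi> z) c))) (at z)"
  unfolding has_derivative_at_alt
proof (intro conjI allI impI)
  show "bounded_linear (\<lambda>k. lincomb g (mask A k) (\<phi> \<beta> (\<psi> z) c))"
    using linear_compose[OF linear_mask linear_lincomb] linear_conv_bounded_linear
    by (auto simp: o_def)
next
  fix e :: real assume "0 < e"
  define p where "p = \<psi> z"
  define R where "R = norm p + 1"
  define R1 where "R1 = curve_bound \<bar>c\<bar> R"
  define K1 where "K1 = CARD('m) * M * (1 + R1)"
  define y where "y \<sigma> = \<phi> \<beta> p (c * \<sigma>)" for \<sigma>
  have bnd: "norm (\<phi> \<beta> q (c * \<sigma>)) \<le> R1" if "norm q \<le> R" "\<sigma> \<in> {0..1}" for q \<sigma>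
    unfolding R1_def
    by (rule integral_curve_bounded[OF integral_curve_flow[of \<beta> c q]]) (use that in \<open>auto simp: norm_axis flow_0\<close>)
  have y_bnd: "norm (y \<sigma>) \<le> R1" if "\<sigma> \<in> {0..1}" for \<sigma>
    unfolding y_def using that by (intro bnd) (auto simp: R_def)
  have "R1 \<ge> 0" using y_bnd[of 0] norm_ge_zero[of "y 0"] by (simp del: norm_ge_zero)
  then have K1: "K1 \<ge> 0" using M by (simp add: K1_def)
  obtain L where L: "L \<ge> 0"
    "\<And>w x y. norm x \<le> R1 + 1 \<Longrightarrow> norm y \<le> R1 + 1 \<Longrightarrow>
       norm (lincomb g w x - lincomb g w y) \<le> L * norm w * norm (x - y)"
    by (rule lincomb_lipschitz[of "R1 + 1"]) blast
  have Lg: "norm (g \<beta> x - g \<beta> y) \<le> L * norm (x - y)" if "norm x \<le> R1 + 1" "norm y \<le> R1 + 1" for x y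
    using L(2)[OF that, of "axis \<beta> 1"] by (simp add: lincomb_axis norm_axis)
  \<comment> \<open>Divided by the Gronwall factor and by the combined weight of the initial and the
    accumulated error, so that the last bound is exactly \<open>e * k\<close>.\<close>
  define \<epsilon> where "\<epsilon> = e / (exp (\<bar>c\<bar> * L + 1) * (1 + \<bar>c\<bar> * K1))"
  have pos: "exp (\<bar>c\<bar> * L + 1) * (1 + \<bar>c\<bar> * K1) > 0"
    using K1 by (intro mult_pos_pos) (auto intro: add_pos_nonneg)
  have \<epsilon>: "\<epsilon> > 0" using \<open>0 < e\<close> pos by (simp add: \<epsilon>_def)
  obtain \<delta> where \<delta>: "\<delta> > 0"
    "\<And>x w. x \<in> cball 0 R1 \<Longrightarrow> norm w \<le> \<delta> \<Longrightarrow> norm (g \<beta> (x + w) - g \<beta> x - g' \<beta> x w) \<le> \<epsilon> * norm w"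
    using C1_uniformly_differentiable[OF deriv cont' \<epsilon>, of R1] by blast
  obtain d where d: "d > 0"
    "\<And>w. norm (w - z) < d \<Longrightarrow> norm (\<psi> w - \<psi> z - lincomb g (mask A (w - z)) (\<psi> z)) \<le> \<epsilon> * norm (w - z)"
    using \<psi> \<epsilon> unfolding has_derivative_at_alt by blast
  \<comment> \<open>The first entry gives differentiability of \<open>\<psi>\<close>, the second
    keeps \<open>D\<close> below \<open>\<delta>\<close> and 1, the third keeps
    \<open>\<psi> w\<close> in the ball of radius \<open>R\<close>.\<close>
  define \<eta> where "\<eta> = min d (min (min \<delta> 1 / (K1 + 1)) (1 / (\<epsilon> + K1 + 1)))"
  have \<eta>: "\<eta> > 0" using d(1) \<delta>(1) K1 \<epsilon> by (simp add: \<eta>_def)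
  show "\<exists>d>0. \<forall>w. norm (w - z) < d \<longrightarrow>
      norm (\<phi> \<beta> (\<psi> w) c - \<phi> \<beta> (\<psi> z) c - lincomb g (mask A (w - z)) (\<phi> \<beta> (\<psi> z) c)) \<le> e * norm (w - z)"
  proof (intro exI[of _ \<eta>] conjI \<eta> allI impI)
    fix w assume w: "norm (w - z) < \<eta>"
    define k where "k = norm (w - z)"
    have k: "k \<ge> 0" "k < d" "K1 * k \<le> min \<delta> 1" "(\<epsilon> + K1) * k \<le> 1"
    proof -
      show "k \<ge> 0" by (simp add: k_def)
      show "k < d" using w by (simp add: k_def \<eta>_def)
      have "k \<le> min \<delta> 1 / (K1 + 1)" using w by (simp add: k_def \<eta>_def)
      then have "k * (K1 + 1) \<le> min \<delta> 1" using K1 by (subst (asm) pos_le_divide_eq) auto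
      moreover have "k * (K1 + 1) = K1 * k + k" by (simp add: algebra_simps)
      ultimately show "K1 * k \<le> min \<delta> 1" using \<open>k \<ge> 0\<close> by linarith
      have "k \<le> 1 / (\<epsilon> + K1 + 1)" using w by (simp add: k_def \<eta>_def)
      then have "k * (\<epsilon> + K1 + 1) \<le> 1" using K1 \<epsilon> by (subst (asm) pos_le_divide_eq) auto
      then show "(\<epsilon> + K1) * k \<le> 1" using \<open>k \<ge> 0\<close> by (simp add: algebra_simps)
    qed
    \<comment> \<open>The candidate for the first variation of the orbit \<open>y\<close> when its
      start is moved in the direction \<open>lincomb g (mask A (w - z)) p\<close>.\<close>
    define D where "D \<sigma> = lincomb g (mask A (w - z)) (y \<sigma>)" for \<sigma>
    have D: "norm (D \<sigma>) \<le> K1 * k" if "\<sigma> \<in> {0..1}" for \<sigma>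
    proof -
      have "norm (D \<sigma>) \<le> K1 * norm (mask A (w - z))"
        unfolding D_def K1_def by (rule lincomb_bounded[OF y_bnd[OF that]])
      also have "\<dots> \<le> K1 * k" unfolding k_def using K1 by (intro mult_left_mono norm_mask_le)
      finally show ?thesis .
    qed
    define Y where "Y \<sigma> = \<phi> \<beta> (\<psi> w) (c * \<sigma>)" for \<sigma>
    have y0: "y 0 = p" and Y0: "Y 0 = \<psi> w" by (simp_all add: y_def Y_def flow_0)
    have E0: "norm (\<psi> w - p - D 0) \<le> \<epsilon> * k"
      using d(2)[of w] k(2) by (simp add: D_def y0 p_def k_def)
    have "norm (\<psi> w - p) \<le> \<epsilon> * k + K1 * k"
      using E0 D[of 0] norm_triangle_sub[of "\<psi> w - p" "D 0"] by simp
    then have "norm (\<psi> w - p) \<le> 1" using k(4) by (simp add: algebra_simps)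
    then have "norm (\<psi> w) \<le> R" using norm_triangle_sub[of "\<psi> w" p] by (simp add: R_def)
    then have Y_bnd: "norm (Y \<sigma>) \<le> R1" if "\<sigma> \<in> {0..1}" for \<sigma>
      unfolding Y_def using that by (intro bnd)
    have dy: "(y has_vector_derivative c *\<^sub>R g \<beta> (y \<sigma>)) (at \<sigma> within {0..1})" for \<sigma>
      unfolding y_def by (rule flow_rescaled)
    have dY: "(Y has_vector_derivative c *\<^sub>R g \<beta> (Y \<sigma>)) (at \<sigma> within {0..1})" for \<sigma>
      unfolding Y_def by (rule flow_rescaled)
    have dD: "(D has_vector_derivative c *\<^sub>R g' \<beta> (y \<sigma>) (D \<sigma>)) (at \<sigma> within {0..1})" for \<sigma>
    proof -
      have "((\<lambda>\<sigma>. g \<alpha> (y \<sigma>)) has_vector_derivative g' \<alpha> (y \<sigma>) (c *\<^sub>R g \<beta> (y \<sigma>))) (at \<sigma> within {0..1})" for \<alpha>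
        using has_derivative_compose[OF dy[unfolded has_vector_derivative_def] deriv[of \<alpha>]]
        by (simp add: has_vector_derivative_def blinfun.scaleR_right)
      then have "(D has_vector_derivative (\<Sum>\<alpha>\<in>UNIV. mask A (w - z) $ \<alpha> *\<^sub>R g' \<alpha> (y \<sigma>) (c *\<^sub>R g \<beta> (y \<sigma>)))) (at \<sigma> within {0..1})"
        unfolding D_def lincomb_def
        by (intro has_vector_derivative_sum bounded_linear.has_vector_derivative[OF bounded_linear_scaleR_right])
      \<comment> \<open>Here the brackets enter: the derivative of \<open>g \<alpha>\<close> in
        direction \<open>g \<beta>\<close> is exchanged for that of \<open>g \<beta>\<close> in
        direction \<open>g \<alpha>\<close>.\<close>
      also have "(\<Sum>\<alpha>\<in>UNIV. mask A (w - z) $ \<alpha> *\<^sub>R g' \<alpha> (y \<sigma>) (c *\<^sub>R g \<beta> (y \<sigma>))) = c *\<^sub>R g' \<beta> (y \<sigma>) (D \<sigma>)"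
        unfolding D_def lincomb_def
        by (simp add: blinfun.scaleR_right blinfun.sum_right scaleR_sum_right commute[where \<alpha>=\<beta>]
            mult.commute del: mask_nth)
      finally show ?thesis .
    qed
    define E where "E \<sigma> = Y \<sigma> - y \<sigma> - D \<sigma>" for \<sigma>
    define E' where "E' \<sigma> = c *\<^sub>R g \<beta> (Y \<sigma>) - c *\<^sub>R g \<beta> (y \<sigma>) - c *\<^sub>R g' \<beta> (y \<sigma>) (D \<sigma>)" for \<sigma>
    have "norm (E 1) \<le> exp (\<bar>c\<bar> * L + 1) * (norm (E 0) + \<bar>c\<bar> * (\<epsilon> * (K1 * k)))"
    proof (rule gronwall_unit_interval[where y'=E'])
      fix \<sigma> :: real assume \<sigma>: "\<sigma> \<in> {0..1}"
      show "(E has_vector_derivative E' \<sigma>) (at \<sigma> within {0..1})"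
        unfolding E_def E'_def by (intro has_vector_derivative_diff dy dY dD)
      have D1: "norm (D \<sigma>) \<le> min \<delta> 1" using D[OF \<sigma>] k(3) by linarith
      have 1: "norm (g \<beta> (Y \<sigma>) - g \<beta> (y \<sigma> + D \<sigma>)) \<le> L * norm (E \<sigma>)"
      proof -
        have "norm (y \<sigma> + D \<sigma>) \<le> R1 + 1" using D1 y_bnd[OF \<sigma>] norm_triangle_ineq[of "y \<sigma>" "D \<sigma>"] by simp
        then have "norm (g \<beta> (Y \<sigma>) - g \<beta> (y \<sigma> + D \<sigma>)) \<le> L * norm (Y \<sigma> - (y \<sigma> + D \<sigma>))"
          using Y_bnd[OF \<sigma>] by (intro Lg) auto
        then show ?thesis by (simp add: E_def algebra_simps)
      qed
      have 2: "norm (g \<beta> (y \<sigma> + D \<sigma>) - g \<beta> (y \<sigma>) - g' \<beta> (y \<sigma>) (D \<sigma>)) \<le> \<epsilon> * (K1 * k)"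
      proof -
        have "norm (g \<beta> (y \<sigma> + D \<sigma>) - g \<beta> (y \<sigma>) - g' \<beta> (y \<sigma>) (D \<sigma>)) \<le> \<epsilon> * norm (D \<sigma>)"
          using y_bnd[OF \<sigma>] D1 by (intro \<delta>(2)) auto
        also have "\<dots> \<le> \<epsilon> * (K1 * k)" using D[OF \<sigma>] \<epsilon> by (intro mult_left_mono) auto
        finally show ?thesis .
      qed
      \<comment> \<open>The intermediate point \<open>y \<sigma> + D \<sigma>\<close> separates a
        Lipschitz term in \<open>E\<close> from the linearisation error of
        \<open>g \<beta>\<close>.\<close>
      have "E' \<sigma> = c *\<^sub>R ((g \<beta> (Y \<sigma>) - g \<beta> (y \<sigma> + D \<sigma>)) + (g \<beta> (y \<sigma> + D \<sigma>) - g \<beta> (y \<sigma>) - g' \<beta> (y \<sigma>) (D \<sigma>)))"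
        by (simp add: E'_def algebra_simps)
      then have "norm (E' \<sigma>) = \<bar>c\<bar> * norm ((g \<beta> (Y \<sigma>) - g \<beta> (y \<sigma> + D \<sigma>)) + (g \<beta> (y \<sigma> + D \<sigma>) - g \<beta> (y \<sigma>) - g' \<beta> (y \<sigma>) (D \<sigma>)))"
        by simp
      also have "\<dots> \<le> \<bar>c\<bar> * (L * norm (E \<sigma>) + \<epsilon> * (K1 * k))"
        using 1 2 by (intro mult_left_mono norm_triangle_le) auto
      finally show "norm (E' \<sigma>) \<le> \<bar>c\<bar> * L * norm (E \<sigma>) + \<bar>c\<bar> * (\<epsilon> * (K1 * k))" by (simp add: algebra_simps)
    qed (use L(1) \<epsilon> K1 k in auto)
    also have "\<dots> \<le> exp (\<bar>c\<bar> * L + 1) * (\<epsilon> * k + \<bar>c\<bar> * (\<epsilon> * (K1 * k)))"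
      using E0 by (intro mult_left_mono add_right_mono) (auto simp: E_def y0 Y0)
    also have "\<dots> = (exp (\<bar>c\<bar> * L + 1) * (1 + \<bar>c\<bar> * K1)) * \<epsilon> * k" by (simp add: algebra_simps)
    also have "\<dots> = e * k"
      unfolding \<epsilon>_def times_divide_eq_right
      by (simp only: nonzero_mult_div_cancel_left[OF less_imp_neq[OF pos, symmetric]])
    finally show "norm (\<phi> \<beta> (\<psi> w) c - \<phi> \<beta> (\<psi> z) c - lincomb g (mask A (w - z)) (\<phi> \<beta> (\<psi> z) c)) \<le> e * norm (w - z)"
      by (simp add: E_def Y_def y_def D_def p_def k_def)
  qed
qed

end

context commuting_flows
begin

text \<open>Total differentiability from partial derivatives: the one in \<open>w\<close> is the
  transport of \<open>lincomb\<close> by the flow, the one in time is the flow equation, whose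
  right-hand side is jointly continuous. The chain rule then inserts the time
  \<open>w $ \<beta>\<close>.\<close>

lemma flow_composition_step:
  assumes \<psi>: "\<And>z. (\<psi> has_derivative (\<lambda>k. lincomb g (mask A k) (\<psi> z))) (at (z :: real^'m))"
    and "\<beta> \<notin> A"
  shows "((\<lambda>w. \<phi> \<beta> (\<psi> w) (w $ \<beta>)) has_derivative
     (\<lambda>k. lincomb g (mask (insert \<beta> A) k) (\<phi> \<beta> (\<psi> z) (z $ \<beta>)))) (at z)"
proof -
  let ?f = "\<lambda>w s. \<phi> \<beta> (\<psi> w) s"
  have "((\<lambda>(w, s). ?f w s) has_derivative
      (\<lambda>(k, h). lincomb g (mask A k) (?f z (z $ \<beta>)) + blinfun_scaleR_left (g \<beta> (?f z (z $ \<beta>))) h))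
      (at (z, z $ \<beta>) within UNIV \<times> UNIV)"
  proof (rule has_derivative_partialsI)
    show "((\<lambda>w. ?f w (z $ \<beta>)) has_derivative (\<lambda>k. lincomb g (mask A k) (?f z (z $ \<beta>)))) (at z)"
      by (rule flow_pushes_lincomb[OF \<psi>])
    show "(?f w has_derivative blinfun_apply (blinfun_scaleR_left (g \<beta> (?f w s)))) (at s)" for w s
      using flow_deriv[of \<beta> "\<psi> w" s] by (simp add: has_vector_derivative_def)
    have "isCont \<psi> z" using \<psi> has_derivative_continuous by blast
    then have "isCont (\<lambda>p. \<psi> (fst p)) (z, z $ \<beta>)"
      by (intro isCont_o2[OF isCont_fst[OF continuous_ident]]) (simp only: fst_conv)
    then have "isCont (\<lambda>p. (\<psi> (fst p), snd p)) (z, z $ \<beta>)"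
      by (rule isCont_Pair) (rule isCont_snd[OF continuous_ident])
    then have "isCont (\<lambda>p. (\<lambda>(x, s). \<phi> \<beta> x s) (\<psi> (fst p), snd p)) (z, z $ \<beta>)"
      by (rule isCont_o2) (simp only: fst_conv snd_conv flow_continuous)
    then have "isCont (\<lambda>p. \<phi> \<beta> (\<psi> (fst p)) (snd p)) (z, z $ \<beta>)" by simp
    then have "isCont (\<lambda>p. g \<beta> (\<phi> \<beta> (\<psi> (fst p)) (snd p))) (z, z $ \<beta>)"
      by (rule isCont_o2) (rule has_derivative_continuous[OF deriv])
    then show "continuous (at (z, z $ \<beta>) within UNIV \<times> UNIV) (\<lambda>(w, s). blinfun_scaleR_left (g \<beta> (?f w s)))"
      by (simp add: case_prod_unfold bounded_linear.isCont[OF bounded_linear_blinfun_scaleR_left])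
  qed auto
  then have 1: "((\<lambda>(w, s). ?f w s) has_derivative
      (\<lambda>(k, h). lincomb g (mask A k) (?f z (z $ \<beta>)) + h *\<^sub>R g \<beta> (?f z (z $ \<beta>)))) (at (z, z $ \<beta>))"
    by simp
  have 2: "((\<lambda>w. (w, w $ \<beta>)) has_derivative (\<lambda>k. (k, k $ \<beta>))) (at z)"
    by (intro has_derivative_Pair has_derivative_ident bounded_linear_imp_has_derivative bounded_linear_vec_nth)
  have "lincomb g (mask (insert \<beta> A) k) q = lincomb g (mask A k) q + (k $ \<beta>) *\<^sub>R g \<beta> q" for k q
  proof -
    have "mask (insert \<beta> A) k = mask A k + axis \<beta> (k $ \<beta>)"
      using \<open>\<beta> \<notin> A\<close> by (auto simp: vec_eq_iff axis_def)
    then show ?thesis by (simp add: lincomb_simps lincomb_axis)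
  qed
  then show ?thesis using has_derivative_compose[OF 2 1] by simp
qed

text \<open>Each new field flows for the time given by its own coordinate, from the point already
  reached.\<close>

lemma product_flow_exists:
  assumes "finite A"
  shows "\<exists>\<psi>. \<psi> 0 = p \<and> (\<forall>z. (\<psi> has_derivative (\<lambda>k. lincomb g (mask A k) (\<psi> z))) (at z))"
  using assms
proof induction
  case empty
  have "mask {} k = 0" for k :: "real^'m" by (simp add: vec_eq_iff)
  then show ?case by (intro exI[of _ "\<lambda>_. p"]) (simp add: lincomb_simps)
next
  case (insert \<beta> A)
  then obtain \<psi> where \<psi>: "\<psi> 0 = p" "\<And>z. (\<psi> has_derivative (\<lambda>k. lincomb g (mask A k) (\<psi> z))) (at z)"
    by blast
  show ?case
    using flow_composition_step[OF \<psi>(2) insert.hyps(2)]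
    by (intro exI[of _ "\<lambda>w. \<phi> \<beta> (\<psi> w) (w $ \<beta>)"]) (simp add: \<psi>(1) flow_0)
qed

end

text \<open>What survives of the individual flows: a map whose derivative in \<open>z\<close> is the
  control term in every direction at once. Commutativity is encoded in the existence of such a
  map.\<close>

locale product_flow = C1_fields g g' M
  for g :: "'m::finite \<Rightarrow> 'a::euclidean_space \<Rightarrow> 'a" and g' M +
  fixes \<Psi> :: "'a \<Rightarrow> real^'m \<Rightarrow> 'a"
  assumes \<Psi>_0 [simp]: "\<And>p. \<Psi> p 0 = p"
    and \<Psi>_deriv: "\<And>p z. (\<Psi> p has_derivative (\<lambda>k. lincomb g k (\<Psi> p z))) (at z)"

lemma (in commuting_flows) product_flow_ex: "\<exists>\<Psi>. product_flow g g' M \<Psi>"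
proof -
  have m: "mask UNIV k = k" for k :: "real^'m" by (simp add: vec_eq_iff)
  obtain \<Psi> where "\<And>p. \<Psi> p 0 = p" "\<And>p z. (\<Psi> p has_derivative (\<lambda>k. lincomb g k (\<Psi> p z))) (at z)"
    using product_flow_exists[of UNIV] unfolding m by (metis finite)
  then have "product_flow g g' M \<Psi>" by unfold_locales auto
  then show ?thesis by blast
qed

section \<open>The joint flow as an action of the input space\<close>

context product_flow
begin

lemma integral_curve_\<Psi>: "integral_curve z (\<lambda>s. \<Psi> p (w + s *\<^sub>R z))"
  unfolding integral_curve_def
proof
  fix s :: real
  have "((\<lambda>s. w + s *\<^sub>R z) has_derivative (\<lambda>h. h *\<^sub>R z)) (at s within {0..1})"
    by (auto intro!: derivative_eq_intros)
  from has_derivative_compose[OF this \<Psi>_deriv]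
  show "((\<lambda>s. \<Psi> p (w + s *\<^sub>R z)) has_vector_derivative lincomb g z (\<Psi> p (w + s *\<^sub>R z))) (at s within {0..1})"
    by (simp add: has_vector_derivative_def lincomb_simps)
qed

lemma integral_curve_\<Psi>0: "integral_curve z (\<lambda>s. \<Psi> p (s *\<^sub>R z))"
  using integral_curve_\<Psi>[of z p 0] by simp

text \<open>Along the segment in direction \<open>z\<close> both sides are integral curves with the
  same start, so uniqueness applies.\<close>

lemma \<Psi>_add: "\<Psi> p (w + z) = \<Psi> (\<Psi> p w) z"
proof -
  obtain C where C: "C \<ge> 0"
    "\<And>z' y1 y2 s. \<lbrakk>integral_curve z' y1; integral_curve z' y2; norm z' \<le> norm z; norm (y1 0) \<le> norm (\<Psi> p w);
       norm (y2 0) \<le> norm (\<Psi> p w); s \<in> {0..1}\<rbrakk> \<Longrightarrow> norm (y1 s - y2 s) \<le> C * norm (y1 0 - y2 0)"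
    by (rule integral_curve_lipschitz[of "norm z" "norm (\<Psi> p w)"]) auto
  have "norm (\<Psi> p (w + 1 *\<^sub>R z) - \<Psi> (\<Psi> p w) (1 *\<^sub>R z)) \<le> C * norm (\<Psi> p (w + 0 *\<^sub>R z) - \<Psi> (\<Psi> p w) (0 *\<^sub>R z))"
    by (rule C(2)[OF integral_curve_\<Psi> integral_curve_\<Psi>0]) auto
  then show ?thesis by simp
qed

text \<open>The increment bounds come from the mean value inequality along
  \<open>s *\<^sub>R z\<close>. The decisive one compares two starting points: the flow moves them
  by the same amount up to a factor \<open>norm z\<close>, which stands in for a derivative in
  \<open>p\<close>.\<close>

lemma \<Psi>_estimates:
  assumes "r \<ge> 0" "R \<ge> 0"
  obtains C where "C \<ge> 0"
    "\<And>p z. norm p \<le> R \<Longrightarrow> norm z \<le> r \<Longrightarrow> norm (\<Psi> p z) \<le> C"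
    "\<And>p q z. norm p \<le> R \<Longrightarrow> norm q \<le> R \<Longrightarrow> norm z \<le> r \<Longrightarrow>
        norm (\<Psi> p z - \<Psi> q z - (p - q)) \<le> C * norm z * norm (p - q)"
    "\<And>p z. norm p \<le> R \<Longrightarrow> norm z \<le> r \<Longrightarrow> norm (\<Psi> p z - p) \<le> C * norm z"
    "\<And>p z. norm p \<le> R \<Longrightarrow> norm z \<le> r \<Longrightarrow> norm (\<Psi> p z - p - lincomb g z p) \<le> C * (norm z)\<^sup>2"
proof -
  define R1 where "R1 = curve_bound r R"
  define K where "K = CARD('m) * M * (1 + R1)"
  have bnd: "norm (\<Psi> p (s *\<^sub>R z)) \<le> R1" if "norm p \<le> R" "norm z \<le> r" "s \<in> {0..1}" for p z s
    unfolding R1_def using integral_curve_bounded[OF integral_curve_\<Psi>0 that(2), of p R s] that by simp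
  have "R1 \<ge> 0" using bnd[of 0 0 0] assms by simp
  have "R \<le> R1"
  proof -
    obtain p :: 'a where "norm p = R" using vector_choose_size[OF assms(2)] by blast
    then show ?thesis using bnd[of p 0 0] assms by simp
  qed
  have K: "K \<ge> 0" using \<open>R1 \<ge> 0\<close> M by (simp add: K_def)
  obtain L where L: "L \<ge> 0"
    "\<And>z x y. norm x \<le> R1 \<Longrightarrow> norm y \<le> R1 \<Longrightarrow> norm (lincomb g z x - lincomb g z y) \<le> L * norm z * norm (x - y)"
    by (rule lincomb_lipschitz[of R1]) blast
  obtain C where C: "C \<ge> 0"
    "\<And>z y1 y2 s. \<lbrakk>integral_curve z y1; integral_curve z y2; norm z \<le> r; norm (y1 0) \<le> R; norm (y2 0) \<le> R; s \<in> {0..1}\<rbrakk>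
       \<Longrightarrow> norm (y1 s - y2 s) \<le> C * norm (y1 0 - y2 0)"
    by (rule integral_curve_lipschitz[of r R]) (use assms in auto)
  define B where "B = R1 + L * C + K + L * K"
  have B: "R1 \<le> B" "L * C \<le> B" "K \<le> B" "L * K \<le> B" "B \<ge> 0"
    using \<open>R1 \<ge> 0\<close> K L(1) C(1) by (auto simp: B_def intro!: add_nonneg_nonneg)
  have dcurve: "((\<lambda>s. \<Psi> p (s *\<^sub>R z)) has_vector_derivative lincomb g z (\<Psi> p (s *\<^sub>R z))) (at s within {0..1})"
    if "s \<in> {0..1}" for p z s
    using integral_curve_\<Psi>0[of z p] that by (simp add: integral_curve_def)
  have 3: "norm (\<Psi> p z - p) \<le> K * norm z" if "norm p \<le> R" "norm z \<le> r" for p z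
  proof -
    have "norm (\<Psi> p (1 *\<^sub>R z) - \<Psi> p (0 *\<^sub>R z)) \<le> K * norm z"
    proof (rule vector_mean_value_unit_interval[OF dcurve])
      show "norm (lincomb g z (\<Psi> p (s *\<^sub>R z))) \<le> K * norm z" if "s \<in> {0..1}" for s
        unfolding K_def by (rule lincomb_bounded) (rule bnd[OF \<open>norm p \<le> R\<close> \<open>norm z \<le> r\<close> that])
    qed
    then show ?thesis by simp
  qed
  show thesis
  proof (rule that[OF B(5)])
    fix p :: 'a and z :: "real^'m" assume pz: "norm p \<le> R" "norm z \<le> r"
    show "norm (\<Psi> p z) \<le> B" using bnd[OF pz, of 1] B(1) by simp
    have "K * norm z \<le> B * norm z" using B(3) by (rule mult_right_mono) simp
    then show "norm (\<Psi> p z - p) \<le> B * norm z" using 3[OF pz] by linarith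
    have "norm ((\<Psi> p (1 *\<^sub>R z) - 1 *\<^sub>R lincomb g z p) - (\<Psi> p (0 *\<^sub>R z) - 0 *\<^sub>R lincomb g z p)) \<le> L * norm z * (K * norm z)"
    proof (rule vector_mean_value_unit_interval[where F="\<lambda>s. \<Psi> p (s *\<^sub>R z) - s *\<^sub>R lincomb g z p"
          and F'="\<lambda>s. lincomb g z (\<Psi> p (s *\<^sub>R z)) - lincomb g z p"])
      fix s :: real assume s: "s \<in> {0..1}"
      have "((\<lambda>s. s *\<^sub>R lincomb g z p) has_vector_derivative lincomb g z p) (at s within {0..1})"
        by (auto simp: has_vector_derivative_def intro!: derivative_eq_intros)
      then show "((\<lambda>s. \<Psi> p (s *\<^sub>R z) - s *\<^sub>R lincomb g z p) has_vector_derivative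
          lincomb g z (\<Psi> p (s *\<^sub>R z)) - lincomb g z p) (at s within {0..1})"
        by (intro has_vector_derivative_diff dcurve[OF s])
      have sz: "norm (s *\<^sub>R z) \<le> norm z" using s mult_right_mono[of "\<bar>s\<bar>" 1 "norm z"] by simp
      have "norm (lincomb g z (\<Psi> p (s *\<^sub>R z)) - lincomb g z p) \<le> L * norm z * norm (\<Psi> p (s *\<^sub>R z) - p)"
        using bnd[OF pz s] pz(1) \<open>R \<le> R1\<close> by (intro L(2)) auto
      also have "\<dots> \<le> L * norm z * (K * norm (s *\<^sub>R z))"
        using L(1) 3[OF pz(1), of "s *\<^sub>R z"] sz pz(2) by (intro mult_left_mono) auto
      also have "\<dots> \<le> L * norm z * (K * norm z)"
        using L(1) K sz by (intro mult_left_mono) auto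
      finally show "norm (lincomb g z (\<Psi> p (s *\<^sub>R z)) - lincomb g z p) \<le> L * norm z * (K * norm z)" .
    qed
    then have "norm (\<Psi> p z - p - lincomb g z p) \<le> L * K * (norm z)\<^sup>2"
      by (simp add: algebra_simps power2_eq_square)
    also have "\<dots> \<le> B * (norm z)\<^sup>2" using B(4) by (rule mult_right_mono) simp
    finally show "norm (\<Psi> p z - p - lincomb g z p) \<le> B * (norm z)\<^sup>2" .
  next
    fix p q :: 'a and z :: "real^'m" assume *: "norm p \<le> R" "norm q \<le> R" "norm z \<le> r"
    have "norm ((\<Psi> p (1 *\<^sub>R z) - \<Psi> q (1 *\<^sub>R z)) - (\<Psi> p (0 *\<^sub>R z) - \<Psi> q (0 *\<^sub>R z))) \<le> L * norm z * (C * norm (p - q))"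
    proof (rule vector_mean_value_unit_interval[where F="\<lambda>s. \<Psi> p (s *\<^sub>R z) - \<Psi> q (s *\<^sub>R z)"
          and F'="\<lambda>s. lincomb g z (\<Psi> p (s *\<^sub>R z)) - lincomb g z (\<Psi> q (s *\<^sub>R z))"])
      fix s :: real assume s: "s \<in> {0..1}"
      show "((\<lambda>s. \<Psi> p (s *\<^sub>R z) - \<Psi> q (s *\<^sub>R z)) has_vector_derivative
          lincomb g z (\<Psi> p (s *\<^sub>R z)) - lincomb g z (\<Psi> q (s *\<^sub>R z))) (at s within {0..1})"
        by (intro has_vector_derivative_diff dcurve[OF s])
      have "norm (lincomb g z (\<Psi> p (s *\<^sub>R z)) - lincomb g z (\<Psi> q (s *\<^sub>R z)))
          \<le> L * norm z * norm (\<Psi> p (s *\<^sub>R z) - \<Psi> q (s *\<^sub>R z))"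
        using bnd[OF *(1,3) s] bnd[OF *(2,3) s] by (intro L(2))
      also have "\<dots> \<le> L * norm z * (C * norm (p - q))"
        using L(1) C(2)[OF integral_curve_\<Psi>0 integral_curve_\<Psi>0 *(3) _ _ s, of p q] *
        by (intro mult_left_mono) auto
      finally show "norm (lincomb g z (\<Psi> p (s *\<^sub>R z)) - lincomb g z (\<Psi> q (s *\<^sub>R z))) \<le> L * norm z * (C * norm (p - q))" .
    qed
    then have "norm (\<Psi> p z - \<Psi> q z - (p - q)) \<le> L * C * (norm z * norm (p - q))"
      by (simp add: algebra_simps)
    also have "\<dots> \<le> B * (norm z * norm (p - q))" using B(2) by (rule mult_right_mono) simp
    finally show "norm (\<Psi> p z - \<Psi> q z - (p - q)) \<le> B * norm z * norm (p - q)" by (simp add: mult.assoc)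
  qed
qed

end

section \<open>Solutions of control systems\<close>

lemma has_vector_derivative_quotient:
  fixes F :: "real \<Rightarrow> 'a::real_normed_vector"
  assumes "(F has_vector_derivative D) (at r within S)"
  shows "((\<lambda>y. (F y - F r) /\<^sub>R (y - r)) \<longlongrightarrow> D) (at r within S)"
proof -
  have "((\<lambda>y. norm (F y - F r - (y - r) *\<^sub>R D) / norm (y - r)) \<longlongrightarrow> 0) (at r within S)"
    using assms unfolding has_vector_derivative_def has_derivative_iff_norm by blast
  moreover have "\<forall>\<^sub>F y in at r within S. norm ((F y - F r) /\<^sub>R (y - r) - D) \<le> norm (F y - F r - (y - r) *\<^sub>R D) / norm (y - r)"
    unfolding eventually_at_filter
  proof (rule always_eventually, intro allI impI)
    fix y assume "y \<noteq> r"
    then have "(F y - F r) /\<^sub>R (y - r) - D = (F y - F r - (y - r) *\<^sub>R D) /\<^sub>R (y - r)"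
      by (simp add: scaleR_diff_right)
    then show "norm ((F y - F r) /\<^sub>R (y - r) - D) \<le> norm (F y - F r - (y - r) *\<^sub>R D) / norm (y - r)"
      by (simp add: divide_inverse mult.commute)
  qed
  ultimately have "((\<lambda>y. (F y - F r) /\<^sub>R (y - r) - D) \<longlongrightarrow> 0) (at r within S)"
    by (rule Lim_null_comparison[rotated])
  then show ?thesis by (simp add: LIM_zero_iff)
qed

lemma AE_lebesgue_on_interval:
  "(AE t in lebesgue_on {a..b::real}. P t) \<longleftrightarrow> (\<exists>N. negligible N \<and> (\<forall>t\<in>{a..b} - N. P t))"
proof -
  have "(AE t in lebesgue_on {a..b}. P t) \<longleftrightarrow> (AE t in lebesgue. t \<in> {a..b} \<longrightarrow> P t)"
    by (rule AE_restrict_space_iff) simp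
  also have "\<dots> \<longleftrightarrow> (\<exists>N\<in>null_sets lebesgue. {t. \<not> (t \<in> {a..b} \<longrightarrow> P t)} \<subseteq> N)"
    by (simp add: eventually_ae_filter)
  also have "\<dots> \<longleftrightarrow> (\<exists>N. negligible N \<and> (\<forall>t\<in>{a..b} - N. P t))"
    unfolding negligible_iff_null_sets Bex_def
    by (intro arg_cong[where f=Ex] ext conj_cong refl) auto
  finally show ?thesis .
qed

lemma dominated_convergence_ae:
  fixes F :: "nat \<Rightarrow> real \<Rightarrow> 'a::euclidean_space"
  assumes F: "\<And>k. F k integrable_on {s..t}" and N: "negligible N"
    and bnd: "\<And>k r. r \<in> {s..t} - N \<Longrightarrow> norm (F k r) \<le> B"
    and lim: "\<And>r. r \<in> {s..t} - N \<Longrightarrow> (\<lambda>k. F k r) \<longlonglongrightarrow> G r"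
  shows "G integrable_on {s..t}" "(\<lambda>k. integral {s..t} (F k)) \<longlonglongrightarrow> integral {s..t} G"
proof -
  let ?F = "\<lambda>k r. if r \<in> N then 0 else F k r" and ?G = "\<lambda>r. if r \<in> N then 0 else G r"
  have F': "?F k integrable_on {s..t}" for k
    by (rule integrable_spike[OF F[of k] N]) auto
  have B: "(\<lambda>_. \<bar>B\<bar>) integrable_on {s..t}" by (rule integrable_const_ivl)
  have le: "norm (?F k r) \<le> \<bar>B\<bar>" if "r \<in> {s..t}" for k r
    using bnd[of r k] that by auto
  have lim': "(\<lambda>k. ?F k r) \<longlonglongrightarrow> ?G r" if "r \<in> {s..t}" for r
    using lim[of r] that by auto
  note dc = dominated_convergence[OF F' B le lim']
  show "G integrable_on {s..t}"
    by (rule integrable_spike[OF dc(1) N]) auto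
  have "integral {s..t} (?F k) = integral {s..t} (F k)" for k
    by (rule integral_spike[OF N]) auto
  moreover have "integral {s..t} ?G = integral {s..t} G"
    by (rule integral_spike[OF N]) auto
  ultimately show "(\<lambda>k. integral {s..t} (F k)) \<longlonglongrightarrow> integral {s..t} G"
    using dc(2) by simp
qed

context C1_fields
begin

lemma lincomb_absolutely_integrable:
  assumes c: "c absolutely_integrable_on {a..b::real}" and y: "continuous_on {a..b} y"
  shows "(\<lambda>t. lincomb g (c t) (y t)) absolutely_integrable_on {a..b}"
  unfolding lincomb_def
proof (rule absolutely_integrable_sum)
  fix \<alpha> :: 'm
  have cg: "continuous_on {a..b} (\<lambda>t. g \<alpha> (y t))"
    by (rule continuous_on_compose2[OF continuous_field[of UNIV] y]) auto
  show "(\<lambda>t. c t $ \<alpha> *\<^sub>R g \<alpha> (y t)) absolutely_integrable_on {a..b}"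
  proof (rule absolutely_integrable_bounded_measurable_product[where h="\<lambda>p q. q *\<^sub>R p"
        and f="\<lambda>t. g \<alpha> (y t)" and g="\<lambda>t. c t $ \<alpha>"])
    show "bilinear (\<lambda>p q. q *\<^sub>R (p::'a))"
      unfolding bilinear_def by (auto intro!: linearI simp: algebra_simps)
    show "(\<lambda>t. g \<alpha> (y t)) \<in> borel_measurable (lebesgue_on {a..b})"
      using cg by (intro continuous_imp_measurable_on_sets_lebesgue) auto
    show "bounded ((\<lambda>t. g \<alpha> (y t)) ` {a..b})"
      using cg by (intro compact_imp_bounded compact_continuous_image) auto
    have "(\<lambda>t. c t \<bullet> axis \<alpha> 1) absolutely_integrable_on {a..b}"
      using c by (rule absolutely_integrable_component)
    then show "(\<lambda>t. c t $ \<alpha>) absolutely_integrable_on {a..b}" by (simp add: inner_axis)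
  qed simp
qed simp

end

text \<open>\<open>V\<close> and \<open>v\<close> are fixed here, since the approximating problems
  differ from the limit problem in the input \<open>u\<close> alone. The inequality
  \<open>a < b\<close> makes derivatives within the interval unique, endpoints included.\<close>

locale affine_control_system = C1_fields g g' M
  for g :: "'m::finite \<Rightarrow> real^'n \<Rightarrow> real^'n" and g' M +
  fixes a b :: real and f :: "real \<Rightarrow> real^'n \<Rightarrow> real^'m \<Rightarrow> real^'l \<Rightarrow> real^'n"
    and V :: "(real^'l) set" and v :: "real \<Rightarrow> real^'l" and x\<^sub>0 :: "real^'n"
  assumes ab: "a < b" and v_in_V: "AE t in lebesgue_on {a..b}. v t \<in> V"
    and f_continuous: "\<And>t. t \<in> {a..b} \<Longrightarrow> continuous_on (UNIV \<times> UNIV \<times> V) (\<lambda>(y, w, z). f t y w z)"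
    and f_locally_lipschitz:
      "\<And>p. \<exists>r>0. \<exists>L. \<forall>t\<in>{a..b}. \<forall>z\<in>V. L-lipschitz_on (ball p r) (\<lambda>(y, w). f t y w z)"
    and f_growth: "\<And>t z y w. t \<in> {a..b} \<Longrightarrow> z \<in> V \<Longrightarrow> norm (f t y w z) \<le> M * (1 + norm (y, w))"
begin

abbreviation solution :: "(real \<Rightarrow> real^'m) \<Rightarrow> (real \<Rightarrow> real^'n) \<Rightarrow> bool" where
  "solution u x \<equiv> caratheodory_solution a b f g x\<^sub>0 u v x"

abbreviation rate :: "(real \<Rightarrow> 'c::real_normed_vector) \<Rightarrow> real \<Rightarrow> 'c" where
  "rate w t \<equiv> vector_derivative w (at t within {a..b})"

definition drift :: "(real \<Rightarrow> real^'m) \<Rightarrow> (real \<Rightarrow> real^'n) \<Rightarrow> real \<Rightarrow> real^'n" where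
  "drift u x t = f t (x t) (u t) (v t)"

lemma drift_bounded_at:
  assumes "t \<in> {a..b}" "v t \<in> V" "norm (x t) \<le> B" "norm (u t) \<le> R"
  shows "norm (drift u x t) \<le> M * (1 + B + R)"
proof -
  have "norm (drift u x t) \<le> M * (1 + norm (x t, u t))"
    unfolding drift_def using f_growth assms(1,2) by blast
  also have "\<dots> \<le> M * (1 + B + R)"
  proof (intro mult_left_mono)
    have "norm (x t, u t) \<le> norm (x t) + norm (u t)" by (rule norm_Pair_le)
    then show "1 + norm (x t, u t) \<le> 1 + B + R" using assms by linarith
  qed (use M in simp)
  finally show ?thesis .
qed

lemma v_in_V_ae: obtains N where "negligible N" "\<And>t. t \<in> {a..b} - N \<Longrightarrow> v t \<in> V"
  using v_in_V unfolding AE_lebesgue_on_interval by blast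

text \<open>Uniqueness of derivatives within a nondegenerate interval forces the existential
  \<open>u'\<close> to be \<open>rate u t\<close>.\<close>

lemma solution_iff:
  "solution u x \<longleftrightarrow> abs_continuous_on {a..b} x \<and> x a = x\<^sub>0 \<and>
    (\<exists>N. negligible N \<and> (\<forall>t\<in>{a..b} - N. (u has_vector_derivative rate u t) (at t within {a..b}) \<and>
        (x has_vector_derivative drift u x t + lincomb g (rate u t) (x t)) (at t within {a..b})))"
proof -
  have "(\<exists>u'. (u has_vector_derivative u') (at t within {a..b}) \<and>
        (x has_vector_derivative f t (x t) (u t) (v t) + (\<Sum>\<alpha>\<in>UNIV. u' $ \<alpha> *\<^sub>R g \<alpha> (x t))) (at t within {a..b}))
     \<longleftrightarrow> (u has_vector_derivative rate u t) (at t within {a..b}) \<and>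
        (x has_vector_derivative drift u x t + lincomb g (rate u t) (x t)) (at t within {a..b})"
    if "t \<in> {a..b}" for t
    using vector_derivative_within_closed_interval[OF ab that]
    unfolding drift_def lincomb_def by blast
  then have "(AE t in lebesgue_on {a..b}. \<exists>u'. (u has_vector_derivative u') (at t within {a..b}) \<and>
        (x has_vector_derivative f t (x t) (u t) (v t) + (\<Sum>\<alpha>\<in>UNIV. u' $ \<alpha> *\<^sub>R g \<alpha> (x t))) (at t within {a..b}))
     \<longleftrightarrow> (\<exists>N. negligible N \<and> (\<forall>t\<in>{a..b} - N. (u has_vector_derivative rate u t) (at t within {a..b}) \<and>
        (x has_vector_derivative drift u x t + lincomb g (rate u t) (x t)) (at t within {a..b})))"
    unfolding AE_lebesgue_on_interval by (intro arg_cong[where f=Ex] ext conj_cong refl ball_cong) auto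
  then show ?thesis unfolding caratheodory_solution_def by simp
qed

end

text \<open>A single null set collects all exceptional times, so that off \<open>N\<close> every
  pointwise fact is available together.\<close>

locale regular_solution = affine_control_system g g' M a b f V v x\<^sub>0
  for g :: "'m::finite \<Rightarrow> real^'n \<Rightarrow> real^'n" and g' M a b
    and f :: "real \<Rightarrow> real^'n \<Rightarrow> real^'m \<Rightarrow> real^'l \<Rightarrow> real^'n" and V v x\<^sub>0 +
  fixes u :: "real \<Rightarrow> real^'m" and x :: "real \<Rightarrow> real^'n" and N :: "real set"
  assumes u: "abs_continuous_on {a..b} u" and x: "abs_continuous_on {a..b} x" and x_init: "x a = x\<^sub>0"
    and N: "negligible N"
    and N_V: "\<And>t. t \<in> {a..b} - N \<Longrightarrow> v t \<in> V"
    and N_u: "\<And>t. t \<in> {a..b} - N \<Longrightarrow> (u has_vector_derivative rate u t) (at t within {a..b})"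
    and N_x: "\<And>t. t \<in> {a..b} - N \<Longrightarrow>
      (x has_vector_derivative drift u x t + lincomb g (rate u t) (x t)) (at t within {a..b})"

context affine_control_system
begin

lemma regular_solution_exists:
  assumes "solution u x" "abs_continuous_on {a..b} u"
  shows "\<exists>N. regular_solution g g' M a b f V v x\<^sub>0 u x N"
proof -
  obtain N1 where N1: "negligible N1" "\<And>t. t \<in> {a..b} - N1 \<Longrightarrow> v t \<in> V"
    by (rule v_in_V_ae) blast
  obtain N2 where N2: "negligible N2"
    "\<And>t. t \<in> {a..b} - N2 \<Longrightarrow> (u has_vector_derivative rate u t) (at t within {a..b}) \<and>
        (x has_vector_derivative drift u x t + lincomb g (rate u t) (x t)) (at t within {a..b})"
    using assms(1) unfolding solution_iff by blast
  have "regular_solution g g' M a b f V v x\<^sub>0 u x (N1 \<union> N2)"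
    using assms N1 N2 unfolding solution_iff by unfold_locales auto
  then show ?thesis by blast
qed

end

context regular_solution
begin

sublocale u: abs_continuous_derivative a b u "rate u" N
  by unfold_locales (use u N N_u in auto)

sublocale x: abs_continuous_derivative a b x "\<lambda>t. drift u x t + lincomb g (rate u t) (x t)" N
  by unfold_locales (use x N N_x in auto)

lemma continuous_u: "continuous_on {a..b} u" and continuous_x: "continuous_on {a..b} x"
  using u x by (auto intro: abs_continuous_on_imp_continuous)

lemma control_integrable: "(\<lambda>t. lincomb g (rate u t) (x t)) absolutely_integrable_on {a..b}"
  by (rule lincomb_absolutely_integrable[OF u.absolutely_integrable continuous_x])

text \<open>The drift is the derivative of \<open>x\<close> minus the control term, both absolutely
  integrable.\<close>

lemma drift_integrable: "drift u x absolutely_integrable_on {a..b}"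
  using set_integral_diff(1)[OF x.absolutely_integrable control_integrable] by simp

lemma drift_bounded:
  assumes "t \<in> {a..b} - N" "norm (x t) \<le> B" "norm (u t) \<le> R"
  shows "norm (drift u x t) \<le> M * (1 + B + R)"
  using assms by (intro drift_bounded_at N_V) auto

end

lemma integral_norm_bound_ae:
  fixes F :: "real \<Rightarrow> 'a::euclidean_space"
  assumes "F integrable_on S" "G integrable_on S" "negligible N"
    and le: "\<And>r. r \<in> S - N \<Longrightarrow> norm (F r) \<le> G r"
  shows "norm (integral S F) \<le> integral S G"
proof -
  let ?F = "\<lambda>r. if r \<in> N then 0 else F r" and ?G = "\<lambda>r. if r \<in> N then 0 else G r"
  have "norm (integral S ?F) \<le> integral S ?G"
  proof (rule integral_norm_bound_integral)
    show "?F integrable_on S" by (rule integrable_spike[OF assms(1,3)]) auto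
    show "?G integrable_on S" by (rule integrable_spike[OF assms(2,3)]) auto
  qed (use le in auto)
  moreover have "integral S ?F = integral S F" by (rule integral_spike[OF assms(3)]) auto
  moreover have "integral S ?G = integral S G" by (rule integral_spike[OF assms(3)]) auto
  ultimately show ?thesis by simp
qed

text \<open>At the infimum \<open>T\<close> of the times of disagreement the solutions agree by
  continuity. Just after \<open>T\<close> the local Lipschitz bound for \<open>f\<close> is
  available and \<open>\<kappa>\<close> integrates to at most 1/2, so the maximum of
  \<open>norm (e s)\<close> there is at most half of itself. Working at a maximum replaces an
  exponential estimate with an integrable coefficient.\<close>

lemma (in affine_control_system) solution_unique:
  assumes u: "abs_continuous_on {a..b} u" and sols: "solution u y1" "solution u y2" and t: "t \<in> {a..b}"
  shows "y1 t = y2 t"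
proof (rule ccontr)
  assume ne: "y1 t \<noteq> y2 t"
  obtain N1 where "regular_solution g g' M a b f V v x\<^sub>0 u y1 N1"
    using regular_solution_exists[OF sols(1) u] by blast
  then interpret s1: regular_solution g g' M a b f V v x\<^sub>0 u y1 N1 .
  obtain N2 where "regular_solution g g' M a b f V v x\<^sub>0 u y2 N2"
    using regular_solution_exists[OF sols(2) u] by blast
  then interpret s2: regular_solution g g' M a b f V v x\<^sub>0 u y2 N2 .
  define e where "e t = y1 t - y2 t" for t
  have ce: "continuous_on {a..b} e"
    unfolding e_def by (intro continuous_on_diff s1.continuous_x s2.continuous_x)
  define Z where "Z = {t \<in> {a..b}. e t \<noteq> 0}"
  have Z: "t \<in> Z" "bdd_below Z" using t ne by (auto simp: Z_def e_def intro: bdd_belowI[of _ a])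
  define T where "T = Inf Z"
  have "T \<le> t" unfolding T_def using Z by (intro cInf_lower)
  have "a \<le> T" unfolding T_def using Z by (intro cInf_greatest) (auto simp: Z_def)
  have T: "T \<in> {a..b}" using \<open>T \<le> t\<close> \<open>a \<le> T\<close> t by simp
  have before: "e s = 0" if "s \<in> {a..b}" "s < T" for s
    using cInf_lower[OF _ Z(2), of s] that by (auto simp: Z_def T_def)
  have eT: "e T = 0"
  proof (rule ccontr)
    assume n: "e T \<noteq> 0"
    have "e a = 0" using s1.x_init s2.x_init by (simp add: e_def)
    then have "a < T" using n \<open>a \<le> T\<close> by (cases "a = T") auto
    obtain d where d: "d > 0" "\<And>s. s \<in> {a..b} \<Longrightarrow> dist s T < d \<Longrightarrow> dist (e s) (e T) < norm (e T)"
      using ce T n unfolding continuous_on_iff by (meson zero_less_norm_iff)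
    define s where "s = max a (T - d / 2)"
    have "s \<in> {a..b}" "s < T" "dist s T < d"
      using T d(1) \<open>a < T\<close> by (auto simp: s_def dist_real_def max_def)
    then show False using before[of s] d(2)[of s] by simp
  qed
  then have "T < b" using \<open>T \<le> t\<close> ne t by (cases "T = t") (auto simp: e_def)
  obtain r L where r: "r > 0" and L: "\<And>t z. t \<in> {a..b} \<Longrightarrow> z \<in> V \<Longrightarrow> L-lipschitz_on (ball (y1 T, u T) r) (\<lambda>(y, w). f t y w z)"
    using f_locally_lipschitz[of "(y1 T, u T)"] by blast
  obtain R where R: "\<And>t. t \<in> {a..b} \<Longrightarrow> norm (y1 t) \<le> R" "\<And>t. t \<in> {a..b} \<Longrightarrow> norm (y2 t) \<le> R"
  proof -
    have "compact (y1 ` {a..b} \<union> y2 ` {a..b})"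
      by (intro compact_Un compact_continuous_image s1.continuous_x s2.continuous_x) auto
    then obtain R where "\<forall>y\<in>y1 ` {a..b} \<union> y2 ` {a..b}. norm y \<le> R"
      using compact_imp_bounded bounded_iff by blast
    then show thesis using that by blast
  qed
  obtain K where K: "K \<ge> 0"
    "\<And>z x y. norm x \<le> R \<Longrightarrow> norm y \<le> R \<Longrightarrow> norm (lincomb g z x - lincomb g z y) \<le> K * norm z * norm (x - y)"
    by (rule lincomb_lipschitz[of R]) blast
  \<comment> \<open>An integrable Lipschitz coefficient for the whole right-hand side near
    \<open>T\<close>; the rate of \<open>u\<close> may be unbounded.\<close>
  define \<kappa> where "\<kappa> s = \<bar>L\<bar> + K * norm (rate u s)" for s
  have \<kappa>: "\<kappa> integrable_on {a..b}"
    unfolding \<kappa>_def using s1.u.absolutely_integrable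
    by (intro integrable_add integrable_const_ivl integrable_on_mult_right) (simp add: absolutely_integrable_on_def)
  have \<kappa>_sub: "\<kappa> integrable_on {T..s}" if "s \<le> b" for s
    by (rule integrable_on_subinterval[OF \<kappa>]) (use \<open>a \<le> T\<close> that in auto)
  have \<kappa>_nn: "0 \<le> \<kappa> s" for s using K(1) by (simp add: \<kappa>_def)
  have "continuous_on {T..b} (\<lambda>s. integral {T..s} \<kappa>)"
    by (rule indefinite_integral_continuous_1[OF \<kappa>_sub]) simp
  then obtain d1 where d1: "d1 > 0" "\<And>s. s \<in> {T..b} \<Longrightarrow> dist s T < d1 \<Longrightarrow> dist (integral {T..s} \<kappa>) (integral {T..T} \<kappa>) < 1/2"
    unfolding continuous_on_iff using \<open>T < b\<close> by (metis atLeastAtMost_iff half_gt_zero_iff less_eq_real_def order_refl zero_less_one)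
  have near: "\<exists>d>0. \<forall>s\<in>{a..b}. dist s T < d \<longrightarrow> (y s, u s) \<in> ball (y T, u T) r"
    if "continuous_on {a..b} y" for y :: "real \<Rightarrow> real^'n"
  proof -
    have "continuous_on {a..b} (\<lambda>s. (y s, u s))" by (intro continuous_on_Pair that s1.continuous_u)
    then show ?thesis using r T unfolding continuous_on_iff mem_ball by (metis dist_commute)
  qed
  obtain d2 where d2: "d2 > 0" "\<And>s. s \<in> {a..b} \<Longrightarrow> dist s T < d2 \<Longrightarrow> (y1 s, u s) \<in> ball (y1 T, u T) r"
    using near[OF s1.continuous_x] by blast
  obtain d3 where d3: "d3 > 0" "\<And>s. s \<in> {a..b} \<Longrightarrow> dist s T < d3 \<Longrightarrow> (y2 s, u s) \<in> ball (y1 T, u T) r"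
    using near[OF s2.continuous_x] eT by (auto simp: e_def)
  \<comment> \<open>Close enough to \<open>T\<close> for both solutions to stay in the Lipschitz
    ball and for \<open>\<kappa>\<close> to integrate to at most 1/2.\<close>
  define s1 where "s1 = min b (T + min d1 (min d2 d3) / 2)"
  have s1: "T < s1" "s1 \<le> b" "s1 - T < d1" "s1 - T < d2" "s1 - T < d3"
    using d1(1) d2(1) d3(1) \<open>T < b\<close> by (auto simp: s1_def min_def)
  have "continuous_on {T..s1} (\<lambda>s. norm (e s))"
    by (intro continuous_on_norm continuous_on_subset[OF ce]) (use s1 \<open>a \<le> T\<close> in auto)
  then obtain s where s: "s \<in> {T..s1}" "\<And>s'. s' \<in> {T..s1} \<Longrightarrow> norm (e s') \<le> norm (e s)"
    using continuous_attains_sup[of "{T..s1}" "\<lambda>s. norm (e s)"] s1(1) by auto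
  have sb: "s \<le> b" using s s1 by auto
  let ?e' = "\<lambda>r. (drift u y1 r + lincomb g (rate u r) (y1 r)) - (drift u y2 r + lincomb g (rate u r) (y2 r))"
  have int: "(?e' has_integral (y1 s - y1 T) - (y2 s - y2 T)) {T..s}"
    using s sb \<open>a \<le> T\<close> by (intro has_integral_diff s1.x.has_integral_subinterval s2.x.has_integral_subinterval) auto
  have "norm (integral {T..s} ?e') \<le> integral {T..s} (\<lambda>r. \<kappa> r * norm (e s))"
  proof (rule integral_norm_bound_ae[of _ _ _ "N1 \<union> N2"])
    show "?e' integrable_on {T..s}" using int by (auto simp: integrable_on_def)
    show "(\<lambda>r. \<kappa> r * norm (e s)) integrable_on {T..s}"
      by (intro integrable_on_mult_left \<kappa>_sub sb)
    show "negligible (N1 \<union> N2)" using s1.N s2.N by simp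
    fix q assume q: "q \<in> {T..s} - (N1 \<union> N2)"
    then have q': "q \<in> {a..b} - N1" "q \<in> {a..b}" "q \<in> {T..s1}" "dist q T < d2" "dist q T < d3"
      using s s1 \<open>a \<le> T\<close> by (auto simp: dist_real_def)
    have "dist (f q (y1 q) (u q) (v q)) (f q (y2 q) (u q) (v q)) \<le> L * dist (y1 q, u q) (y2 q, u q)"
      using lipschitz_onD[OF L[OF q'(2) s1.N_V[OF q'(1)]] d2(2)[OF q'(2,4)] d3(2)[OF q'(2,5)]] by simp
    also have "dist (y1 q, u q) (y2 q, u q) = norm (e q)" by (simp add: dist_Pair_Pair dist_norm e_def)
    also have "L * norm (e q) \<le> \<bar>L\<bar> * norm (e q)" by (intro mult_right_mono) auto
    finally have 1: "norm (drift u y1 q - drift u y2 q) \<le> \<bar>L\<bar> * norm (e q)" by (simp add: drift_def dist_norm)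
    have 2: "norm (lincomb g (rate u q) (y1 q) - lincomb g (rate u q) (y2 q)) \<le> K * norm (rate u q) * norm (e q)"
      unfolding e_def using R q'(2) by (intro K(2)) auto
    have "?e' q = (drift u y1 q - drift u y2 q) + (lincomb g (rate u q) (y1 q) - lincomb g (rate u q) (y2 q))" by simp
    then have "norm (?e' q) \<le> \<bar>L\<bar> * norm (e q) + K * norm (rate u q) * norm (e q)"
      using norm_triangle_mono[OF 1 2] by (simp only:)
    also have "\<dots> = \<kappa> q * norm (e q)" by (simp add: \<kappa>_def algebra_simps)
    also have "\<dots> \<le> \<kappa> q * norm (e s)" by (intro mult_left_mono s(2) q'(3) \<kappa>_nn)
    finally show "norm (?e' q) \<le> \<kappa> q * norm (e s)" .
  qed
  moreover have "integral {T..s} ?e' = e s" using integral_unique[OF int] eT by (simp add: e_def)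
  moreover have "integral {T..s} (\<lambda>r. \<kappa> r * norm (e s)) = integral {T..s} \<kappa> * norm (e s)" by simp
  ultimately have "norm (e s) \<le> integral {T..s} \<kappa> * norm (e s)" by (simp only:)
  also have "\<dots> \<le> 1/2 * norm (e s)"
  proof (rule mult_right_mono)
    show "integral {T..s} \<kappa> \<le> 1/2"
      using d1(2)[of s] s s1 sb by (auto simp: dist_real_def)
  qed simp
  finally have "norm (e s) \<le> 0" by linarith
  then have zero: "e q = 0" if "q \<in> {T..s1}" for q using s(2)[OF that] norm_le_zero_iff order_trans by blast
  \<comment> \<open>The infimum has members of \<open>Z\<close> arbitrarily close above it, contrary
    to agreement up to \<open>s1\<close>.\<close>
  obtain z where "z \<in> Z" "z < s1" using cInf_lessD[of Z s1] Z s1(1) unfolding T_def by blast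
  moreover have "T \<le> z" unfolding T_def using \<open>z \<in> Z\<close> Z(2) by (intro cInf_lower)
  ultimately show False using zero[of z] by (auto simp: Z_def)
qed

text \<open>The drift contains no derivative of the input, so almost everywhere convergence of
  states and inputs passes through \<open>f\<close> by continuity, and
  \<open>M * (1 + B + R)\<close> dominates. The exceptional sets of all indices form one countable
  union.\<close>

lemma (in affine_control_system) drift_convergence:
  assumes u: "\<And>k. abs_continuous_on {a..b} (uk k)" and sol: "\<And>k. solution (uk k) (xk k)"
    and B: "\<And>k t. t \<in> {a..b} \<Longrightarrow> norm (xk k t) \<le> B" and R: "\<And>k t. t \<in> {a..b} \<Longrightarrow> norm (uk k t) \<le> R"
    and N: "negligible N"
    and lim: "\<And>t. t \<in> {a..b} - N \<Longrightarrow> (\<lambda>k. xk k t) \<longlonglongrightarrow> x t" "\<And>t. t \<in> {a..b} - N \<Longrightarrow> (\<lambda>k. uk k t) \<longlonglongrightarrow> u t"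
    and st: "a \<le> s" "t \<le> b"
  shows "drift u x integrable_on {s..t}" "(\<lambda>k. integral {s..t} (drift (uk k) (xk k))) \<longlonglongrightarrow> integral {s..t} (drift u x)"
proof -
  have "\<exists>N. regular_solution g g' M a b f V v x\<^sub>0 (uk k) (xk k) N" for k
    by (rule regular_solution_exists[OF sol u])
  then obtain Nk where Nk: "\<And>k. regular_solution g g' M a b f V v x\<^sub>0 (uk k) (xk k) (Nk k)" by metis
  interpret s: regular_solution g g' M a b f V v x\<^sub>0 "uk k" "xk k" "Nk k" for k by (rule Nk)
  define N' where "N' = N \<union> (\<Union>k. Nk k)"
  have sub: "{s..t} \<subseteq> {a..b}" using st by auto
  have N': "negligible N'"
    unfolding N'_def using N s.N by (intro negligible_Un negligible_countable_Union) auto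
  have int: "drift (uk k) (xk k) integrable_on {s..t}" for k
    using s.drift_integrable[of k] sub by (auto simp: absolutely_integrable_on_def intro: integrable_on_subinterval)
  have bnd: "norm (drift (uk k) (xk k) r) \<le> M * (1 + B + R)" if "r \<in> {s..t} - N'" for k r
  proof (rule s.drift_bounded)
    show "r \<in> {a..b} - Nk k" using that sub by (auto simp: N'_def)
  qed (use B R that sub in auto)
  have conv: "(\<lambda>k. drift (uk k) (xk k) r) \<longlonglongrightarrow> drift u x r" if r: "r \<in> {s..t} - N'" for r
  proof -
    \<comment> \<open>Membership of \<open>v r\<close> in \<open>V\<close> concerns \<open>v\<close>
      alone, so the null set of any one index provides it.\<close>
    have rab: "r \<in> {a..b} - N" "r \<in> {a..b} - Nk 0" using r sub by (auto simp: N'_def)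
    have vV: "v r \<in> V" by (rule s.N_V[OF rab(2)])
    have "continuous_on (UNIV \<times> UNIV \<times> V) (\<lambda>(y, w, z). f r y w z)" using f_continuous rab by blast
    moreover have "(\<lambda>k. (xk k r, uk k r, v r)) \<longlonglongrightarrow> (x r, u r, v r)"
      by (intro tendsto_Pair lim rab tendsto_const)
    ultimately have "(\<lambda>k. (\<lambda>(y, w, z). f r y w z) (xk k r, uk k r, v r)) \<longlonglongrightarrow> (\<lambda>(y, w, z). f r y w z) (x r, u r, v r)"
      by (rule continuous_on_tendsto_compose) (use vV in auto)
    then show ?thesis by (simp add: drift_def)
  qed
  show "drift u x integrable_on {s..t}" "(\<lambda>k. integral {s..t} (drift (uk k) (xk k))) \<longlonglongrightarrow> integral {s..t} (drift u x)"
    using dominated_convergence_ae[OF int N' bnd conv] by auto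
qed

section \<open>Limit solutions for commuting fields\<close>

lemma (in product_flow) \<Psi>_along_control:
  assumes "(u has_vector_derivative u') (at r within S)"
  shows "((\<lambda>y. \<Psi> p (u y - u r)) has_vector_derivative lincomb g u' p) (at r within S)"
proof -
  have "((\<lambda>y. u y - u r) has_derivative (\<lambda>h. h *\<^sub>R u' - 0)) (at r within S)"
    using assms unfolding has_vector_derivative_def by (intro has_derivative_diff has_derivative_const)
  from has_derivative_compose[OF this \<Psi>_deriv[of p "u r - u r"]]
  show ?thesis by (simp add: has_vector_derivative_def lincomb_simps)
qed

text \<open>Joint continuity, from the Lipschitz estimate in the start and differentiability in
  \<open>z\<close>.\<close>

lemma (in product_flow) \<Psi>_tendsto:
  assumes p: "pk \<longlonglongrightarrow> p" and z: "zk \<longlonglongrightarrow> z"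
  shows "(\<lambda>k. \<Psi> (pk k) (zk k)) \<longlonglongrightarrow> \<Psi> p z"
proof -
  obtain r where r: "\<And>k. norm (zk k) \<le> r"
    using convergent_imp_Bseq[of zk] z by (auto simp: convergent_def Bseq_def)
  obtain R where R: "\<And>k. norm (pk k) \<le> R"
    using convergent_imp_Bseq[of pk] p by (auto simp: convergent_def Bseq_def)
  have nn: "0 \<le> r" "0 \<le> R" using r[of 0] R[of 0] norm_ge_zero order_trans by blast+
  have "norm p \<le> R" by (rule Lim_bounded[OF tendsto_norm[OF p]]) (use R in auto)
  obtain C where C: "C \<ge> 0" "\<And>p q z. norm p \<le> R \<Longrightarrow> norm q \<le> R \<Longrightarrow> norm z \<le> r \<Longrightarrow>
        norm (\<Psi> p z - \<Psi> q z - (p - q)) \<le> C * norm z * norm (p - q)"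
    by (rule \<Psi>_estimates[OF nn]) blast
  have le: "norm (\<Psi> (pk k) (zk k) - \<Psi> p (zk k)) \<le> (C * r + 1) * norm (pk k - p)" for k
  proof -
    have "norm (\<Psi> (pk k) (zk k) - \<Psi> p (zk k)) \<le> norm (\<Psi> (pk k) (zk k) - \<Psi> p (zk k) - (pk k - p)) + norm (pk k - p)"
      by (metis add.commute norm_triangle_sub)
    also have "\<dots> \<le> C * norm (zk k) * norm (pk k - p) + norm (pk k - p)"
      using C(2)[OF R \<open>norm p \<le> R\<close> r] by simp
    also have "\<dots> \<le> C * r * norm (pk k - p) + norm (pk k - p)"
      using C(1) r by (intro add_right_mono mult_right_mono mult_left_mono) auto
    finally show ?thesis by (simp add: algebra_simps)
  qed
  have "(\<lambda>k. (C * r + 1) * norm (pk k - p)) \<longlonglongrightarrow> (C * r + 1) * norm (p - p)"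
    by (intro tendsto_intros p)
  then have t0: "(\<lambda>k. (C * r + 1) * norm (pk k - p)) \<longlonglongrightarrow> 0" by simp
  have 1: "(\<lambda>k. \<Psi> (pk k) (zk k) - \<Psi> p (zk k)) \<longlonglongrightarrow> 0"
    by (rule Lim_null_comparison[OF _ t0]) (intro always_eventually allI le)
  have "isCont (\<Psi> p) z" by (rule has_derivative_continuous[OF \<Psi>_deriv])
  then have "(\<lambda>k. \<Psi> p (zk k)) \<longlonglongrightarrow> \<Psi> p z" using z by (rule isCont_tendsto_compose)
  from tendsto_add[OF 1 this] show ?thesis by simp
qed

locale commuting_system = affine_control_system g g' M a b f V v x\<^sub>0 + product_flow g g' M \<Psi>
  for g :: "'m::finite \<Rightarrow> real^'n \<Rightarrow> real^'n" and g' M a b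
    and f :: "real \<Rightarrow> real^'n \<Rightarrow> real^'m \<Rightarrow> real^'l \<Rightarrow> real^'n" and V v x\<^sub>0 \<Psi>
begin

text \<open>Along a solution the point \<open>\<Psi> (x r) (u t - u r)\<close> moves only under the drift, up to an
  error which is small where \<open>u r\<close> is close to \<open>u t\<close>.\<close>

lemma flow_defect:
  assumes "0 \<le> B" "0 \<le> R"
  obtains K where "K \<ge> 0"
    "\<And>u x s t. \<lbrakk>abs_continuous_on {a..b} u; solution u x; \<And>t. t \<in> {a..b} \<Longrightarrow> norm (x t) \<le> B;
       \<And>t. t \<in> {a..b} \<Longrightarrow> norm (u t) \<le> R; a \<le> s; s \<le> t; t \<le> b\<rbrakk> \<Longrightarrow>
       norm (x t - \<Psi> (x s) (u t - u s) - integral {s..t} (drift u x)) \<le> K * integral {s..t} (\<lambda>r. norm (u t - u r))"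
proof -
  have R2: "0 \<le> 2 * R" using assms by simp
  obtain C0 where C0: "\<And>p z. norm p \<le> B \<Longrightarrow> norm z \<le> 2 * R \<Longrightarrow> norm (\<Psi> p z) \<le> C0"
    by (rule \<Psi>_estimates[OF R2 assms(1)]) blast
  \<comment> \<open>The flow may leave the ball of radius \<open>B\<close>, and its images serve
    again as starting points; the second set of constants belongs to the enlarged ball.\<close>
  define B1 where "B1 = max B C0"
  have B1: "B1 \<ge> 0" "B \<le> B1" "C0 \<le> B1" using assms by (auto simp: B1_def)
  obtain C where C: "C \<ge> 0"
    "\<And>p q z. norm p \<le> B1 \<Longrightarrow> norm q \<le> B1 \<Longrightarrow> norm z \<le> 2 * R \<Longrightarrow>
        norm (\<Psi> p z - \<Psi> q z - (p - q)) \<le> C * norm z * norm (p - q)"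
    "\<And>p z. norm p \<le> B1 \<Longrightarrow> norm z \<le> 2 * R \<Longrightarrow> norm (\<Psi> p z - p) \<le> C * norm z"
    by (rule \<Psi>_estimates[OF R2 B1(1)]) blast
  \<comment> \<open>\<open>C\<close> measures how far the flow is from a translation; the other
    factor bounds the drift.\<close>
  define K where "K = C * (M * (1 + B + R))"
  have K: "K \<ge> 0" using C(1) M assms by (simp add: K_def)
  show thesis
  proof (rule that[OF K])
    fix u x s t
    assume u: "abs_continuous_on {a..b} u" and sol: "solution u x"
      and xB: "\<And>t. t \<in> {a..b} \<Longrightarrow> norm (x t) \<le> B" and uR: "\<And>t. t \<in> {a..b} \<Longrightarrow> norm (u t) \<le> R"
      and st: "a \<le> s" "s \<le> t" "t \<le> b"
    obtain N where "regular_solution g g' M a b f V v x\<^sub>0 u x N"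
      using regular_solution_exists[OF sol u] by blast
    then interpret s: regular_solution g g' M a b f V v x\<^sub>0 u x N .
    have sub: "{s..t} \<subseteq> {a..b}" using st by auto
    have xB1: "norm (x r) \<le> B1" if "r \<in> {s..t}" for r
      using xB[of r] that sub B1 by auto
    have u2R: "norm (u r - u q) \<le> 2 * R" if "r \<in> {s..t}" "q \<in> {s..t}" for r q
      using norm_triangle_ineq4[of "u r" "u q"] uR[of r] uR[of q] that sub by auto
    show "norm (x t - \<Psi> (x s) (u t - u s) - integral {s..t} (drift u x)) \<le> K * integral {s..t} (\<lambda>r. norm (u t - u r))"
    proof (cases "s = t")
      case False
      then have "s < t" using st by simp
      have tt: "t \<in> {s..t}" using st by simp
      define \<eta> where "\<eta> r = \<Psi> (x r) (u t - u r)" for r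
      have lip: "norm (\<eta> r - \<eta> q) \<le> (C * (2 * R) + 1 + C) * (norm (x r - x q) + norm (u r - u q))"
        if "q \<in> {s..t}" "r \<in> {s..t}" for q r
      proof -
        have "norm (\<Psi> (x r) (u t - u r) - \<Psi> (x q) (u t - u r) - (x r - x q)) \<le> C * norm (u t - u r) * norm (x r - x q)"
          by (intro C(2) xB1 u2R that tt)
        also have "\<dots> \<le> C * (2 * R) * norm (x r - x q)"
          using C(1) u2R[OF tt that(2)] by (intro mult_right_mono mult_left_mono) auto
        finally have 1: "norm (\<Psi> (x r) (u t - u r) - \<Psi> (x q) (u t - u r)) \<le> (C * (2 * R) + 1) * norm (x r - x q)"
          using norm_triangle_sub[of "\<Psi> (x r) (u t - u r) - \<Psi> (x q) (u t - u r)" "x r - x q"]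
          by (simp add: algebra_simps)
        \<comment> \<open>Additivity turns a change of the second argument into a further flow from
          a moved point.\<close>
        have eq: "\<Psi> (x q) (u t - u r) = \<Psi> (\<Psi> (x q) (u t - u q)) (u q - u r)"
          using \<Psi>_add[of "x q" "u t - u q" "u q - u r"] by simp
        have "norm (x q) \<le> B" using xB that sub by auto
        then have "norm (\<Psi> (x q) (u t - u q)) \<le> B1"
          using C0[of "x q" "u t - u q"] u2R[OF tt that(1)] B1 by linarith
        then have 2: "norm (\<Psi> (x q) (u t - u r) - \<Psi> (x q) (u t - u q)) \<le> C * norm (u r - u q)"
          using C(3)[of "\<Psi> (x q) (u t - u q)" "u q - u r"] u2R[OF that] unfolding eq
          by (simp add: norm_minus_commute[of "u q"])
        have "\<eta> r - \<eta> q = (\<Psi> (x r) (u t - u r) - \<Psi> (x q) (u t - u r)) + (\<Psi> (x q) (u t - u r) - \<Psi> (x q) (u t - u q))"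
          by (simp add: \<eta>_def)
        then have "norm (\<eta> r - \<eta> q) \<le> (C * (2 * R) + 1) * norm (x r - x q) + C * norm (u r - u q)"
          using norm_triangle_mono[OF 1 2] by (simp only:)
        also have "\<dots> \<le> (C * (2 * R) + 1 + C) * norm (x r - x q) + (C * (2 * R) + 1 + C) * norm (u r - u q)"
        proof -
          have "0 \<le> C * (2 * R)" using C(1) assms by simp
          then show ?thesis using C(1)
            by (intro add_mono[OF mult_right_mono mult_right_mono]) auto
        qed
        finally show ?thesis by (simp only: distrib_left)
      qed
      have ac: "abs_continuous_on {s..t} \<eta>"
        using abs_continuous_on_subset[OF s.x sub] abs_continuous_on_subset[OF s.u sub] lip
        by (rule abs_continuous_on_add_dominated)
      obtain N1 where N1: "negligible N1" "\<And>r. r \<in> {s..t} - N1 \<Longrightarrow>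
          (\<eta> has_vector_derivative vector_derivative \<eta> (at r within {s..t})) (at r within {s..t})"
        by (rule abs_continuous_differentiable_ae[OF ac]) blast
      define \<eta>' where "\<eta>' r = vector_derivative \<eta> (at r within {s..t})" for r
      have int: "(\<eta>' has_integral \<eta> t - \<eta> s) {s..t}"
        by (rule abs_continuous_has_integral_derivative[OF st(2) ac N1(1)]) (use N1(2) in \<open>simp add: \<eta>'_def\<close>)
      have le: "norm (\<eta>' r - drift u x r) \<le> K * norm (u t - u r)" if r: "r \<in> {s..t} - (N \<union> N1)" for r
      proof -
        have rab: "r \<in> {a..b} - N" "r \<in> {s..t}" using r sub by auto
        let ?F = "at r within {s..t}"
        have nt: "?F \<noteq> bot"
          using rab(2) \<open>s < t\<close> by (simp add: trivial_limit_within islimpt_Icc)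
        \<comment> \<open>The curve driven by the input alone from the state at time
          \<open>r\<close>. Subtracting it from \<open>x\<close> cancels the control term and leaves
          the drift as the derivative at \<open>r\<close>.\<close>
        define q where "q y = \<Psi> (x r) (u y - u r)" for y
        have du: "(u has_vector_derivative rate u r) ?F"
          by (rule has_vector_derivative_within_subset[OF s.N_u[OF rab(1)] sub])
        have "(q has_vector_derivative lincomb g (rate u r) (x r)) ?F"
          unfolding q_def by (rule \<Psi>_along_control[OF du])
        then have "((\<lambda>y. x y - q y) has_vector_derivative
            (drift u x r + lincomb g (rate u r) (x r)) - lincomb g (rate u r) (x r)) ?F"
          by (intro has_vector_derivative_diff has_vector_derivative_within_subset[OF s.N_x[OF rab(1)] sub])
        then have d1: "((\<lambda>y. (x y - q y - (x r - q r)) /\<^sub>R (y - r)) \<longlongrightarrow> drift u x r) ?F"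
          by (intro has_vector_derivative_quotient) simp
        have "x r - q r = 0" by (simp add: q_def)
        then have L1: "((\<lambda>y. (x y - q y) /\<^sub>R (y - r)) \<longlongrightarrow> drift u x r) ?F" using d1 by simp
        have L2: "((\<lambda>y. (\<eta> y - \<eta> r) /\<^sub>R (y - r)) \<longlongrightarrow> \<eta>' r) ?F"
          unfolding \<eta>'_def by (rule has_vector_derivative_quotient) (use N1(2) r in auto)
        have "(u \<longlongrightarrow> u r) ?F"
          using du has_vector_derivative_continuous by (auto simp: continuous_within)
        then have R1: "((\<lambda>y. C * norm (u t - u y) * norm ((x y - q y) /\<^sub>R (y - r))) \<longlongrightarrow>
            C * norm (u t - u r) * norm (drift u x r)) ?F"
          by (intro tendsto_intros L1)
        have L3: "((\<lambda>y. norm ((\<eta> y - \<eta> r) /\<^sub>R (y - r) - (x y - q y) /\<^sub>R (y - r))) \<longlongrightarrow> norm (\<eta>' r - drift u x r)) ?F"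
          by (intro tendsto_intros L1 L2)
        \<comment> \<open>\<open>\<eta> y\<close> and \<open>\<eta> r\<close> arise from
          \<open>x y\<close> and \<open>q y\<close> by the same flow, so their difference is that of
          the starting points up to an error with factor \<open>norm (u t - u y)\<close>.\<close>
        have ev: "\<forall>\<^sub>F y in ?F. norm ((\<eta> y - \<eta> r) /\<^sub>R (y - r) - (x y - q y) /\<^sub>R (y - r))
            \<le> C * norm (u t - u y) * norm ((x y - q y) /\<^sub>R (y - r))"
          unfolding eventually_at_filter
        proof (rule always_eventually, intro allI impI)
          fix y assume y: "y \<in> {s..t}"
          have "\<eta> r = \<Psi> (q y) (u t - u y)"
            using \<Psi>_add[of "x r" "u y - u r" "u t - u y"] by (simp add: \<eta>_def q_def)
          moreover have "norm (q y) \<le> B1"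
            using C0[of "x r" "u y - u r"] u2R[OF y rab(2)] xB[of r] rab B1 unfolding q_def by auto
          ultimately have "norm (\<eta> y - \<eta> r - (x y - q y)) \<le> C * norm (u t - u y) * norm (x y - q y)"
            unfolding \<eta>_def[of y] by (simp only:) (intro C(2) xB1 u2R y tt)
          then have "norm (\<eta> y - \<eta> r - (x y - q y)) * inverse \<bar>y - r\<bar>
              \<le> C * norm (u t - u y) * norm (x y - q y) * inverse \<bar>y - r\<bar>"
            by (rule mult_right_mono) simp
          then show "norm ((\<eta> y - \<eta> r) /\<^sub>R (y - r) - (x y - q y) /\<^sub>R (y - r))
              \<le> C * norm (u t - u y) * norm ((x y - q y) /\<^sub>R (y - r))"
            by (simp add: scaleR_diff_right[symmetric] mult_ac)
        qed
        have "norm (\<eta>' r - drift u x r) \<le> C * norm (u t - u r) * norm (drift u x r)"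
          by (rule tendsto_le[OF nt R1 L3 ev])
        also have "\<dots> \<le> C * norm (u t - u r) * (M * (1 + B + R))"
          using C(1) s.drift_bounded[OF rab(1) xB uR] rab by (intro mult_left_mono) auto
        finally show ?thesis by (simp add: K_def mult_ac)
      qed
      have di: "drift u x integrable_on {s..t}"
        using s.drift_integrable sub by (auto simp: absolutely_integrable_on_def intro: integrable_on_subinterval)
      have cu: "continuous_on {s..t} u" by (rule continuous_on_subset[OF s.continuous_u sub])
      have "norm (integral {s..t} (\<lambda>r. \<eta>' r - drift u x r)) \<le> integral {s..t} (\<lambda>r. K * norm (u t - u r))"
      proof (rule integral_norm_bound_ae[OF _ _ _ le])
        show "(\<lambda>r. \<eta>' r - drift u x r) integrable_on {s..t}"
          using int di by (intro integrable_diff) (auto simp: integrable_on_def)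
        show "(\<lambda>r. K * norm (u t - u r)) integrable_on {s..t}"
          by (intro integrable_continuous_interval continuous_intros cu)
        show "negligible (N \<union> N1)" using s.N N1(1) by simp
      qed
      moreover have "integral {s..t} (\<lambda>r. \<eta>' r - drift u x r) = \<eta> t - \<eta> s - integral {s..t} (drift u x)"
        using integral_diff[of \<eta>' "{s..t}" "drift u x"] int di integral_unique[OF int] by (auto simp: integrable_on_def)
      moreover have "\<eta> t = x t" "\<eta> s = \<Psi> (x s) (u t - u s)" by (simp_all add: \<eta>_def)
      ultimately show ?thesis by simp
    qed simp
  qed
qed

end

section \<open>Null sets, subsequences and the passage to the limit\<close>

lemma interval_point_avoiding_negligible:
  assumes "negligible N" "c < (d::real)"
  obtains s where "c < s" "s < d" "s \<notin> N"
proof -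
  have "\<not> {c<..<d} \<subseteq> N"
  proof
    assume "{c<..<d} \<subseteq> N"
    then have "negligible {c<..<d}" by (rule negligible_subset[OF assms(1)])
    then show False using open_not_negligible[of "{c<..<d}"] assms(2) by auto
  qed
  then obtain s where "s \<in> {c<..<d}" "s \<notin> N" by blast
  then show thesis using that[of s] by simp
qed

lemma right_sequence_avoiding_negligible:
  assumes N: "negligible N" and "\<tau> < (b::real)"
  obtains \<sigma> where "\<And>n. \<sigma> n \<in> {\<tau><..b} - N" "\<sigma> \<longlonglongrightarrow> \<tau>"
proof -
  have "\<exists>s. s \<in> {\<tau><..b} - N \<and> s < \<tau> + 1 / Suc n" for n
  proof -
    have "\<tau> < min b (\<tau> + 1 / Suc n)" using assms by simp
    from interval_point_avoiding_negligible[OF N this] obtain s where "\<tau> < s" "s < min b (\<tau> + 1 / Suc n)" "s \<notin> N" .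
    then show ?thesis by (intro exI[of _ s]) auto
  qed
  then obtain \<sigma> where \<sigma>: "\<And>n. \<sigma> n \<in> {\<tau><..b} - N" "\<And>n. \<sigma> n < \<tau> + 1 / Suc n" by metis
  have "(\<lambda>n. \<tau> + 1 / real (Suc n)) \<longlonglongrightarrow> \<tau> + 0"
    by (intro tendsto_add tendsto_const LIMSEQ_Suc[OF lim_1_over_n])
  then have lim: "(\<lambda>n. \<tau> + 1 / real (Suc n)) \<longlonglongrightarrow> \<tau>" by simp
  have bnd: "\<tau> \<le> \<sigma> n" "\<sigma> n \<le> \<tau> + 1 / real (Suc n)" for n
    using \<sigma>(1)[of n] \<sigma>(2)[of n] by auto
  have "\<sigma> \<longlonglongrightarrow> \<tau>"
    by (rule real_tendsto_sandwich[OF always_eventually always_eventually tendsto_const lim])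
      (intro allI bnd)+
  then show thesis using \<sigma>(1) that by blast
qed

text \<open>Approach from the right, except at \<open>b\<close>, where the problem is
  reflected.\<close>

lemma sequence_avoiding_negligible:
  assumes N: "negligible N" and "a < b" and \<tau>: "\<tau> \<in> {a..b::real}"
  obtains \<sigma> where "\<And>n. \<sigma> n \<in> {a..b} - N" "\<sigma> \<longlonglongrightarrow> \<tau>"
proof (cases "\<tau> < b")
  case True
  obtain \<sigma> where \<sigma>: "\<And>n. \<sigma> n \<in> {\<tau><..b} - N" "\<sigma> \<longlonglongrightarrow> \<tau>"
    by (rule right_sequence_avoiding_negligible[OF N True]) blast
  moreover have "{\<tau><..b} \<subseteq> {a..b}" using \<tau> by auto
  ultimately show thesis by (intro that[of \<sigma>]) blast+
next
  case False
  then have "\<tau> = b" using \<tau> by simp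
  have "negligible (uminus ` N)" using N negligible_differentiable_image_negligible[of N uminus]
    by (simp add: differentiable_on_minus)
  then obtain \<sigma> where \<sigma>: "\<And>n. \<sigma> n \<in> {- b<..- a} - uminus ` N" "\<sigma> \<longlonglongrightarrow> - b"
    by (rule right_sequence_avoiding_negligible[of "uminus ` N" "- b" "- a"]) (use \<open>a < b\<close> \<open>negligible (uminus ` N)\<close> in auto)
  show thesis
  proof (rule that[of "\<lambda>n. - \<sigma> n"])
    show "- \<sigma> n \<in> {a..b} - N" for n
      using \<sigma>(1)[of n] by (auto simp: image_iff)
    show "(\<lambda>n. - \<sigma> n) \<longlonglongrightarrow> \<tau>" using tendsto_minus[OF \<sigma>(2)] \<open>\<tau> = b\<close> by simp
  qed
qed

lemma point_L1_tendsto_pointwise: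
  fixes w :: "real \<Rightarrow> 'a::euclidean_space"
  assumes "point_L1_tendsto I \<tau> wk w"
  shows "(\<lambda>k. wk k \<tau>) \<longlonglongrightarrow> w \<tau>"
proof -
  have S: "(\<lambda>k. norm (wk k \<tau> - w \<tau>) + (LINT t|lebesgue_on I. norm (wk k t - w t))) \<longlonglongrightarrow> 0"
    using assms by (simp add: point_L1_tendsto_def)
  have "(\<lambda>k. norm (wk k \<tau> - w \<tau>)) \<longlonglongrightarrow> 0"
    by (rule real_tendsto_sandwich[OF _ _ tendsto_const S]) (simp_all add: integral_nonneg_AE)
  then show ?thesis by (simp add: tendsto_norm_zero_iff LIM_zero_iff)
qed

text \<open>Convergence in \<open>L1\<close> gives a subsequence converging almost everywhere; the
  point \<open>\<tau>\<close>, where convergence is known separately, is then taken out of the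
  exceptional set.\<close>

lemma point_L1_tendsto_subseq:
  fixes w :: "real \<Rightarrow> 'a::euclidean_space"
  assumes "point_L1_tendsto {a..b} \<tau> wk w"
  obtains r N where "strict_mono (r :: nat \<Rightarrow> nat)" "negligible N" "\<tau> \<notin> N"
    "\<And>t. t \<in> {a..b} - N \<Longrightarrow> (\<lambda>k. wk (r k) t) \<longlonglongrightarrow> w t" "(\<lambda>k. wk (r k) \<tau>) \<longlonglongrightarrow> w \<tau>"
proof -
  define I where "I k = (LINT t|lebesgue_on {a..b}. norm (wk k t - w t))" for k
  have int: "\<And>k. integrable (lebesgue_on {a..b}) (\<lambda>t. wk k t - w t)" and PI: "(\<lambda>k. norm (wk k \<tau> - w \<tau>) + I k) \<longlonglongrightarrow> 0"
    using assms by (auto simp: point_L1_tendsto_def I_def)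
  have nn: "0 \<le> I k" for k by (simp add: I_def)
  have I0: "I \<longlonglongrightarrow> 0"
    by (rule real_tendsto_sandwich[OF _ _ tendsto_const PI]) (simp_all add: nn)
  obtain r where r: "strict_mono (r :: nat \<Rightarrow> nat)" "AE t in lebesgue_on {a..b}. (\<lambda>k. wk (r k) t - w t) \<longlonglongrightarrow> 0"
    using tendsto_L1_AE_subseq[of "lebesgue_on {a..b}" "\<lambda>k t. wk k t - w t", OF int I0[unfolded I_def[abs_def]]] by blast
  obtain N where N: "negligible N" "\<And>t. t \<in> {a..b} - N \<Longrightarrow> (\<lambda>k. wk (r k) t - w t) \<longlonglongrightarrow> 0"
    using r(2) unfolding AE_lebesgue_on_interval by blast
  have \<tau>: "(\<lambda>k. wk (r k) \<tau>) \<longlonglongrightarrow> w \<tau>"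
    using LIMSEQ_subseq_LIMSEQ[OF point_L1_tendsto_pointwise[OF assms] r(1)] by (simp add: o_def)
  show thesis
  proof (rule that[of r "N - {\<tau>}"])
    show "negligible (N - {\<tau>})" using N(1) by (rule negligible_subset) auto
    show "(\<lambda>k. wk (r k) t) \<longlonglongrightarrow> w t" if "t \<in> {a..b} - (N - {\<tau>})" for t
      using N(2)[of t] \<tau> that by (cases "t = \<tau>") (auto simp: LIM_zero_iff)
  qed (use r(1) \<tau> in auto)
qed

context commuting_system
begin

text \<open>Every term of the flow estimate passes to the limit under almost everywhere convergence
  of states and inputs, and its constants depend on common bounds only. The exceptional set belongs
  to one sequence and avoids that sequence's \<open>\<tau>\<close>.\<close>

lemma limit_flow_defect:
  assumes u: "abs_continuous_on {a..b} u" and R: "\<And>w. w \<in> U \<Longrightarrow> norm w \<le> R" "0 \<le> R"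
    and uU: "\<And>t. t \<in> {a..b} \<Longrightarrow> u t \<in> U"
    and app: "approximates_at a b f g U x\<^sub>0 u v x \<tau> uk" and \<tau>: "\<tau> \<in> {a..b}"
  obtains N K B where "negligible N" "\<tau> \<notin> N" "K \<ge> 0" "B \<ge> 0"
    "\<And>t. t \<in> {a..b} - N \<Longrightarrow> norm (x t) \<le> B" "drift u x integrable_on {a..b}"
    "\<And>s t. a \<le> s \<Longrightarrow> s \<le> t \<Longrightarrow> t \<le> b \<Longrightarrow> norm (integral {s..t} (drift u x)) \<le> K * (t - s)"
    "\<And>s t. s \<in> {a..b} - N \<Longrightarrow> t \<in> {a..b} - N \<Longrightarrow> s \<le> t \<Longrightarrow>
       norm (x t - \<Psi> (x s) (u t - u s) - integral {s..t} (drift u x)) \<le> K * integral {s..t} (\<lambda>r. norm (u t - u r))"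
    "\<tau> = a \<Longrightarrow> x a = x\<^sub>0"
proof -
  obtain yk B where ukAC: "\<And>k. uk k \<in> AC {a..b} U" and ysol: "\<And>k. solution (uk k) (yk k)"
    and yB: "\<And>k t. t \<in> {a..b} \<Longrightarrow> norm (yk k t) \<le> B"
    and pt: "point_L1_tendsto {a..b} \<tau> (\<lambda>k t. (yk k t, uk k t)) (\<lambda>t. (x t, u t))"
    using app unfolding approximates_at_def by blast
  obtain r N where rN: "strict_mono (r :: nat \<Rightarrow> nat)" "negligible N" "\<tau> \<notin> N"
    "\<And>t. t \<in> {a..b} - N \<Longrightarrow> (\<lambda>k. (yk (r k) t, uk (r k) t)) \<longlonglongrightarrow> (x t, u t)"
    by (rule point_L1_tendsto_subseq[OF pt]) blast
  have limx: "(\<lambda>k. yk (r k) t) \<longlonglongrightarrow> x t" and limu: "(\<lambda>k. uk (r k) t) \<longlonglongrightarrow> u t" if "t \<in> {a..b} - N" for t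
    using tendsto_fst[OF rN(4)[OF that]] tendsto_snd[OF rN(4)[OF that]] by auto
  have uAC: "abs_continuous_on {a..b} (uk k)" and uR: "t \<in> {a..b} \<Longrightarrow> norm (uk k t) \<le> R" for k t
    using ukAC[of k] R by (auto simp: AC_def)
  have "B \<ge> 0" using yB[of a 0] ab norm_ge_zero[of "yk 0 a"] by (simp del: norm_ge_zero)
  obtain K0 where K0: "K0 \<ge> 0"
    "\<And>u x s t. \<lbrakk>abs_continuous_on {a..b} u; solution u x; \<And>t. t \<in> {a..b} \<Longrightarrow> norm (x t) \<le> B;
       \<And>t. t \<in> {a..b} \<Longrightarrow> norm (u t) \<le> R; a \<le> s; s \<le> t; t \<le> b\<rbrakk> \<Longrightarrow>
       norm (x t - \<Psi> (x s) (u t - u s) - integral {s..t} (drift u x)) \<le> K0 * integral {s..t} (\<lambda>r. norm (u t - u r))"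
    by (rule flow_defect[OF \<open>B \<ge> 0\<close> R(2)]) blast
  define K where "K = max K0 (M * (1 + B + R))"
  have K: "K0 \<le> K" "M * (1 + B + R) \<le> K" "K \<ge> 0" using K0(1) by (auto simp: K_def)
  have dc: "drift u x integrable_on {s..t}"
    "(\<lambda>k. integral {s..t} (drift (uk (r k)) (yk (r k)))) \<longlonglongrightarrow> integral {s..t} (drift u x)"
    if "a \<le> s" "t \<le> b" for s t
    by (rule drift_convergence[where uk="\<lambda>k. uk (r k)" and xk="\<lambda>k. yk (r k)" and x=x and u=u,
          OF uAC ysol yB uR rN(2) limx limu that]; assumption)+
  show thesis
  proof (rule that[OF rN(2,3) K(3) \<open>B \<ge> 0\<close>])
    show "norm (x t) \<le> B" if "t \<in> {a..b} - N" for t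
      by (rule Lim_bounded[OF tendsto_norm[OF limx[OF that]]]) (use yB that in auto)
    show "drift u x integrable_on {a..b}" by (rule dc(1)) auto
    show "norm (integral {s..t} (drift u x)) \<le> K * (t - s)" if st: "a \<le> s" "s \<le> t" "t \<le> b" for s t
    proof (rule Lim_bounded[OF tendsto_norm[OF dc(2)[OF st(1,3)]]], intro allI impI)
      fix k :: nat
      obtain Nk where "regular_solution g g' M a b f V v x\<^sub>0 (uk (r k)) (yk (r k)) Nk"
        using regular_solution_exists[OF ysol uAC] by blast
      then interpret s: regular_solution g g' M a b f V v x\<^sub>0 "uk (r k)" "yk (r k)" Nk .
      have "norm (integral {s..t} (drift (uk (r k)) (yk (r k)))) \<le> integral {s..t} (\<lambda>_. M * (1 + B + R))"
      proof (rule integral_norm_bound_ae[OF _ _ s.N])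
        show "drift (uk (r k)) (yk (r k)) integrable_on {s..t}"
          using s.drift_integrable st by (auto simp: absolutely_integrable_on_def intro: integrable_on_subinterval)
        show "norm (drift (uk (r k)) (yk (r k)) q) \<le> M * (1 + B + R)" if "q \<in> {s..t} - Nk" for q
          using that st by (intro s.drift_bounded yB uR) auto
      qed (rule integrable_const_ivl)
      also have "\<dots> = M * (1 + B + R) * (t - s)" using st by simp
      also have "\<dots> \<le> K * (t - s)" using K(2) st by (intro mult_right_mono) auto
      finally show "norm (integral {s..t} (drift (uk (r k)) (yk (r k)))) \<le> K * (t - s)" .
    qed
    show "norm (x t - \<Psi> (x s) (u t - u s) - integral {s..t} (drift u x)) \<le> K * integral {s..t} (\<lambda>r. norm (u t - u r))"
      if s: "s \<in> {a..b} - N" and t: "t \<in> {a..b} - N" and st: "s \<le> t" for s t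
    proof -
      have sab: "a \<le> s" "t \<le> b" using s t by auto
      have sub: "{s..t} \<subseteq> {a..b}" using sab by auto
      have c: "continuous_on {s..t} (uk k)" for k
        by (rule continuous_on_subset[OF abs_continuous_on_imp_continuous[OF uAC] sub])
      have I: "(\<lambda>k. integral {s..t} (\<lambda>q. norm (uk (r k) t - uk (r k) q))) \<longlonglongrightarrow> integral {s..t} (\<lambda>q. norm (u t - u q))"
      proof (rule dominated_convergence_ae(2)[OF _ rN(2)])
        show "(\<lambda>q. norm (uk (r k) t - uk (r k) q)) integrable_on {s..t}" for k
          by (intro integrable_continuous_interval continuous_intros c)
        show "norm (norm (uk (r k) t - uk (r k) q)) \<le> R + R" if "q \<in> {s..t} - N" for k q
          using norm_triangle_ineq4[of "uk (r k) t" "uk (r k) q"] uR[of t "r k"] uR[of q "r k"] that sub t by auto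
        show "(\<lambda>k. norm (uk (r k) t - uk (r k) q)) \<longlonglongrightarrow> norm (u t - u q)" if "q \<in> {s..t} - N" for q
          using that sub by (intro tendsto_intros limu t) auto
      qed
      have L: "(\<lambda>k. norm (yk (r k) t - \<Psi> (yk (r k) s) (uk (r k) t - uk (r k) s) - integral {s..t} (drift (uk (r k)) (yk (r k)))))
          \<longlonglongrightarrow> norm (x t - \<Psi> (x s) (u t - u s) - integral {s..t} (drift u x))"
        by (intro tendsto_norm tendsto_diff \<Psi>_tendsto limx limu s t dc(2) sab)
      have "norm (x t - \<Psi> (x s) (u t - u s) - integral {s..t} (drift u x)) \<le> K0 * integral {s..t} (\<lambda>r. norm (u t - u r))"
      proof (rule tendsto_le[OF _ tendsto_mult_left[OF I] L])
        show "\<forall>\<^sub>F k in sequentially. norm (yk (r k) t - \<Psi> (yk (r k) s) (uk (r k) t - uk (r k) s) - integral {s..t} (drift (uk (r k)) (yk (r k))))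
          \<le> K0 * integral {s..t} (\<lambda>q. norm (uk (r k) t - uk (r k) q))"
          by (intro always_eventually allI K0(2) uAC ysol yB uR sab st)
      qed simp
      also have "\<dots> \<le> K * integral {s..t} (\<lambda>r. norm (u t - u r))"
      proof (rule mult_right_mono[OF K(1)])
        show "0 \<le> integral {s..t} (\<lambda>r. norm (u t - u r))"
          using abs_continuous_on_imp_continuous[OF u] sub
          by (intro integral_nonneg integrable_continuous_interval continuous_intros) (auto intro: continuous_on_subset)
      qed
      finally show ?thesis .
    qed
    \<comment> \<open>Convergence at \<open>a\<close> is certain only when \<open>a\<close> is the
      chosen \<open>\<tau>\<close>, because \<open>a\<close> may otherwise lie in
      \<open>N\<close>.\<close>
    show "x a = x\<^sub>0" if "\<tau> = a"
    proof -
      have "yk (r k) a = x\<^sub>0" for k using ysol[of "r k"] by (simp add: solution_iff)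
      then show ?thesis using limx[of a] rN(3) that ab LIMSEQ_unique[of "\<lambda>k. x\<^sub>0" x\<^sub>0 "x a"] by simp
    qed
  qed
qed

end

text \<open>Lebesgue's differentiation theorem, shaped for difference quotients from the right along
  sequences. Extension by zero makes the integrand integrable on every box.\<close>

lemma right_average_tendsto:
  fixes h :: "real \<Rightarrow> 'c::euclidean_space"
  assumes "h integrable_on {a..b}"
  obtains N where "negligible N"
    "\<And>r \<sigma>. r \<in> {a..<b} - N \<Longrightarrow> (\<And>n. \<sigma> n \<in> {r<..b}) \<Longrightarrow> \<sigma> \<longlonglongrightarrow> r \<Longrightarrow>
       (\<lambda>n. integral {r..\<sigma> n} h /\<^sub>R (\<sigma> n - r)) \<longlonglongrightarrow> h r"
proof -
  define H where "H t = (if t \<in> {a..b} then h t else 0)" for t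
  have "H integrable_on UNIV" unfolding H_def using assms by (simp only: integrable_restrict_UNIV)
  then have "H integrable_on cbox c d" for c d
    by (rule integrable_on_subcbox) simp
  then obtain N where N: "negligible N"
    "\<And>r e. \<lbrakk>r \<notin> N; 0 < e\<rbrakk> \<Longrightarrow> \<exists>d>0. \<forall>l. 0 < l \<and> l < d \<longrightarrow> norm (integral (cbox r (r + l *\<^sub>R One)) H /\<^sub>R l ^ DIM(real) - H r) < e"
    by (rule integrable_ccontinuous_explicit) blast
  show thesis
  proof (rule that[OF N(1)])
    fix r \<sigma> assume r: "r \<in> {a..<b} - N" and \<sigma>: "\<And>n. \<sigma> n \<in> {r<..b}" "\<sigma> \<longlonglongrightarrow> r"
    show "(\<lambda>n. integral {r..\<sigma> n} h /\<^sub>R (\<sigma> n - r)) \<longlonglongrightarrow> h r"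
      unfolding LIMSEQ_iff
    proof (intro allI impI)
      fix e :: real assume "0 < e"
      obtain d where d: "d > 0" "\<And>l. 0 < l \<Longrightarrow> l < d \<Longrightarrow> norm (integral (cbox r (r + l *\<^sub>R One)) H /\<^sub>R l ^ DIM(real) - H r) < e"
        using N(2)[of r e] r \<open>0 < e\<close> by blast
      obtain n0 where n0: "\<And>n. n \<ge> n0 \<Longrightarrow> norm (\<sigma> n - r) < d" using \<sigma>(2) d(1) unfolding LIMSEQ_iff by blast
      have "norm (integral {r..\<sigma> n} h /\<^sub>R (\<sigma> n - r) - h r) < e" if "n \<ge> n0" for n
      proof -
        have "0 < \<sigma> n - r" "\<sigma> n - r < d" using \<sigma>(1)[of n] n0[OF that] by auto
        then have "norm (integral {r..\<sigma> n} H /\<^sub>R (\<sigma> n - r) - H r) < e" using d(2)[of "\<sigma> n - r"] by simp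
        moreover have "integral {r..\<sigma> n} H = integral {r..\<sigma> n} h"
          using \<sigma>(1)[of n] r by (intro integral_cong) (auto simp: H_def)
        ultimately show ?thesis using r by (simp add: H_def)
      qed
      then show "\<exists>no. \<forall>n\<ge>no. norm (integral {r..\<sigma> n} h /\<^sub>R (\<sigma> n - r) - h r) < e" by blast
    qed
  qed
qed

section \<open>Regularity of the limit and the equation it satisfies\<close>

context commuting_system
begin

text \<open>The integral of \<open>norm (u t - u r)\<close> is bounded crudely by
  \<open>2 * R * (t - s)\<close>; the flow contributes the increment of \<open>u\<close>, the drift
  that of time.\<close>

lemma limit_increments:
  assumes u: "abs_continuous_on {a..b} u" and R: "\<And>w. w \<in> U \<Longrightarrow> norm w \<le> R" "0 \<le> R"
    and uU: "\<And>t. t \<in> {a..b} \<Longrightarrow> u t \<in> U"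
    and app: "approximates_at a b f g U x\<^sub>0 u v x \<tau> uk" and \<tau>: "\<tau> \<in> {a..b}"
  obtains N K where "negligible N" "\<tau> \<notin> N" "K \<ge> 0"
    "\<And>s t. s \<in> {a..b} - N \<Longrightarrow> t \<in> {a..b} - N \<Longrightarrow> norm (x t - x s) \<le> K * (norm (u t - u s) + norm (t - s))"
proof -
  obtain N K B where N: "negligible N" "\<tau> \<notin> N" "K \<ge> 0" "B \<ge> 0"
    "\<And>t. t \<in> {a..b} - N \<Longrightarrow> norm (x t) \<le> B"
    "\<And>s t. a \<le> s \<Longrightarrow> s \<le> t \<Longrightarrow> t \<le> b \<Longrightarrow> norm (integral {s..t} (drift u x)) \<le> K * (t - s)"
    "\<And>s t. s \<in> {a..b} - N \<Longrightarrow> t \<in> {a..b} - N \<Longrightarrow> s \<le> t \<Longrightarrow>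
       norm (x t - \<Psi> (x s) (u t - u s) - integral {s..t} (drift u x)) \<le> K * integral {s..t} (\<lambda>r. norm (u t - u r))"
    by (rule limit_flow_defect[OF u R uU app \<tau>]) blast+
  have "0 \<le> 2 * R" using R(2) by simp
  then obtain C where C: "C \<ge> 0" "\<And>p z. norm p \<le> B \<Longrightarrow> norm z \<le> 2 * R \<Longrightarrow> norm (\<Psi> p z - p) \<le> C * norm z"
    by (rule \<Psi>_estimates[OF _ N(4)]) blast
  define K' where "K' = K * (2 * R) + C + K"
  have KR: "0 \<le> K * (2 * R)" using N(3) R(2) by simp
  have K': "K' \<ge> 0" "C \<le> K'" "K * (2 * R) + K \<le> K'" using KR N(3) C(1) by (auto simp: K'_def)
  have u2R: "norm (u t - u s) \<le> 2 * R" if "s \<in> {a..b}" "t \<in> {a..b}" for s t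
    using norm_triangle_ineq4[of "u t" "u s"] R(1)[OF uU[OF that(1)]] R(1)[OF uU[OF that(2)]] by simp
  have main: "norm (x t - x s) \<le> K' * (norm (u t - u s) + norm (t - s))"
    if s: "s \<in> {a..b} - N" and t: "t \<in> {a..b} - N" and st: "s \<le> t" for s t
  proof -
    have sub: "{s..t} \<subseteq> {a..b}" using s t by auto
    have "integral {s..t} (\<lambda>r. norm (u t - u r)) \<le> integral {s..t} (\<lambda>_. 2 * R)"
    proof (rule integral_le)
      show "(\<lambda>r. norm (u t - u r)) integrable_on {s..t}"
        using abs_continuous_on_imp_continuous[OF u] sub
        by (intro integrable_continuous_interval continuous_intros) (auto intro: continuous_on_subset)
      show "norm (u t - u r) \<le> 2 * R" if "r \<in> {s..t}" for r using u2R that sub t by auto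
    qed (rule integrable_const_ivl)
    also have "\<dots> = 2 * R * (t - s)" using st by simp
    finally have "K * integral {s..t} (\<lambda>r. norm (u t - u r)) \<le> K * (2 * R * (t - s))"
      using N(3) by (rule mult_left_mono)
    then have 1: "norm (x t - \<Psi> (x s) (u t - u s) - integral {s..t} (drift u x)) \<le> K * (2 * R) * (t - s)"
      using N(7)[OF s t st] by (simp add: mult.assoc)
    have 2: "norm (\<Psi> (x s) (u t - u s) - x s) \<le> C * norm (u t - u s)"
      using N(5)[OF s] u2R s t by (intro C(2)) auto
    have 3: "norm (integral {s..t} (drift u x)) \<le> K * (t - s)" using s t st by (intro N(6)) auto
    have "x t - x s = (x t - \<Psi> (x s) (u t - u s) - integral {s..t} (drift u x)) + (\<Psi> (x s) (u t - u s) - x s) + integral {s..t} (drift u x)"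
      by simp
    then have "norm (x t - x s) \<le> K * (2 * R) * (t - s) + C * norm (u t - u s) + K * (t - s)"
      using norm_triangle_mono[OF norm_triangle_mono[OF 1 2] 3] by (simp only:)
    also have "\<dots> = C * norm (u t - u s) + (K * (2 * R) + K) * (t - s)" by (simp add: algebra_simps)
    also have "\<dots> \<le> K' * norm (u t - u s) + K' * (t - s)"
      using K' st by (intro add_mono mult_right_mono) auto
    finally show ?thesis using st by (simp add: distrib_left)
  qed
  show thesis
  proof (rule that[OF N(1,2) K'(1)])
    fix s t assume "s \<in> {a..b} - N" "t \<in> {a..b} - N"
    then show "norm (x t - x s) \<le> K' * (norm (u t - u s) + norm (t - s))"
      using main[of s t] main[of t s] by (cases "s \<le> t") (auto simp: norm_minus_commute abs_minus_commute)
  qed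
qed

text \<open>The bound on increments holds off the null set of the sequence for \<open>a\<close>. At
  another time \<open>\<tau>\<close> the value of \<open>x\<close> is tied to nearby values by the
  sequence for \<open>\<tau>\<close>, and points avoiding both null sets carry the first bound over
  to \<open>\<tau>\<close> with its constant unchanged.\<close>

lemma limit_abs_continuous:
  assumes u: "abs_continuous_on {a..b} u" and R: "\<And>w. w \<in> U \<Longrightarrow> norm w \<le> R" "0 \<le> R"
    and uU: "\<And>t. t \<in> {a..b} \<Longrightarrow> u t \<in> U" and lim: "limit_solution a b f g U x\<^sub>0 u v x"
  shows "abs_continuous_on {a..b} x"
proof -
  have "a \<in> {a..b}" using ab by simp
  then obtain uk where app: "approximates_at a b f g U x\<^sub>0 u v x a uk" using lim unfolding limit_solution_def by blast
  obtain N K where N: "negligible N" "K \<ge> 0"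
    "\<And>s t. s \<in> {a..b} - N \<Longrightarrow> t \<in> {a..b} - N \<Longrightarrow> norm (x t - x s) \<le> K * (norm (u t - u s) + norm (t - s))"
    by (rule limit_increments[OF u R uU app \<open>a \<in> {a..b}\<close>]) blast+
  have ucont: "(\<lambda>n. u (\<sigma> n)) \<longlonglongrightarrow> u \<tau>"
    if "\<sigma> \<longlonglongrightarrow> \<tau>" "\<And>n. \<sigma> n \<in> {a..b}" "\<tau> \<in> {a..b}" for \<sigma> \<tau>
    using continuous_on_tendsto_compose[OF abs_continuous_on_imp_continuous[OF u] that(1,3)] that(2) by simp
  have approach: "\<exists>\<sigma>. (\<forall>n. \<sigma> n \<in> {a..b} - N) \<and> \<sigma> \<longlonglongrightarrow> \<tau> \<and> (\<lambda>n. x (\<sigma> n)) \<longlonglongrightarrow> x \<tau>"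
    if \<tau>: "\<tau> \<in> {a..b}" for \<tau>
  proof -
    obtain uk' where app': "approximates_at a b f g U x\<^sub>0 u v x \<tau> uk'" using lim \<tau> unfolding limit_solution_def by blast
    obtain N' K' where N': "negligible N'" "\<tau> \<notin> N'" "K' \<ge> 0"
      "\<And>s t. s \<in> {a..b} - N' \<Longrightarrow> t \<in> {a..b} - N' \<Longrightarrow> norm (x t - x s) \<le> K' * (norm (u t - u s) + norm (t - s))"
      by (rule limit_increments[OF u R uU app' \<tau>]) blast+
    obtain \<sigma> where \<sigma>: "\<And>n. \<sigma> n \<in> {a..b} - (N \<union> N')" "\<sigma> \<longlonglongrightarrow> \<tau>"
      by (rule sequence_avoiding_negligible[OF negligible_Un[OF N(1) N'(1)] ab \<tau>]) blast
    have "(\<lambda>n. K' * (norm (u (\<sigma> n) - u \<tau>) + norm (\<sigma> n - \<tau>))) \<longlonglongrightarrow> K' * (norm (u \<tau> - u \<tau>) + norm (\<tau> - \<tau>))"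
      using \<sigma>(1) by (intro tendsto_intros ucont \<sigma>(2) \<tau>) blast
    then have t0: "(\<lambda>n. K' * (norm (u (\<sigma> n) - u \<tau>) + norm (\<sigma> n - \<tau>))) \<longlonglongrightarrow> 0" by simp
    have le: "norm (x (\<sigma> n) - x \<tau>) \<le> K' * (norm (u (\<sigma> n) - u \<tau>) + norm (\<sigma> n - \<tau>))" for n
      using \<sigma>(1)[of n] \<tau> N'(2) by (intro N'(4)) auto
    have "(\<lambda>n. x (\<sigma> n) - x \<tau>) \<longlonglongrightarrow> 0"
      by (rule Lim_null_comparison[OF _ t0]) (intro always_eventually allI le)
    then have "(\<lambda>n. x (\<sigma> n)) \<longlonglongrightarrow> x \<tau>" by (simp add: LIM_zero_iff)
    then show ?thesis using \<sigma> by blast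
  qed
  have "norm (x t - x s) \<le> K * (norm (u t - u s) + norm (t - s))" if st: "s \<in> {a..b}" "t \<in> {a..b}" for s t
  proof -
    obtain \<sigma> where \<sigma>: "\<forall>n. \<sigma> n \<in> {a..b} - N" "\<sigma> \<longlonglongrightarrow> s" "(\<lambda>n. x (\<sigma> n)) \<longlonglongrightarrow> x s" using approach[OF st(1)] by blast
    obtain \<rho> where \<rho>: "\<forall>n. \<rho> n \<in> {a..b} - N" "\<rho> \<longlonglongrightarrow> t" "(\<lambda>n. x (\<rho> n)) \<longlonglongrightarrow> x t" using approach[OF st(2)] by blast
    have us: "(\<lambda>n. u (\<sigma> n)) \<longlonglongrightarrow> u s" by (rule ucont[OF \<sigma>(2) _ st(1)]) (use \<sigma>(1) in blast)
    have ut: "(\<lambda>n. u (\<rho> n)) \<longlonglongrightarrow> u t" by (rule ucont[OF \<rho>(2) _ st(2)]) (use \<rho>(1) in blast)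
    show ?thesis
    proof (rule tendsto_le[OF sequentially_bot])
      show "(\<lambda>n. K * (norm (u (\<rho> n) - u (\<sigma> n)) + norm (\<rho> n - \<sigma> n))) \<longlonglongrightarrow> K * (norm (u t - u s) + norm (t - s))"
        by (intro tendsto_intros us ut \<sigma>(2) \<rho>(2))
      show "(\<lambda>n. norm (x (\<rho> n) - x (\<sigma> n))) \<longlonglongrightarrow> norm (x t - x s)"
        by (intro tendsto_intros \<sigma>(3) \<rho>(3))
      show "\<forall>\<^sub>F n in sequentially. norm (x (\<rho> n) - x (\<sigma> n)) \<le> K * (norm (u (\<rho> n) - u (\<sigma> n)) + norm (\<rho> n - \<sigma> n))"
        using \<sigma>(1) \<rho>(1) by (intro always_eventually allI N(3)) auto
    qed
  qed
  then show ?thesis by (rule abs_continuous_on_add_dominated[OF u abs_continuous_on_ident])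
qed

theorem commuting_limit_solution:
  assumes u: "abs_continuous_on {a..b} u" and R: "\<And>w. w \<in> U \<Longrightarrow> norm w \<le> R" "0 \<le> R"
    and uU: "\<And>t. t \<in> {a..b} \<Longrightarrow> u t \<in> U" and lim: "limit_solution a b f g U x\<^sub>0 u v x"
  shows "solution u x"
proof -
  have x: "abs_continuous_on {a..b} x" by (rule limit_abs_continuous[OF u R uU lim])
  have aab: "a \<in> {a..b}" using ab by simp
  obtain uk where app: "approximates_at a b f g U x\<^sub>0 u v x a uk" using lim aab unfolding limit_solution_def by blast
  obtain N K B where N: "negligible N" "K \<ge> 0" "drift u x integrable_on {a..b}"
    "\<And>s t. s \<in> {a..b} - N \<Longrightarrow> t \<in> {a..b} - N \<Longrightarrow> s \<le> t \<Longrightarrow>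
       norm (x t - \<Psi> (x s) (u t - u s) - integral {s..t} (drift u x)) \<le> K * integral {s..t} (\<lambda>r. norm (u t - u r))"
    "x a = x\<^sub>0"
    by (rule limit_flow_defect[OF u R uU app aab]) blast+
  obtain N1 where N1: "negligible N1"
    "\<And>t. t \<in> {a..b} - N1 \<Longrightarrow> (u has_vector_derivative rate u t) (at t within {a..b})"
    by (rule abs_continuous_differentiable_ae[OF u]) blast
  obtain N2 where N2: "negligible N2"
    "\<And>t. t \<in> {a..b} - N2 \<Longrightarrow> (x has_vector_derivative rate x t) (at t within {a..b})"
    by (rule abs_continuous_differentiable_ae[OF x]) blast
  obtain N3 where N3: "negligible N3"
    "\<And>r \<sigma>. r \<in> {a..<b} - N3 \<Longrightarrow> (\<And>n. \<sigma> n \<in> {r<..b}) \<Longrightarrow> \<sigma> \<longlonglongrightarrow> r \<Longrightarrow>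
       (\<lambda>n. integral {r..\<sigma> n} (drift u x) /\<^sub>R (\<sigma> n - r)) \<longlonglongrightarrow> drift u x r"
    by (rule right_average_tendsto[OF N(3)]) blast
  \<comment> \<open>The endpoint \<open>b\<close> joins the exceptional times because the argument
    uses quotients from the right.\<close>
  define N' where "N' = N \<union> N1 \<union> N2 \<union> N3 \<union> {b}"
  have N': "negligible N'" unfolding N'_def by (intro negligible_Un N(1) N1(1) N2(1) N3(1)) simp
  have "rate x r = drift u x r + lincomb g (rate u r) (x r)" if r: "r \<in> {a..b} - N'" for r
  proof -
    have rr: "r \<in> {a..b} - N" "r \<in> {a..b} - N1" "r \<in> {a..b} - N2" "r \<in> {a..<b} - N3" "r \<in> {a..b}" "r < b"
      using r by (auto simp: N'_def)
    obtain \<sigma> where \<sigma>: "\<And>n. \<sigma> n \<in> {r<..b} - N" "\<sigma> \<longlonglongrightarrow> r"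
      by (rule right_sequence_avoiding_negligible[OF N(1) rr(6)]) blast
    have \<sigma>': "\<sigma> n \<in> {a..b} - N" "\<sigma> n \<in> {r<..b}" "\<sigma> n \<in> {a..b} - {r}" "r \<le> \<sigma> n" "0 < \<sigma> n - r" for n
      using \<sigma>(1)[of n] rr(5) by auto
    have along: "(\<lambda>n. (F (\<sigma> n) - F r) /\<^sub>R (\<sigma> n - r)) \<longlonglongrightarrow> D"
      if "(F has_vector_derivative D) (at r within {a..b})" for F :: "real \<Rightarrow> real^'n" and D
      using has_vector_derivative_quotient[OF that] \<sigma>'(3) \<sigma>(2)
      unfolding tendsto_at_iff_sequentially o_def by blast
    \<comment> \<open>The flow defect over \<open>[r, \<sigma> n]\<close> divided by its length. As
      a combination of three quotients it tends to the defect of the differential equation at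
      \<open>r\<close>; the estimate forces it to zero, since the average of
      \<open>norm (u (\<sigma> n) - u q)\<close> vanishes by continuity of \<open>u\<close>.\<close>
    define E where "E n = (x (\<sigma> n) - \<Psi> (x r) (u (\<sigma> n) - u r) - integral {r..\<sigma> n} (drift u x)) /\<^sub>R (\<sigma> n - r)" for n
    have "(\<lambda>n. (x (\<sigma> n) - x r) /\<^sub>R (\<sigma> n - r) - (\<Psi> (x r) (u (\<sigma> n) - u r) - \<Psi> (x r) (u r - u r)) /\<^sub>R (\<sigma> n - r)
        - integral {r..\<sigma> n} (drift u x) /\<^sub>R (\<sigma> n - r)) \<longlonglongrightarrow> rate x r - lincomb g (rate u r) (x r) - drift u x r"
      by (intro tendsto_diff along N2(2) rr N3(2) \<Psi>_along_control N1(2) \<sigma>' \<sigma>(2))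
    moreover have "(x (\<sigma> n) - x r) /\<^sub>R (\<sigma> n - r) - (\<Psi> (x r) (u (\<sigma> n) - u r) - \<Psi> (x r) (u r - u r)) /\<^sub>R (\<sigma> n - r)
        - integral {r..\<sigma> n} (drift u x) /\<^sub>R (\<sigma> n - r) = E n" for n
      by (simp add: E_def scaleR_diff_right)
    ultimately have E1: "E \<longlonglongrightarrow> rate x r - lincomb g (rate u r) (x r) - drift u x r" by (simp add: E_def[abs_def])
    have "E \<longlonglongrightarrow> 0"
      unfolding LIMSEQ_iff
    proof (intro allI impI)
      fix e :: real assume "0 < e"
      \<comment> \<open>The summand 1 covers \<open>K = 0\<close> and makes the final inequality
        strict.\<close>
      define \<epsilon> where "\<epsilon> = e / (2 * K + 1)"
      have \<epsilon>: "\<epsilon> > 0" "K * (2 * \<epsilon>) < e"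
      proof -
        have "2 * K + 1 > 0" using N(2) by simp
        then show "\<epsilon> > 0" using \<open>0 < e\<close> by (simp add: \<epsilon>_def)
        have "(2 * K + 1) * \<epsilon> = e" using \<open>2 * K + 1 > 0\<close> by (simp add: \<epsilon>_def)
        then show "K * (2 * \<epsilon>) < e" using \<open>\<epsilon> > 0\<close> by (simp add: algebra_simps)
      qed
      obtain d where d: "d > 0" "\<And>q. q \<in> {a..b} \<Longrightarrow> dist q r < d \<Longrightarrow> dist (u q) (u r) < \<epsilon>"
        using abs_continuous_on_imp_continuous[OF u] rr(5) \<epsilon>(1) unfolding continuous_on_iff by blast
      obtain n0 where n0: "\<And>n. n \<ge> n0 \<Longrightarrow> norm (\<sigma> n - r) < d" using \<sigma>(2) d(1) unfolding LIMSEQ_iff by blast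
      have "norm (E n - 0) < e" if n: "n \<ge> n0" for n
      proof -
        have sub: "{r..\<sigma> n} \<subseteq> {a..b}" using \<sigma>'(1)[of n] rr(5) by auto
        have small: "norm (u q - u r) < \<epsilon>" if "q \<in> {r..\<sigma> n}" for q
        proof -
          have "q \<in> {a..b}" using that sub by blast
          moreover have "dist q r < d" using that n0[OF n] by (auto simp: dist_real_def)
          ultimately show ?thesis using d(2) by (simp add: dist_norm)
        qed
        have "integral {r..\<sigma> n} (\<lambda>q. norm (u (\<sigma> n) - u q)) \<le> integral {r..\<sigma> n} (\<lambda>_. 2 * \<epsilon>)"
        proof (rule integral_le)
          show "(\<lambda>q. norm (u (\<sigma> n) - u q)) integrable_on {r..\<sigma> n}"
            using abs_continuous_on_imp_continuous[OF u] sub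
            by (intro integrable_continuous_interval continuous_intros) (auto intro: continuous_on_subset)
          show "norm (u (\<sigma> n) - u q) \<le> 2 * \<epsilon>" if "q \<in> {r..\<sigma> n}" for q
            using small[OF that] small[of "\<sigma> n"] norm_triangle_ineq4[of "u (\<sigma> n) - u r" "u q - u r"] \<sigma>'(4)[of n] by auto
        qed (rule integrable_const_ivl)
        also have "\<dots> = 2 * \<epsilon> * (\<sigma> n - r)" using \<sigma>'(4)[of n] by simp
        finally have "K * integral {r..\<sigma> n} (\<lambda>q. norm (u (\<sigma> n) - u q)) \<le> K * (2 * \<epsilon> * (\<sigma> n - r))"
          using N(2) by (rule mult_left_mono)
        from order_trans[OF N(4)[OF rr(1) \<sigma>'(1)[of n] \<sigma>'(4)[of n]] this]
        have le: "norm (x (\<sigma> n) - \<Psi> (x r) (u (\<sigma> n) - u r) - integral {r..\<sigma> n} (drift u x)) \<le> K * (2 * \<epsilon>) * (\<sigma> n - r)"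
          by (simp add: mult.assoc)
        have "norm (E n) = norm (x (\<sigma> n) - \<Psi> (x r) (u (\<sigma> n) - u r) - integral {r..\<sigma> n} (drift u x)) / (\<sigma> n - r)"
          unfolding E_def norm_scaleR using \<sigma>'(5)[of n] by (simp add: divide_inverse mult.commute)
        then have "norm (E n) \<le> K * (2 * \<epsilon>)"
          using le by (simp only: pos_divide_le_eq[OF \<sigma>'(5)])
        then show ?thesis using \<epsilon>(2) by simp
      qed
      then show "\<exists>no. \<forall>n\<ge>no. norm (E n - 0) < e" by blast
    qed
    then have "rate x r - lincomb g (rate u r) (x r) - drift u x r = 0" using E1 LIMSEQ_unique by blast
    then show ?thesis by (simp add: algebra_simps)
  qed
  note rate_x = this
  have "\<forall>t\<in>{a..b} - N'. (u has_vector_derivative rate u t) (at t within {a..b}) \<and>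
        (x has_vector_derivative drift u x t + lincomb g (rate u t) (x t)) (at t within {a..b})"
  proof
    fix t assume t: "t \<in> {a..b} - N'"
    then have "t \<in> {a..b} - N1" "t \<in> {a..b} - N2" by (auto simp: N'_def)
    from N1(2)[OF this(1)] N2(2)[OF this(2)]
    show "(u has_vector_derivative rate u t) (at t within {a..b}) \<and>
        (x has_vector_derivative drift u x t + lincomb g (rate u t) (x t)) (at t within {a..b})"
      unfolding rate_x[OF t] by blast
  qed
  then show ?thesis unfolding solution_iff using x N(5) N' by blast
qed

end

section \<open>Limit solutions for inputs of bounded variation\<close>

lemma integral_subinterval_eq_diff:
  fixes q :: "real \<Rightarrow> 'c::banach"
  assumes "q integrable_on {a..b}" "a \<le> s" "s \<le> t" "t \<le> b"
  shows "integral {s..t} q = integral {a..t} q - integral {a..s} q"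
  using Henstock_Kurzweil_Integration.integral_combine[OF assms(2,3) integrable_on_subinterval[OF assms(1)]] assms
  by (auto simp: algebra_simps)

lemma (in C1_fields) lincomb_tendsto:
  assumes "zk \<longlonglongrightarrow> z" "pk \<longlonglongrightarrow> p"
  shows "(\<lambda>k. lincomb g (zk k) (pk k)) \<longlonglongrightarrow> lincomb g z p"
  unfolding lincomb_def
  by (intro tendsto_sum tendsto_scaleR tendsto_vec_nth assms isCont_tendsto_compose[OF has_derivative_continuous[OF deriv]])

context affine_control_system
begin

text \<open>Over the step the state moves by at most a multiple of \<open>t - s\<close> plus a
  multiple of the variation of \<open>u\<close>. Freezing the fields at the initial state costs this
  displacement times \<open>L\<close> times the variation, whence the quadratic term.\<close>

lemma euler_step_error:
  assumes "0 \<le> B"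
  obtains L where "L \<ge> 0"
    "\<And>x y z. norm x \<le> B \<Longrightarrow> norm y \<le> B \<Longrightarrow> norm (lincomb g z x - lincomb g z y) \<le> L * norm z * norm (x - y)"
    "\<And>u y s t. \<lbrakk>abs_continuous_on {a..b} u; solution u y; \<And>t. t \<in> {a..b} \<Longrightarrow> norm (y t) \<le> B;
       \<And>t. t \<in> {a..b} \<Longrightarrow> norm (u t) \<le> R; a \<le> s; s \<le> t; t \<le> b\<rbrakk> \<Longrightarrow>
       norm (y t - y s - integral {s..t} (drift u y) - lincomb g (u t - u s) (y s))
         \<le> L * integral {s..t} (\<lambda>r. norm (rate u r)) *
            (M * (1 + B + R) * (t - s) + CARD('m) * M * (1 + B) * integral {s..t} (\<lambda>r. norm (rate u r)))"
proof -
  obtain L where L: "L \<ge> 0"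
    "\<And>z x y. norm x \<le> B \<Longrightarrow> norm y \<le> B \<Longrightarrow> norm (lincomb g z x - lincomb g z y) \<le> L * norm z * norm (x - y)"
    by (rule lincomb_lipschitz[of B]) blast
  show thesis
  proof (rule that[OF L])
    fix u y s t
    assume u: "abs_continuous_on {a..b} u" and sol: "solution u y"
      and yB: "\<And>t. t \<in> {a..b} \<Longrightarrow> norm (y t) \<le> B" and uR: "\<And>t. t \<in> {a..b} \<Longrightarrow> norm (u t) \<le> R"
      and st: "a \<le> s" "s \<le> t" "t \<le> b"
    obtain N where "regular_solution g g' M a b f V v x\<^sub>0 u y N"
      using regular_solution_exists[OF sol u] by blast
    then interpret s: regular_solution g g' M a b f V v x\<^sub>0 u y N .
    have sub: "{p..q} \<subseteq> {a..b}" if "s \<le> p" "q \<le> t" for p q using st that by auto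
    \<comment> \<open>The variation of \<open>u\<close> over the step, as the integral of its
      speed.\<close>
    define W where "W = integral {s..t} (\<lambda>r. norm (rate u r))"
    define F where "F = M * (1 + B + R)"
    define Kg where "Kg = CARD('m) * M * (1 + B)"
    have "B \<ge> 0" "R \<ge> 0" using yB[of a] uR[of a] norm_ge_zero[of "y a"] norm_ge_zero[of "u a"] ab by (auto simp del: norm_ge_zero)
    then have nn: "F \<ge> 0" "Kg \<ge> 0" using M by (auto simp: F_def Kg_def)
    have ri: "(\<lambda>r. norm (rate u r)) integrable_on {p..q}" if "s \<le> p" "q \<le> t" for p q
      using s.u.absolutely_integrable sub[OF that] by (auto simp: absolutely_integrable_on_def intro: integrable_on_subinterval)
    have di: "drift u y integrable_on {p..q}" if "s \<le> p" "q \<le> t" for p q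
      using s.drift_integrable sub[OF that] by (auto simp: absolutely_integrable_on_def intro: integrable_on_subinterval)
    have step: "norm (y q - y s) \<le> F * (t - s) + Kg * W" if q: "q \<in> {s..t}" for q
    proof -
      let ?d = "\<lambda>r. drift u y r + lincomb g (rate u r) (y r)"
      have int: "(?d has_integral y q - y s) {s..q}"
        using q st by (intro s.x.has_integral_subinterval) auto
      have "norm (integral {s..q} ?d) \<le> integral {s..q} (\<lambda>r. F + Kg * norm (rate u r))"
      proof (rule integral_norm_bound_ae[OF _ _ s.N])
        show "?d integrable_on {s..q}" using int by (auto simp: integrable_on_def)
        show "(\<lambda>r. F + Kg * norm (rate u r)) integrable_on {s..q}"
          using q by (intro integrable_add integrable_const_ivl integrable_on_mult_right ri) auto
        fix r assume r: "r \<in> {s..q} - N"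
        then have r': "r \<in> {a..b} - N" using sub[of s q] q by auto
        have "norm (drift u y r) \<le> F"
          unfolding F_def using r' by (intro s.drift_bounded yB uR) auto
        moreover have "norm (lincomb g (rate u r) (y r)) \<le> Kg * norm (rate u r)"
          unfolding Kg_def using r' by (intro lincomb_bounded yB) auto
        ultimately show "norm (?d r) \<le> F + Kg * norm (rate u r)" by (rule norm_triangle_mono)
      qed
      also have "\<dots> = F * (q - s) + Kg * integral {s..q} (\<lambda>r. norm (rate u r))"
        using q by (subst integral_add) (auto intro!: integrable_on_mult_right ri integrable_const_ivl)
      also have "\<dots> \<le> F * (t - s) + Kg * W"
        unfolding W_def using q nn by (intro add_mono mult_left_mono integral_subset_le ri) auto
      finally show ?thesis using integral_unique[OF int] by simp
    qed
    \<comment> \<open>The integrand of the Euler error: the control term minus the same term with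
      the state frozen at \<open>s\<close>.\<close>
    let ?e = "\<lambda>r. lincomb g (rate u r) (y r) - lincomb g (rate u r) (y s)"
    have i1: "((\<lambda>r. drift u y r + lincomb g (rate u r) (y r)) has_integral y t - y s) {s..t}"
      by (rule s.x.has_integral_subinterval[OF st])
    have i2: "((\<lambda>r. lincomb g (rate u r) (y s)) has_integral lincomb g (u t - u s) (y s)) {s..t}"
      using has_integral_linear[OF s.u.has_integral_subinterval[OF st] bounded_linear_lincomb] by (simp add: o_def)
    have i3: "(drift u y has_integral integral {s..t} (drift u y)) {s..t}"
      using di[of s t] by (simp add: integrable_integral)
    have i4: "(?e has_integral y t - y s - integral {s..t} (drift u y) - lincomb g (u t - u s) (y s)) {s..t}"
      using has_integral_diff[OF has_integral_diff[OF i1 i3] i2] by simp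
    have "norm (integral {s..t} ?e) \<le> integral {s..t} (\<lambda>r. L * (F * (t - s) + Kg * W) * norm (rate u r))"
    proof (rule integral_norm_bound_integral)
      show "?e integrable_on {s..t}" using i4 by (auto simp: integrable_on_def)
      show "(\<lambda>r. L * (F * (t - s) + Kg * W) * norm (rate u r)) integrable_on {s..t}"
        by (intro integrable_on_mult_right ri) auto
      fix r assume r: "r \<in> {s..t}"
      have "norm (?e r) \<le> L * norm (rate u r) * norm (y r - y s)"
        using r st by (intro L(2) yB) auto
      also have "\<dots> \<le> L * norm (rate u r) * (F * (t - s) + Kg * W)"
        using L(1) step[OF r] by (intro mult_left_mono) auto
      finally show "norm (?e r) \<le> L * (F * (t - s) + Kg * W) * norm (rate u r)" by (simp add: mult_ac)
    qed
    then show "norm (y t - y s - integral {s..t} (drift u y) - lincomb g (u t - u s) (y s))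
        \<le> L * integral {s..t} (\<lambda>r. norm (rate u r)) *
          (M * (1 + B + R) * (t - s) + CARD('m) * M * (1 + B) * integral {s..t} (\<lambda>r. norm (rate u r)))"
      unfolding integral_unique[OF i4] W_def[symmetric] F_def[symmetric] Kg_def[symmetric]
      by (simp add: W_def[symmetric] mult_ac)
  qed
qed

end

context affine_control_system
begin

theorem BV_limit_solution:
  assumes u: "abs_continuous_on {a..b} u" and R: "\<And>w. w \<in> U \<Longrightarrow> norm w \<le> R"
    and uU: "\<And>t. t \<in> {a..b} \<Longrightarrow> u t \<in> U" and x: "abs_continuous_on {a..b} x"
    and lim: "BV_simple_limit_solution a b f g U x\<^sub>0 u v x"
  shows "solution u x"
proof -
  have aab: "a \<in> {a..b}" using ab by simp
  obtain uk where ev: "equibounded_variation a b uk"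
    and app: "\<And>\<tau>. \<tau> \<in> {a..b} \<Longrightarrow> approximates_at a b f g U x\<^sub>0 u v x \<tau> uk"
    using lim unfolding BV_simple_limit_solution_def by blast
  obtain c where c: "\<And>k D. D division_of {a..b} \<Longrightarrow> (\<Sum>K\<in>D. norm (uk k (Sup K) - uk k (Inf K))) \<le> c"
    using ev unfolding equibounded_variation_def by blast
  obtain yk B where ukAC: "\<And>k. uk k \<in> AC {a..b} U" and ysol: "\<And>k. solution (uk k) (yk k)"
    and yB: "\<And>k t. t \<in> {a..b} \<Longrightarrow> norm (yk k t) \<le> B"
    using app[OF aab] unfolding approximates_at_def by blast
  have uAC: "abs_continuous_on {a..b} (uk k)" and uR: "t \<in> {a..b} \<Longrightarrow> norm (uk k t) \<le> R" for k t
    using ukAC[of k] R by (auto simp: AC_def)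
  have lims: "(\<lambda>k. (yk k t, uk k t)) \<longlonglongrightarrow> (x t, u t)" if t: "t \<in> {a..b}" for t
  proof -
    obtain zk where z: "\<And>k. solution (uk k) (zk k)"
      and pt: "point_L1_tendsto {a..b} t (\<lambda>k t. (zk k t, uk k t)) (\<lambda>t. (x t, u t))"
      using app[OF t] unfolding approximates_at_def by blast
    \<comment> \<open>States attached to another time solve the same problem with the same input.
      Uniqueness identifies them, so a single sequence of states converges at every time.\<close>
    have "zk k t = yk k t" for k by (rule solution_unique[OF uAC z ysol t])
    then show ?thesis using point_L1_tendsto_pointwise[OF pt] by simp
  qed
  have limx: "(\<lambda>k. yk k t) \<longlonglongrightarrow> x t" and limu: "(\<lambda>k. uk k t) \<longlonglongrightarrow> u t" if "t \<in> {a..b}" for t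
    using tendsto_fst[OF lims[OF that]] tendsto_snd[OF lims[OF that]] by auto
  have xB: "norm (x t) \<le> B" if "t \<in> {a..b}" for t
    by (rule Lim_bounded[OF tendsto_norm[OF limx[OF that]]]) (use yB that in auto)
  have uRt: "norm (u t) \<le> R" if "t \<in> {a..b}" for t using R uU that by blast
  have nn: "B \<ge> 0" "R \<ge> 0"
    using order_trans[OF norm_ge_zero xB[OF aab]] order_trans[OF norm_ge_zero uRt[OF aab]] by auto
  have x_init: "x a = x\<^sub>0"
  proof -
    have "yk k a = x\<^sub>0" for k using ysol[of k] by (simp add: solution_iff)
    then show ?thesis using limx[OF aab] LIMSEQ_unique[of "\<lambda>k. x\<^sub>0" x\<^sub>0 "x a"] by simp
  qed
  define F where "F = M * (1 + B + R)"
  define Kg where "Kg = CARD('m) * M * (1 + B)"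
  have FK: "F \<ge> 0" "Kg \<ge> 0" using nn M by (auto simp: F_def Kg_def)
  obtain L where L: "L \<ge> 0"
    "\<And>x y z. norm x \<le> B \<Longrightarrow> norm y \<le> B \<Longrightarrow> norm (lincomb g z x - lincomb g z y) \<le> L * norm z * norm (x - y)"
    "\<And>u y s t. \<lbrakk>abs_continuous_on {a..b} u; solution u y; \<And>t. t \<in> {a..b} \<Longrightarrow> norm (y t) \<le> B;
       \<And>t. t \<in> {a..b} \<Longrightarrow> norm (u t) \<le> R; a \<le> s; s \<le> t; t \<le> b\<rbrakk> \<Longrightarrow>
       norm (y t - y s - integral {s..t} (drift u y) - lincomb g (u t - u s) (y s))
         \<le> L * integral {s..t} (\<lambda>r. norm (rate u r)) *
            (F * (t - s) + Kg * integral {s..t} (\<lambda>r. norm (rate u r)))"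
    unfolding F_def Kg_def by (rule euler_step_error[OF nn(1), of R]) blast
  have dc: "drift u x integrable_on {s..t}"
    "(\<lambda>k. integral {s..t} (drift (uk k) (yk k))) \<longlonglongrightarrow> integral {s..t} (drift u x)"
    if "a \<le> s" "t \<le> b" for s t
  proof -
    have l: "(\<lambda>k. yk k t) \<longlonglongrightarrow> x t" "(\<lambda>k. uk k t) \<longlonglongrightarrow> u t" if "t \<in> {a..b} - {}" for t
      using limx limu that by auto
    show "drift u x integrable_on {s..t}"
      "(\<lambda>k. integral {s..t} (drift (uk k) (yk k))) \<longlonglongrightarrow> integral {s..t} (drift u x)"
      by (rule drift_convergence[where uk=uk and xk=yk and x=x and u=u,
          OF uAC ysol yB uR negligible_empty l that]; assumption)+
  qed
  obtain N1 where N1: "negligible N1"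
    "\<And>t. t \<in> {a..b} - N1 \<Longrightarrow> (u has_vector_derivative rate u t) (at t within {a..b})"
    by (rule abs_continuous_differentiable_ae[OF u]) blast
  interpret u: abs_continuous_derivative a b u "rate u" N1 by unfold_locales (use u N1 in auto)
  obtain N2 where N2: "negligible N2"
    "\<And>t. t \<in> {a..b} - N2 \<Longrightarrow> (x has_vector_derivative rate x t) (at t within {a..b})"
    by (rule abs_continuous_differentiable_ae[OF x]) blast
  interpret x: abs_continuous_derivative a b x "rate x" N2 by unfold_locales (use x N2 in auto)
  obtain NV where NV: "negligible NV" "\<And>t. t \<in> {a..b} - NV \<Longrightarrow> v t \<in> V"
    by (rule v_in_V_ae) blast
  have cu: "continuous_on {a..b} u" and cx: "continuous_on {a..b} x"
    using u x by (auto intro: abs_continuous_on_imp_continuous)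
  \<comment> \<open>The right-hand side that \<open>x\<close> has to satisfy.\<close>
  define q where "q r = drift u x r + lincomb g (rate u r) (x r)" for r
  have li: "(\<lambda>r. lincomb g (rate u r) (x r)) integrable_on {a..b}"
    using lincomb_absolutely_integrable[OF u.absolutely_integrable cx] by (simp add: absolutely_integrable_on_def)
  have qi: "q integrable_on {a..b}" unfolding q_def by (intro integrable_add dc(1) li) auto
  have nui: "(\<lambda>r. norm (rate u r)) integrable_on {a..b}"
    using u.absolutely_integrable by (simp add: absolutely_integrable_on_def)
  \<comment> \<open>The Euler error of the limit itself, which is the pointwise limit of the Euler
    errors of the approximations.\<close>
  define e where "e s t = norm (x t - x s - integral {s..t} (drift u x) - lincomb g (u t - u s) (x s))" for s t
  have drift_small: "norm (integral {s..t} (drift u x)) \<le> F * (t - s)" if st: "a \<le> s" "s \<le> t" "t \<le> b" for s t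
  proof -
    have "norm (integral {s..t} (drift u x)) \<le> integral {s..t} (\<lambda>_. F)"
    proof (rule integral_norm_bound_ae[OF dc(1)[OF st(1,3)] integrable_const_ivl NV(1)])
      show "norm (drift u x r) \<le> F" if "r \<in> {s..t} - NV" for r
        unfolding F_def using that st by (intro drift_bounded_at NV(2) xB uRt) auto
    qed
    also have "\<dots> = F * (t - s)" using st by simp
    finally show ?thesis .
  qed
  define Cu where "Cu = integral {a..b} (\<lambda>r. norm (rate u r))"
  \<comment> \<open>Constancy of \<open>P\<close> is the integrated form of the equation.\<close>
  define P where "P t = x t - integral {a..t} q" for t
  \<comment> \<open>The increment of \<open>P\<close> is the Euler error of \<open>x\<close> minus
    the error of freezing \<open>x\<close> in the integrated control term; the second is small
    because \<open>x\<close> oscillates by at most \<open>\<omega>\<close> on the step.\<close>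
  have P_step: "norm (P t - P s) \<le> e s t + L * \<omega> * integral {s..t} (\<lambda>r. norm (rate u r))"
    if st: "a \<le> s" "s \<le> t" "t \<le> b" and \<omega>: "\<And>r. r \<in> {s..t} \<Longrightarrow> norm (x r - x s) \<le> \<omega>" for s t \<omega>
  proof -
    have sub: "{s..t} \<subseteq> {a..b}" using st by auto
    let ?d = "\<lambda>r. lincomb g (rate u r) (x r) - lincomb g (rate u r) (x s)"
    have i1: "(q has_integral integral {s..t} q) {s..t}"
      by (intro integrable_integral integrable_on_subinterval[OF qi sub])
    have i2: "((\<lambda>r. lincomb g (rate u r) (x s)) has_integral lincomb g (u t - u s) (x s)) {s..t}"
      using has_integral_linear[OF u.has_integral_subinterval[OF st] bounded_linear_lincomb] by (simp add: o_def)
    have i3: "(drift u x has_integral integral {s..t} (drift u x)) {s..t}"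
      by (intro integrable_integral dc(1) st)
    have i4: "(?d has_integral integral {s..t} q - integral {s..t} (drift u x) - lincomb g (u t - u s) (x s)) {s..t}"
      using has_integral_diff[OF has_integral_diff[OF i1 i3] i2] by (simp add: q_def)
    have "norm (integral {s..t} ?d) \<le> integral {s..t} (\<lambda>r. L * \<omega> * norm (rate u r))"
    proof (rule integral_norm_bound_integral)
      show "?d integrable_on {s..t}" using i4 by (auto simp: integrable_on_def)
      show "(\<lambda>r. L * \<omega> * norm (rate u r)) integrable_on {s..t}"
        by (intro integrable_on_mult_right integrable_on_subinterval[OF nui sub])
      fix r assume r: "r \<in> {s..t}"
      have "norm (?d r) \<le> L * norm (rate u r) * norm (x r - x s)"
        using r st by (intro L(2) xB) auto
      also have "\<dots> \<le> L * norm (rate u r) * \<omega>"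
        using L(1) \<omega>[OF r] by (intro mult_left_mono) auto
      finally show "norm (?d r) \<le> L * \<omega> * norm (rate u r)" by (simp add: mult_ac)
    qed
    then have 1: "norm (integral {s..t} q - integral {s..t} (drift u x) - lincomb g (u t - u s) (x s))
        \<le> L * \<omega> * integral {s..t} (\<lambda>r. norm (rate u r))"
      unfolding integral_unique[OF i4] by simp
    have "P t - P s = (x t - x s - integral {s..t} (drift u x) - lincomb g (u t - u s) (x s))
        - (integral {s..t} q - integral {s..t} (drift u x) - lincomb g (u t - u s) (x s))"
      using integral_subinterval_eq_diff[OF qi st] by (simp add: P_def)
    then show ?thesis unfolding e_def using norm_triangle_ineq4 1 by (smt (verit))
  qed
  text \<open>Only boundedly many steps can carry variation above \<open>\<epsilon>\<close>; capping the error of a step at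
    \<open>\<rho>\<close> lets those be charged to the total variation too, uniformly in the index \<open>k\<close>.\<close>
  have capped: "(\<Sum>i<n. min (e (p i) (p (Suc i))) \<rho>) \<le> c * (\<rho> / \<epsilon> + L * (F * h + Kg * \<epsilon>))"
    if p: "\<And>i. i < n \<Longrightarrow> p i \<le> p (Suc i)" "\<And>i. i < n \<Longrightarrow> p (Suc i) - p i \<le> h" "\<And>i. i \<le> n \<Longrightarrow> p i \<in> {a..b}"
      and pos: "0 < \<epsilon>" "0 < \<rho>" "0 \<le> h" for p :: "nat \<Rightarrow> real" and n \<epsilon> \<rho> h
  proof -
    define ek where "ek k i = norm (yk k (p (Suc i)) - yk k (p i) - integral {p i..p (Suc i)} (drift (uk k) (yk k))
        - lincomb g (uk k (p (Suc i)) - uk k (p i)) (yk k (p i)))" for k i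
    have pab: "a \<le> p i" "p i \<le> b" "a \<le> p (Suc i)" "p (Suc i) \<le> b" if "i < n" for i
      using p(3)[of i] p(3)[of "Suc i"] that by auto
    have "(\<Sum>i<n. min (ek k i) \<rho>) \<le> c * (\<rho> / \<epsilon> + L * (F * h + Kg * \<epsilon>))" for k
    proof -
      obtain Nk where "regular_solution g g' M a b f V v x\<^sub>0 (uk k) (yk k) Nk"
        using regular_solution_exists[OF ysol uAC] by blast
      then interpret s: regular_solution g g' M a b f V v x\<^sub>0 "uk k" "yk k" Nk .
      let ?r = "\<lambda>r. norm (rate (uk k) r)"
      have ri: "?r integrable_on {a..b}" using s.u.absolutely_integrable by (simp add: absolutely_integrable_on_def)
      define W where "W i = integral {p i..p (Suc i)} ?r" for i
      \<comment> \<open>The cost per unit of variation: the first summand pays for steps of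
        variation above \<open>\<epsilon>\<close>, the second for the others.\<close>
      define A where "A = \<rho> / \<epsilon> + L * (F * h + Kg * \<epsilon>)"
      have A: "A \<ge> 0" using pos L(1) FK by (simp add: A_def)
      have "min (ek k i) \<rho> \<le> W i * A" if i: "i < n" for i
      proof -
        have "W i \<ge> 0" unfolding W_def
          using pab[OF i] by (intro integral_nonneg integrable_on_subinterval[OF ri]) auto
        show ?thesis
        proof (cases "W i \<le> \<epsilon>")
          case True
          have "ek k i \<le> L * W i * (F * (p (Suc i) - p i) + Kg * W i)"
            unfolding ek_def W_def using pab[OF i] p(1)[OF i] by (intro L(3) uAC ysol yB uR) auto
          also have "\<dots> \<le> L * W i * (F * h + Kg * \<epsilon>)"
            using L(1) \<open>W i \<ge> 0\<close> FK p(2)[OF i] True by (intro mult_left_mono add_mono) auto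
          also have "\<dots> \<le> W i * A"
          proof -
            have "0 \<le> W i * (\<rho> / \<epsilon>)" using \<open>W i \<ge> 0\<close> pos by simp
            then show ?thesis by (simp add: A_def algebra_simps)
          qed
          finally show ?thesis by simp
        next
          case False
          then have "\<rho> \<le> W i * (\<rho> / \<epsilon>)" using pos by (simp add: field_simps)
          also have "\<dots> \<le> W i * A"
            using \<open>W i \<ge> 0\<close> L(1) FK pos by (intro mult_left_mono) (auto simp: A_def)
          finally show ?thesis by simp
        qed
      qed
      then have "(\<Sum>i<n. min (ek k i) \<rho>) \<le> (\<Sum>i<n. W i * A)" by (intro sum_mono) auto
      also have "\<dots> = (\<Sum>i<n. W i) * A" by (simp add: sum_distrib_right)
      also have "(\<Sum>i<n. W i) = integral {a..p n} ?r - integral {a..p 0} ?r"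
      proof -
        have "(\<Sum>i<n. W i) = (\<Sum>i<n. integral {a..p (Suc i)} ?r - integral {a..p i} ?r)"
          unfolding W_def by (intro sum.cong refl integral_subinterval_eq_diff[OF ri]) (use pab p(1) in auto)
        then show ?thesis using sum_lessThan_telescope[of "\<lambda>i. integral {a..p i} ?r" n] by simp
      qed
      also have "(integral {a..p n} ?r - integral {a..p 0} ?r) * A \<le> c * A"
      proof (rule mult_right_mono[OF _ A])
        have "integral {a..p n} ?r \<le> integral {a..b} ?r"
          using p(3)[of n] by (intro integral_subset_le integrable_on_subinterval[OF ri] ri) auto
        also have "\<dots> \<le> c" using ab c by (intro s.u.integral_norm_le_variation) auto
        finally have "integral {a..p n} ?r \<le> c" .
        moreover have "0 \<le> integral {a..p 0} ?r"
          using p(3)[of 0] by (intro integral_nonneg integrable_on_subinterval[OF ri]) auto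
        ultimately show "integral {a..p n} ?r - integral {a..p 0} ?r \<le> c" by simp
      qed
      finally show ?thesis by (simp add: A_def)
    qed
    \<comment> \<open>The partition is fixed while \<open>k\<close> grows, so only finitely many
      terms pass to the limit.\<close>
    moreover have "(\<lambda>k. \<Sum>i<n. min (ek k i) \<rho>) \<longlonglongrightarrow> (\<Sum>i<n. min (e (p i) (p (Suc i))) \<rho>)"
      unfolding ek_def e_def
      by (intro tendsto_sum tendsto_min tendsto_const tendsto_norm tendsto_diff lincomb_tendsto limx limu dc(2))
         (use pab in auto)
    ultimately show ?thesis by (intro Lim_bounded) auto
  qed
  have "0 \<le> c"
  proof -
    have "{{a..b}} division_of {a..b}" using division_of_self[of a b] ab by simp
    from order_trans[OF sum_nonneg c[OF this]] show ?thesis by simp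
  qed
  have "0 \<le> Cu" unfolding Cu_def by (intro integral_nonneg nui) auto
  \<comment> \<open>The first summand collects the capped Euler errors, the second the freezing
    errors weighted by the variation \<open>Cu\<close> of \<open>u\<close>.\<close>
  define Q where "Q = c * (1 + L * (F + Kg)) + L * Cu"
  have P_small: "norm (P T - P a) \<le> \<epsilon> * Q" if T: "T \<in> {a..b}" and \<epsilon>: "0 < \<epsilon>" for T \<epsilon>
  proof -
    \<comment> \<open>The cap enters the bound as \<open>\<rho> / \<epsilon>\<close>, which is thus
      \<open>\<epsilon>\<close>.\<close>
    define \<rho> where "\<rho> = \<epsilon>\<^sup>2"
    have \<rho>: "\<rho> > 0" using \<epsilon> by (simp add: \<rho>_def)
    obtain d1 where d1: "d1 > 0" "\<And>s t. s \<in> {a..b} \<Longrightarrow> t \<in> {a..b} \<Longrightarrow> dist t s < d1 \<Longrightarrow> dist (x t) (x s) < min \<epsilon> (\<rho> / 3)"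
    proof -
      have "0 < min \<epsilon> (\<rho> / 3)" using \<rho> \<epsilon> by simp
      then show thesis
        using compact_uniformly_continuous[OF cx compact_Icc] that unfolding uniformly_continuous_on_def by blast
    qed
    obtain d2 where d2: "d2 > 0" "\<And>s t. s \<in> {a..b} \<Longrightarrow> t \<in> {a..b} \<Longrightarrow> dist t s < d2 \<Longrightarrow> dist (u t) (u s) < \<rho> / (3 * (Kg + 1))"
    proof -
      have "0 < \<rho> / (3 * (Kg + 1))" using \<rho> FK by simp
      then show thesis
        using compact_uniformly_continuous[OF cu compact_Icc] that unfolding uniformly_continuous_on_def by blast
    qed
    \<comment> \<open>Below this mesh each of the three parts of an Euler error of the limit is at
      most \<open>\<rho> / 3\<close>, and \<open>x\<close> oscillates by at most
      \<open>\<epsilon>\<close> on a step.\<close>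
    define \<delta> where "\<delta> = min (min d1 d2) (min \<epsilon> (\<rho> / (3 * (F + 1))))"
    have \<delta>: "\<delta> > 0" using d1 d2 \<epsilon> \<rho> FK by (simp add: \<delta>_def)
    obtain n :: nat where n: "(T - a) / \<delta> < real n" using reals_Archimedean2 by blast
    \<comment> \<open>The successor keeps the number of steps positive, even when
      \<open>T = a\<close>.\<close>
    define n' where "n' = Suc n"
    define h where "h = (T - a) / n'"
    have h: "0 \<le> h" "h < \<delta>"
    proof -
      show "0 \<le> h" using T by (simp add: h_def)
      have "(T - a) / \<delta> < real n'" using n by (simp add: n'_def)
      then have "T - a < real n' * \<delta>" using \<delta> by (simp add: pos_divide_less_eq)
      then show "h < \<delta>" by (simp add: h_def n'_def pos_divide_less_eq mult.commute)
    qed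
    define p where "p i = a + real i * h" for i :: nat
    have p0: "p 0 = a" by (simp add: p_def)
    have pn: "p n' = T" by (simp add: p_def h_def n'_def)
    have psuc: "p (Suc i) - p i = h" for i by (simp add: p_def algebra_simps)
    have pab: "p i \<in> {a..b}" if "i \<le> n'" for i
    proof -
      have "real i * h \<le> real n' * h" using that h by (intro mult_right_mono) auto
      then have "p i \<le> T" using pn by (simp add: p_def)
      then show ?thesis using T h(1) by (simp add: p_def)
    qed
    have pmono: "p i \<le> p (Suc i)" for i using psuc[of i] h by simp
    have close: "norm (x r - x (p i)) \<le> \<epsilon>" if "r \<in> {p i..p (Suc i)}" "i < n'" for r i
    proof -
      have "dist r (p i) < d1" using that psuc[of i] h by (auto simp: dist_real_def \<delta>_def)
      moreover have "r \<in> {a..b}" using that pab[of i] pab[of "Suc i"] by auto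
      ultimately show ?thesis using d1(2)[of "p i" r] pab[of i] that by (simp add: dist_norm)
    qed
    have e_small: "e (p i) (p (Suc i)) \<le> \<rho>" if i: "i < n'" for i
    proof -
      have pi: "p i \<in> {a..b}" "p (Suc i) \<in> {a..b}" using pab i by auto
      have dd: "dist (p (Suc i)) (p i) < d1" "dist (p (Suc i)) (p i) < d2"
        using psuc[of i] h by (auto simp: dist_real_def \<delta>_def)
      have 1: "norm (x (p (Suc i)) - x (p i)) \<le> \<rho> / 3"
        using d1(2)[OF pi dd(1)] by (simp add: dist_norm)
      have 2: "norm (integral {p i..p (Suc i)} (drift u x)) \<le> \<rho> / 3"
      proof -
        have "norm (integral {p i..p (Suc i)} (drift u x)) \<le> F * h"
          using drift_small[of "p i" "p (Suc i)"] pi pmono psuc[of i] by simp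
        also have "\<dots> \<le> (F + 1) * (\<rho> / (3 * (F + 1)))"
          using h FK by (intro mult_mono) (auto simp: \<delta>_def)
        also have "\<dots> = \<rho> / 3" using FK by (simp add: field_simps)
        finally show ?thesis .
      qed
      have 3: "norm (lincomb g (u (p (Suc i)) - u (p i)) (x (p i))) \<le> \<rho> / 3"
      proof -
        have "norm (lincomb g (u (p (Suc i)) - u (p i)) (x (p i))) \<le> Kg * norm (u (p (Suc i)) - u (p i))"
          unfolding Kg_def by (rule lincomb_bounded[OF xB[OF pi(1)]])
        also have "\<dots> \<le> (Kg + 1) * (\<rho> / (3 * (Kg + 1)))"
          using d2(2)[OF pi dd(2)] FK by (intro mult_mono) (auto simp: dist_norm)
        also have "\<dots> = \<rho> / 3" using FK by (simp add: field_simps)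
        finally show ?thesis .
      qed
      have "e (p i) (p (Suc i)) \<le> \<rho> / 3 + \<rho> / 3 + \<rho> / 3"
        unfolding e_def
        by (rule order_trans[OF norm_triangle_ineq4 add_mono[OF order_trans[OF norm_triangle_ineq4 add_mono[OF 1 2]] 3]])
      then show ?thesis by simp
    qed
    have "norm (P T - P a) = norm (\<Sum>i<n'. P (p (Suc i)) - P (p i))"
      using sum_lessThan_telescope[of "\<lambda>i. P (p i)" n'] pn p0 by simp
    also have "\<dots> \<le> (\<Sum>i<n'. e (p i) (p (Suc i)) + L * \<epsilon> * integral {p i..p (Suc i)} (\<lambda>r. norm (rate u r)))"
    proof (rule sum_norm_le)
      fix i assume "i \<in> {..<n'}"
      then have i: "i < n'" by simp
      show "norm (P (p (Suc i)) - P (p i)) \<le> e (p i) (p (Suc i)) + L * \<epsilon> * integral {p i..p (Suc i)} (\<lambda>r. norm (rate u r))"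
        using pab[of i] pab[of "Suc i"] i pmono close by (intro P_step) auto
    qed
    also have "\<dots> = (\<Sum>i<n'. e (p i) (p (Suc i))) + L * \<epsilon> * (\<Sum>i<n'. integral {p i..p (Suc i)} (\<lambda>r. norm (rate u r)))"
      by (simp add: sum.distrib sum_distrib_left)
    \<comment> \<open>The errors of the limit never exceed the cap, so the capped bound applies to
      the errors themselves.\<close>
    also have "(\<Sum>i<n'. e (p i) (p (Suc i))) = (\<Sum>i<n'. min (e (p i) (p (Suc i))) \<rho>)"
      using e_small by (intro sum.cong) auto
    also have "\<dots> \<le> c * (\<rho> / \<epsilon> + L * (F * h + Kg * \<epsilon>))"
      using pab pmono psuc h \<epsilon> \<rho> by (intro capped) auto
    also have "\<dots> \<le> c * (\<epsilon> + L * (F * \<epsilon> + Kg * \<epsilon>))"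
    proof -
      have "\<rho> / \<epsilon> = \<epsilon>" using \<epsilon> by (simp add: \<rho>_def power2_eq_square)
      moreover have "F * h \<le> F * \<epsilon>" using h FK by (intro mult_left_mono) (auto simp: \<delta>_def)
      then have "L * (F * h + Kg * \<epsilon>) \<le> L * (F * \<epsilon> + Kg * \<epsilon>)"
        by (intro mult_left_mono[OF add_right_mono] L(1))
      ultimately have "\<rho> / \<epsilon> + L * (F * h + Kg * \<epsilon>) \<le> \<epsilon> + L * (F * \<epsilon> + Kg * \<epsilon>)" by simp
      then show ?thesis using \<open>0 \<le> c\<close> by (rule mult_left_mono)
    qed
    also have "(\<Sum>i<n'. integral {p i..p (Suc i)} (\<lambda>r. norm (rate u r))) \<le> Cu"
    proof -
      have "(\<Sum>i<n'. integral {p i..p (Suc i)} (\<lambda>r. norm (rate u r)))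
          = (\<Sum>i<n'. integral {a..p (Suc i)} (\<lambda>r. norm (rate u r)) - integral {a..p i} (\<lambda>r. norm (rate u r)))"
        using pab pmono by (intro sum.cong refl integral_subinterval_eq_diff[OF nui]) (auto simp: Suc_le_eq)
      also have "\<dots> = integral {a..T} (\<lambda>r. norm (rate u r))" 
        using sum_lessThan_telescope[of "\<lambda>i. integral {a..p i} (\<lambda>r. norm (rate u r))" n'] pn p0 by simp
      also have "\<dots> \<le> Cu"
        unfolding Cu_def using T by (intro integral_subset_le integrable_on_subinterval[OF nui] nui) auto
      finally show ?thesis .
    qed
    finally have "norm (P T - P a) \<le> c * (\<epsilon> + L * (F * \<epsilon> + Kg * \<epsilon>)) + L * \<epsilon> * Cu"
      using L(1) \<epsilon> by (simp add: mult_left_mono)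
    then show ?thesis by (simp add: Q_def algebra_simps)
  qed
  have P_const: "P T = P a" if T: "T \<in> {a..b}" for T
  proof -
    have "0 \<le> Q" using \<open>0 \<le> c\<close> \<open>0 \<le> Cu\<close> L(1) FK by (simp add: Q_def)
    have "norm (P T - P a) \<le> 0 + \<eta>" if "0 < \<eta>" for \<eta>
    proof -
      have "norm (P T - P a) \<le> \<eta> / (Q + 1) * Q"
        using \<open>0 \<le> Q\<close> that by (intro P_small[OF T]) auto
      also have "\<dots> \<le> \<eta>" using \<open>0 \<le> Q\<close> that by (simp add: field_simps)
      finally show ?thesis by simp
    qed
    then have "norm (P T - P a) \<le> 0" by (rule field_le_epsilon)
    then show ?thesis by simp
  qed
  \<comment> \<open>Constancy of \<open>P\<close> makes all integrals of \<open>E\<close> over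
    subintervals vanish, and differentiation of the integral then gives \<open>E = 0\<close> almost
    everywhere.\<close>
  define E where "E r = rate x r - q r" for r
  have Ei: "E integrable_on {a..b}"
    unfolding E_def using x.absolutely_integrable
    by (intro integrable_diff qi) (simp add: absolutely_integrable_on_def)
  have E0: "integral {s..t} E = 0" if st: "a \<le> s" "s \<le> t" "t \<le> b" for s t
  proof -
    have "integral {s..t} E = integral {s..t} (rate x) - integral {s..t} q"
      unfolding E_def using x.has_integral_subinterval[OF st] st
      by (intro integral_diff integrable_on_subinterval[OF qi]) (auto simp: integrable_on_def)
    also have "\<dots> = (x t - x s) - (integral {a..t} q - integral {a..s} q)"
      using integral_unique[OF x.has_integral_subinterval[OF st]] integral_subinterval_eq_diff[OF qi st] by simp
    also have "\<dots> = P t - P s" by (simp add: P_def)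
    also have "\<dots> = 0"
    proof -
      have "s \<in> {a..b}" "t \<in> {a..b}" using st by auto
      then show ?thesis by (simp only: P_const[of s] P_const[of t] diff_self)
    qed
    finally show ?thesis .
  qed
  obtain N3 where N3: "negligible N3"
    "\<And>r \<sigma>. r \<in> {a..<b} - N3 \<Longrightarrow> (\<And>n. \<sigma> n \<in> {r<..b}) \<Longrightarrow> \<sigma> \<longlonglongrightarrow> r \<Longrightarrow>
       (\<lambda>n. integral {r..\<sigma> n} E /\<^sub>R (\<sigma> n - r)) \<longlonglongrightarrow> E r"
    by (rule right_average_tendsto[OF Ei]) blast
  have Ezero: "E r = 0" if r: "r \<in> {a..<b} - N3" for r
  proof -
    have "r < b" using r by simp
    obtain \<sigma> where \<sigma>: "\<And>n. \<sigma> n \<in> {r<..b} - {}" "\<sigma> \<longlonglongrightarrow> r"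
      by (rule right_sequence_avoiding_negligible[OF negligible_empty \<open>r < b\<close>]) blast
    have "integral {r..\<sigma> n} E = 0" for n using \<sigma>(1)[of n] r by (intro E0) auto
    moreover have "(\<lambda>n. integral {r..\<sigma> n} E /\<^sub>R (\<sigma> n - r)) \<longlonglongrightarrow> E r"
      using \<sigma> by (intro N3(2) r) auto
    ultimately show ?thesis using LIMSEQ_unique[of "\<lambda>n. 0" 0 "E r"] by simp
  qed
  have "negligible (N1 \<union> N2 \<union> N3 \<union> {b})" by (intro negligible_Un N1(1) N2(1) N3(1)) simp
  moreover have "(u has_vector_derivative rate u t) (at t within {a..b}) \<and>
        (x has_vector_derivative drift u x t + lincomb g (rate u t) (x t)) (at t within {a..b})"
    if t: "t \<in> {a..b} - (N1 \<union> N2 \<union> N3 \<union> {b})" for t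
  proof -
    have "t \<in> {a..b} - N1" "t \<in> {a..b} - N2" "t \<in> {a..<b} - N3" using t by auto
    moreover from Ezero[OF this(3)] have "rate x t = drift u x t + lincomb g (rate u t) (x t)"
      by (simp add: E_def q_def)
    ultimately show ?thesis using N1(2) N2(2) by metis
  qed
  ultimately show ?thesis unfolding solution_iff using x x_init by blast
qed

end

section \<open>From the hypotheses to the flows, and the final assembly\<close>

lemma (in affine_control_system) bracket_commute:
  assumes "lie_bracket (g \<alpha>) (g \<beta>) x = 0"
  shows "g' \<beta> x (g \<alpha> x) = g' \<alpha> x (g \<beta> x)"
proof -
  have "frechet_derivative (g \<gamma>) (at x) = blinfun_apply (g' \<gamma> x)" for \<gamma>
    using frechet_derivative_at[OF deriv] by simp
  then show ?thesis using assms by (simp add: lie_bracket_def)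
qed

text \<open>Completeness supplies a global orbit of each field through each point; a choice of these
  orbits gives the flows to be composed.\<close>

lemma (in affine_control_system) commuting_solution:
  assumes u: "abs_continuous_on {a..b} u" and R: "\<And>w. w \<in> U \<Longrightarrow> norm w \<le> R" "0 \<le> R"
    and uU: "\<And>t. t \<in> {a..b} \<Longrightarrow> u t \<in> U" and cc: "commuting_complete g"
    and lim: "limit_solution a b f g U x\<^sub>0 u v x"
  shows "solution u x"
proof -
  define \<phi> where "\<phi> \<alpha> p = (SOME y. y 0 = p \<and> (\<forall>t. (y has_vector_derivative g \<alpha> (y t)) (at t)))" for \<alpha> p
  have "\<exists>y. y 0 = p \<and> (\<forall>t. (y has_vector_derivative g \<alpha> (y t)) (at t))" for \<alpha> p
    using cc unfolding commuting_complete_def complete_field_def by blast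
  then have \<phi>: "\<phi> \<alpha> p 0 = p \<and> (\<forall>t. (\<phi> \<alpha> p has_vector_derivative g \<alpha> (\<phi> \<alpha> p t)) (at t))" for \<alpha> p
    unfolding \<phi>_def by (rule someI_ex)
  have "commuting_flows g g' M \<phi>"
    using cc \<phi> by unfold_locales (auto simp: commuting_complete_def intro: bracket_commute)
  then obtain \<Psi> where "product_flow g g' M \<Psi>" using commuting_flows.product_flow_ex by blast
  then interpret product_flow g g' M \<Psi> .
  interpret commuting_system g g' M a b f V v x\<^sub>0 \<Psi> ..
  show ?thesis by (rule commuting_limit_solution[OF u R uU lim])
qed

theorem theorem2p2:
  fixes a b :: real
    and f :: "real \<Rightarrow> real^'n \<Rightarrow> real^'m \<Rightarrow> real^'l \<Rightarrow> real^'n"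
    and g :: "'m \<Rightarrow> real^'n \<Rightarrow> real^'n"
    and U :: "(real^'m) set" and V :: "(real^'l) set"
    and x\<^sub>0 :: "real^'n" and u :: "real \<Rightarrow> real^'m" and v :: "real \<Rightarrow> real^'l"
    and x :: "real \<Rightarrow> real^'n"
  assumes "a \<le> b"
    and "compact U" and "AC_approximable U"
    and "compact V"
    and f_measurable:
      "\<And>y w z. z \<in> V \<Longrightarrow> (\<lambda>t. f t y w z) \<in> borel_measurable (lebesgue_on {a..b})"
    and f_continuous:
      "\<And>t. t \<in> {a..b} \<Longrightarrow> continuous_on (UNIV \<times> UNIV \<times> V) (\<lambda>(y, w, z). f t y w z)"
    and f_locally_lipschitz:
      "\<And>p. \<exists>r>0. \<exists>L. \<forall>t\<in>{a..b}. \<forall>z\<in>V. L-lipschitz_on (ball p r) (\<lambda>(y, w). f t y w z)"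
    and g_C1: "\<And>\<alpha>. C1_field (g \<alpha>)"
    and linear_growth:
      "\<exists>M>0. \<forall>t\<in>{a..b}. \<forall>z\<in>V. \<forall>y w.
         norm (f t y w z, \<chi> \<alpha>. g \<alpha> y) \<le> M * (1 + norm (y, w))"
    and "u \<in> AC {a..b} U" and "v \<in> L1_rep {a..b} V"
    and "(commuting_complete g \<and> limit_solution a b f g U x\<^sub>0 u v x) \<or>
         (abs_continuous_on {a..b} x \<and> BV_simple_limit_solution a b f g U x\<^sub>0 u v x)"
  shows "caratheodory_solution a b f g x\<^sub>0 u v x \<and>
    (\<forall>y. caratheodory_solution a b f g x\<^sub>0 u v y \<longrightarrow> (\<forall>t\<in>{a..b}. y t = x t))"
proof (cases "a < b")
  case False
  \<comment> \<open>On a single point every almost everywhere condition is vacuous and only the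
    initial value carries information; it is read off from convergence at \<open>a\<close>.\<close>
  then have ba: "b = a" using \<open>a \<le> b\<close> by simp
  obtain uk where app: "approximates_at a b f g U x\<^sub>0 u v x a uk"
    using assms(12) ba unfolding limit_solution_def BV_simple_limit_solution_def by auto
  then obtain xk where xk: "\<And>k. caratheodory_solution a b f g x\<^sub>0 (uk k) v (xk k)"
    and pt: "point_L1_tendsto {a..b} a (\<lambda>k t. (xk k t, uk k t)) (\<lambda>t. (x t, u t))"
    unfolding approximates_at_def by blast
  have "xk k a = x\<^sub>0" for k using xk by (simp add: caratheodory_solution_def)
  then have xa: "x a = x\<^sub>0"
    using tendsto_fst[OF point_L1_tendsto_pointwise[OF pt]] LIMSEQ_unique[of "\<lambda>k. x\<^sub>0" x\<^sub>0 "x a"] by simp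
  have ac: "abs_continuous_on {a..b} x"
    by (rule abs_continuous_on_dominated[where C=1, OF abs_continuous_on_ident]) (simp add: ba)
  have ae: "AE t in lebesgue_on {a..b}. P t" for P
    unfolding AE_lebesgue_on_interval ba by (intro exI[of _ "{a}"]) simp
  have "caratheodory_solution a b f g x\<^sub>0 u v x"
    unfolding caratheodory_solution_def by (intro conjI ac xa ae)
  moreover have "y t = x t" if "caratheodory_solution a b f g x\<^sub>0 u v y" "t \<in> {a..b}" for y t
    using that xa ba by (simp add: caratheodory_solution_def)
  ultimately show ?thesis by blast
next
  case True
  have uU: "u t \<in> U" if "t \<in> {a..b}" for t
    using \<open>u \<in> AC {a..b} U\<close> that by (auto simp: AC_def)
  have u: "abs_continuous_on {a..b} u" using \<open>u \<in> AC {a..b} U\<close> by (simp add: AC_def)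
  have vV: "AE t in lebesgue_on {a..b}. v t \<in> V" using \<open>v \<in> L1_rep {a..b} V\<close> by (simp add: L1_rep_def)
  obtain R0 where R0: "\<And>w. w \<in> U \<Longrightarrow> norm w \<le> R0"
    using compact_imp_bounded[OF \<open>compact U\<close>] unfolding bounded_iff by blast
  have R: "norm w \<le> \<bar>R0\<bar>" if "w \<in> U" for w using R0[OF that] by simp
  \<comment> \<open>A point of \<open>V\<close> is required to extract the growth of the fields from
    the joint bound, where they occur only next to \<open>f\<close>.\<close>
  have "V \<noteq> {}"
  proof
    assume "V = {}"
    with vV obtain N where "negligible N" "\<forall>t\<in>{a..b} - N. False"
      unfolding AE_lebesgue_on_interval by blast
    moreover obtain t where "a < t" "t < b" "t \<notin> N"
      by (rule interval_point_avoiding_negligible[OF \<open>negligible N\<close> True])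
    ultimately show False by auto
  qed
  then obtain z\<^sub>0 where z0: "z\<^sub>0 \<in> V" by blast
  obtain M where M: "M > 0" "\<And>t z y w. t \<in> {a..b} \<Longrightarrow> z \<in> V \<Longrightarrow> norm (f t y w z, \<chi> \<alpha>. g \<alpha> y) \<le> M * (1 + norm (y, w))"
    using linear_growth by blast
  have fg: "norm (f t y w z) \<le> M * (1 + norm (y, w))" if "t \<in> {a..b}" "z \<in> V" for t z y w
    using norm_fst_le[of "f t y w z" "\<chi> \<alpha>. g \<alpha> y"] M(2)[OF that, of y w] by linarith
  have gg: "norm (g \<alpha> y) \<le> M * (1 + norm y)" for \<alpha> y
  proof -
    have "norm (g \<alpha> y) \<le> norm (\<chi> \<alpha>. g \<alpha> y)"
      using Finite_Cartesian_Product.norm_nth_le[of "\<chi> \<alpha>. g \<alpha> y" \<alpha>] by simp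
    also have "\<dots> \<le> norm (f a y 0 z\<^sub>0, \<chi> \<alpha>. g \<alpha> y)" by (rule norm_snd_le)
    \<comment> \<open>The fields do not depend on the input value, so it is set to zero, which
      leaves growth in the state alone.\<close>
    also have "\<dots> \<le> M * (1 + norm (y, 0 :: real^'m))" by (rule M(2)[OF _ z0]) (use True in simp)
    finally show ?thesis by simp
  qed
  obtain g' where g': "\<And>\<alpha> x. (g \<alpha> has_derivative blinfun_apply (g' \<alpha> x)) (at x)" "\<And>\<alpha>. continuous_on UNIV (g' \<alpha>)"
    using g_C1 unfolding C1_field_def by metis
  interpret affine_control_system g g' M a b f V v x\<^sub>0
    by unfold_locales (use g' M(1) gg True vV f_continuous f_locally_lipschitz fg in auto)
  have sol: "solution u x"
    using assms(12)
  proof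
    assume "commuting_complete g \<and> limit_solution a b f g U x\<^sub>0 u v x"
    then show ?thesis using commuting_solution[OF u R _ uU] by simp
  next
    assume "abs_continuous_on {a..b} x \<and> BV_simple_limit_solution a b f g U x\<^sub>0 u v x"
    then show ?thesis using BV_limit_solution[OF u R uU] by blast
  qed
  then show ?thesis using solution_unique[OF u _ sol] by blast
qed

end
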